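(* Let $w$ be a periodic L\'evy white noise on $\mathbb{T}^d$. Then, for every $0<p,q\leq\infty$ and $\tau\in\mathbb{R}$ such that $$\tau<d\left(\frac{1}{\max(p,2)}-1\right),$$ we have $w\in B_{p,q}^{\tau}(\mathbb{T}^d)$ almost surely.
   Context: $\mathbb{T}^d=\mathbb{R}^d/\mathbb{Z}^d$ with normalized Lebesgue measure. $\mathcal{S}(\mathbb{T}^d)$ is the space of smooth periodic (real-valued) functions, $\mathcal{S}'(\mathbb{T}^d)$ its topological dual, $\langle u,\varphi\rangle$ the (bilinear) duality product. The cylindrical $\sigma$-field $\mathcal{B}_c(\mathcal{S}'(\mathbb{T}^d))$ is generated by the sets $\{u : (\langle u,\varphi_1\rangle,\dots,\langle u,\varphi_N\rangle)\in B\}$ with $N\in\mathbb{N}$, $\varphi_i\in\mathcal{S}(\mathbb{T}^d)$, $B\subset\mathbb{R}^N$ Borel. A generalized periodic process is a measurable map $s$ from a probability space $(\Omega,\mathcal{F},\mathscr{P})$ to $(\mathcal{S}'(\mathbb{T}^d),\mathcal{B}_c(\mathcal{S}'(\mathbb{T}^d)))$; its characteristic functional is $\widehat{\mathscr{P}}_s(\varphi)=\mathbb{E}[e^{\mathrm{i}\langle s,\varphi\rangle}]$, $\varphi\in\mathcal{S}(\mathbb{T}^d)$. A L\'evy exponent is a function $f:\mathbb{R}\to\mathbb{C}$ which is the log-characteristic function of an infinitely divisible law, i.e. $$f(\xi)=\mathrm{i}\mu\xi-\frac{\sigma^2\xi^2}{2}+\int_{\mathbb{R}\setminus\{0\}}\left(e^{\mathrm{i}\xi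 t}-1-\mathrm{i}\xi t1_{|t|\leq1}\right)V(\mathrm{d}t)$$ with $\mu\in\mathbb{R}$, $\sigma^2\geq0$ and $V$ a Radon measure on $\mathbb{R}\setminus\{0\}$ with $\int\min(1,t^2)V(\mathrm{d}t)<\infty$. A periodic L\'evy white noise is a generalized periodic process $w$ with $\widehat{\mathscr{P}}_w(\varphi)=\exp\left(\int_{\mathbb{T}^d}f(\varphi(\mathbf{r}))\,\mathrm{d}\mathbf{r}\right)$ for all $\varphi\in\mathcal{S}(\mathbb{T}^d)$, for some L\'evy exponent $f$. Wavelets: for $u\in\mathbb{N}$, a wavelet system of regularity $u$ is obtained from real compactly supported $\psi_F,\psi_M\in C^u(\mathbb{R})$ (scaling function and orthonormal Daubechies-type wavelet, $\psi_M$ having vanishing moments up to order $u-1$). $G^0=\{F,M\}^d$ and, for $j\geq1$, $G^j$ is the set of $G\in\{F,M\}^d$ with at least one component equal to $M$. $L\in\mathbb{N}$ is fixed large enough that the scale-$0$ wavelets are supported within the torus, $\mathbb{P}_j^d=\{m\in\mathbb{Z}^d : 0\leq m_k<2^{j+L},\ 1\leq k\leq d\}$, and $\Psi_{G,m}^{j,\mathrm{per}}$ is the $\mathbb{Z}^d$-periodization of $2^{(j+L)d/2}\prod_{a=1}^d\psi_{G_a}(2^{j+L}x_a-m_a)$. The family $\{\Psi_{G,m}^{j,\mathrm{per}} : j\in\mathbb{N}_0,\ G\in G^j,\ m\in\mathbb{P}_j^d\}$ is an orthonormal basis of $L_2(\mathbb{T}^d)$. Besov sequence spaces: $b_{p,q}^{\tau,\mathrm{per}}$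 is the set of sequences $\lambda=(\lambda_m^{j,G})$ of complex numbers with $$\|\lambda\|_{b_{p,q}^{\tau,\mathrm{per}}}=\Big(\sum_{j\geq0}2^{j(\tau-d/p)q}\sum_{G\in G^j}\Big(\sum_{m\in\mathbb{P}_j^d}|\lambda_m^{j,G}|^p\Big)^{q/p}\Big)^{1/q}<\infty$$ (usual supremum modifications if $p=\infty$ or $q=\infty$; $1/\infty=0$). Besov spaces: $B_{p,q}^{\tau}(\mathbb{T}^d)$ is the usual periodic Besov space, equivalently (with $(x)_+=\max(x,0)$): choosing a wavelet system of regularity $u>\max(\tau,d(1/p-1)_+-\tau)$, it is the set of $f\in\mathcal{S}'(\mathbb{T}^d)$ that can be written $f=\sum_{j,G,m}\lambda_m^{j,G}2^{-(j+L)d/2}\Psi_{G,m}^{j,\mathrm{per}}$ with $\lambda\in b_{p,q}^{\tau,\mathrm{per}}$ (unconditional convergence in $\mathcal{S}'(\mathbb{T}^d)$); the representation is unique and the space does not depend on the choice of wavelet system. Besov spaces belong to $\mathcal{B}_c(\mathcal{S}'(\mathbb{T}^d))$, so the almost-sure statement is meaningful. *)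

theory Defs
  imports "HOL-Probability.Probability"
begin

section \<open>Smooth periodic functions and their dual\<close>

text \<open>Functions on the torus are \<open>\<int>^d\<close>-periodic functions on \<open>real^'d\<close>, so \<open>d = CARD('d)\<close>.\<close>

definition partial_deriv :: "'a::euclidean_space \<Rightarrow> ('a \<Rightarrow> real) \<Rightarrow> 'a \<Rightarrow> real" where
  "partial_deriv b f = (\<lambda>x. frechet_derivative f (at x) b)"

primrec cont_diff :: "nat \<Rightarrow> ('a::euclidean_space \<Rightarrow> real) \<Rightarrow> bool" where
  "cont_diff 0 f \<longleftrightarrow> continuous_on UNIV f"
| "cont_diff (Suc k) f \<longleftrightarrow>
     (\<forall>x. f differentiable (at x)) \<and> (\<forall>b\<in>Basis. cont_diff k (partial_deriv b f))"

definition int_vec :: "int^'d \<Rightarrow> real^'d" where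
  "int_vec n = (\<chi> i. real_of_int (n $ i))"

definition torus_test :: "(real^'d \<Rightarrow> real) set" where
  "torus_test = {\<phi>. (\<forall>k. cont_diff k \<phi>) \<and> (\<forall>x n. \<phi> (x + int_vec n) = \<phi> x)}"

text \<open>The seminorm \<open>sup |\<partial>\<^sup>\<alpha> \<phi>|\<close>; the multi-index is given as a list of basis vectors. The
  supremum is over a bounded set whenever \<open>\<phi>\<close> is in \<open>torus_test\<close>.\<close>

definition torus_seminorm :: "(real^'d) list \<Rightarrow> (real^'d \<Rightarrow> real) \<Rightarrow> real" where
  "torus_seminorm bs \<phi> = (SUP x. \<bar>foldr partial_deriv bs \<phi> x\<bar>)"

definition torus_test_topology :: "(real^'d \<Rightarrow> real) topology" where
  "torus_test_topology = topology_generated_by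
     {{\<psi> \<in> torus_test. torus_seminorm bs (\<lambda>x. \<psi> x - \<phi> x) < e} | \<phi> bs e.
        \<phi> \<in> torus_test \<and> set bs \<subseteq> Basis \<and> 0 < e}"

text \<open>Functionals are made extensional, since their values off \<open>torus_test\<close> carry no meaning.\<close>

definition torus_dual :: "((real^'d \<Rightarrow> real) \<Rightarrow> real) set" where
  "torus_dual = {u \<in> extensional torus_test.
     (\<forall>\<phi>\<in>torus_test. \<forall>\<psi>\<in>torus_test. u (\<lambda>x. \<phi> x + \<psi> x) = u \<phi> + u \<psi>) \<and>
     (\<forall>\<phi>\<in>torus_test. \<forall>c. u (\<lambda>x. c * \<phi> x) = c * u \<phi>) \<and>
     continuous_map torus_test_topology euclideanreal u}"

definition cylindrical_algebra :: "((real^'d \<Rightarrow> real) \<Rightarrow> real) measure" where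
  "cylindrical_algebra = sigma torus_dual
     {{u \<in> torus_dual. (\<lambda>i\<in>{..<N}. u (\<phi> i)) \<in> B} | N \<phi> B.
        (\<forall>i<N. \<phi> i \<in> torus_test) \<and> B \<in> sets (\<Pi>\<^sub>M i\<in>{..<N::nat}. (borel :: real measure))}"

section \<open>Periodic Levy white noise\<close>

definition generalized_periodic_process ::
    "'w measure \<Rightarrow> ('w \<Rightarrow> (real^'d \<Rightarrow> real) \<Rightarrow> real) \<Rightarrow> bool" where
  "generalized_periodic_process P s \<longleftrightarrow> prob_space P \<and> s \<in> measurable P cylindrical_algebra"

definition char_functional ::
    "'w measure \<Rightarrow> ('w \<Rightarrow> (real^'d \<Rightarrow> real) \<Rightarrow> real) \<Rightarrow> (real^'d \<Rightarrow> real) \<Rightarrow> complex" where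
  "char_functional P s \<phi> = (CLINT \<omega>|P. iexp (s \<omega> \<phi>))"

definition levy_measure :: "real measure \<Rightarrow> bool" where
  "levy_measure V \<longleftrightarrow>
     sets V = sets (restrict_space borel (- {0})) \<and>
     (\<forall>K. compact K \<and> K \<subseteq> - {0} \<longrightarrow> emeasure V K < \<infinity>) \<and>
     (\<integral>\<^sup>+ t. ennreal (min 1 (t\<^sup>2)) \<partial>V) < \<infinity>"

definition levy_exponent :: "(real \<Rightarrow> complex) \<Rightarrow> bool" where
  "levy_exponent f \<longleftrightarrow> (\<exists>\<mu> \<sigma> V. levy_measure V \<and>
     (\<forall>\<xi>. f \<xi> = \<i> * of_real (\<mu> * \<xi>) - of_real (\<sigma>\<^sup>2 * \<xi>\<^sup>2 / 2)
        + (CLINT t|V. iexp (\<xi> * t) - 1 - \<i> * of_real (\<xi> * t * indicator {t. \<bar>t\<bar> \<le> 1} t))))"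

definition periodic_levy_noise ::
    "'w measure \<Rightarrow> ('w \<Rightarrow> (real^'d \<Rightarrow> real) \<Rightarrow> real) \<Rightarrow> bool" where
  "periodic_levy_noise P w \<longleftrightarrow> generalized_periodic_process P w \<and>
     (\<exists>f. levy_exponent f \<and>
        (\<forall>\<phi>\<in>torus_test. char_functional P w \<phi> = exp (LINT r:cbox 0 1|lborel. f (\<phi> r))))"

section \<open>Wavelets\<close>

definition orthonormal_basis_L2 :: "('i \<Rightarrow> real \<Rightarrow> real) \<Rightarrow> bool" where
  "orthonormal_basis_L2 e \<longleftrightarrow>
     (\<forall>i. e i \<in> borel_measurable lborel \<and> integrable lborel (\<lambda>x. (e i x)\<^sup>2)) \<and>
     (\<forall>i j. (LINT x|lborel. e i x * e j x) = (if i = j then 1 else 0)) \<and>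
     (\<forall>g. g \<in> borel_measurable lborel \<and> integrable lborel (\<lambda>x. (g x)\<^sup>2) \<longrightarrow>
        (\<forall>\<epsilon>>0. \<exists>I c. finite I \<and> (LINT x|lborel. (g x - (\<Sum>i\<in>I. c i * e i x))\<^sup>2) < \<epsilon>))"

fun line_wavelet ::
    "(real \<Rightarrow> real) \<Rightarrow> (real \<Rightarrow> real) \<Rightarrow> int + nat \<times> int \<Rightarrow> real \<Rightarrow> real" where
  "line_wavelet \<psi>F \<psi>M (Inl k) x = \<psi>F (x - of_int k)"
| "line_wavelet \<psi>F \<psi>M (Inr (j, k)) x = 2 powr (real j / 2) * \<psi>M (2 ^ j * x - of_int k)"

text \<open>Compactly supported orthonormal multiresolution analysis of class \<open>C\<^sup>u\<close>, as provided by the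
  Daubechies wavelets: the finite filters \<open>h\<close> and \<open>g\<close> are those of the scaling and wavelet
  equations.\<close>

definition wavelet_system :: "nat \<Rightarrow> (real \<Rightarrow> real) \<Rightarrow> (real \<Rightarrow> real) \<Rightarrow> bool" where
  "wavelet_system u \<psi>F \<psi>M \<longleftrightarrow>
     cont_diff u \<psi>F \<and> cont_diff u \<psi>M \<and>
     compact (closure {x. \<psi>F x \<noteq> 0}) \<and> compact (closure {x. \<psi>M x \<noteq> 0}) \<and>
     (\<exists>h :: int \<Rightarrow> real. finite {k. h k \<noteq> 0} \<and>
        (\<forall>x. \<psi>F x = (\<Sum>k | h k \<noteq> 0. h k * sqrt 2 * \<psi>F (2 * x - of_int k)))) \<and>
     (\<exists>g :: int \<Rightarrow> real. finite {k. g k \<noteq> 0} \<and>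
        (\<forall>x. \<psi>M x = (\<Sum>k | g k \<noteq> 0. g k * sqrt 2 * \<psi>F (2 * x - of_int k)))) \<and>
     orthonormal_basis_L2 (line_wavelet \<psi>F \<psi>M) \<and>
     (\<forall>v<u. (LINT x|lborel. x ^ v * \<psi>M x) = 0)"

text \<open>\<open>L\<close> is large enough for the scale-0 functions to fit into a cell of side 1.\<close>

definition torus_scale :: "(real \<Rightarrow> real) \<Rightarrow> (real \<Rightarrow> real) \<Rightarrow> nat \<Rightarrow> bool" where
  "torus_scale \<psi>F \<psi>M L \<longleftrightarrow>
     (\<forall>\<psi>\<in>{\<psi>F, \<psi>M}. \<exists>a. {x. \<psi> (2 ^ L * x) \<noteq> 0} \<subseteq> {a..a + 1})"

datatype wavelet_kind = Father | Mother

definition wavelet_kinds :: "nat \<Rightarrow> ('d \<Rightarrow> wavelet_kind) set" where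
  "wavelet_kinds j = (if j = 0 then UNIV else {G. \<exists>a. G a = Mother})"

definition wavelet_shifts :: "nat \<Rightarrow> nat \<Rightarrow> (int^'d) set" where
  "wavelet_shifts L j = {m. \<forall>k. 0 \<le> m $ k \<and> m $ k < 2 ^ (j + L)}"

definition space_wavelet ::
    "(real \<Rightarrow> real) \<Rightarrow> (real \<Rightarrow> real) \<Rightarrow> nat \<Rightarrow> nat \<Rightarrow> ('d \<Rightarrow> wavelet_kind) \<Rightarrow> int^'d
      \<Rightarrow> real^'d \<Rightarrow> real" where
  "space_wavelet \<psi>F \<psi>M L j G m x =
     2 powr (real (j + L) * real CARD('d) / 2) *
     (\<Prod>a\<in>UNIV. (case G a of Father \<Rightarrow> \<psi>F | Mother \<Rightarrow> \<psi>M) (2 ^ (j + L) * x $ a - of_int (m $ a)))"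

definition periodic_wavelet ::
    "(real \<Rightarrow> real) \<Rightarrow> (real \<Rightarrow> real) \<Rightarrow> nat \<Rightarrow> nat \<Rightarrow> ('d \<Rightarrow> wavelet_kind) \<Rightarrow> int^'d
      \<Rightarrow> real^'d \<Rightarrow> real" where
  "periodic_wavelet \<psi>F \<psi>M L j G m x =
     (\<Sum>\<^sub>\<infinity>n\<in>UNIV. space_wavelet \<psi>F \<psi>M L j G m (x - int_vec n))"

section \<open>Besov spaces\<close>

text \<open>\<open>1/p\<close> as a real number for \<open>0 < p \<le> \<infinity>\<close>, with value 0 at \<open>p = \<infinity>\<close>.\<close>

definition recip :: "ennreal \<Rightarrow> real" where
  "recip p = enn2real (inverse p)"

definition lp_norm :: "ennreal \<Rightarrow> 'i set \<Rightarrow> ('i \<Rightarrow> complex) \<Rightarrow> real" where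
  "lp_norm p A x =
     (if p = \<infinity> then Max ((\<lambda>i. cmod (x i)) ` A)
      else (\<Sum>i\<in>A. cmod (x i) powr enn2real p) powr recip p)"

definition besov_seq_norm ::
    "nat \<Rightarrow> real \<Rightarrow> ennreal \<Rightarrow> ennreal
      \<Rightarrow> (nat \<Rightarrow> ('d \<Rightarrow> wavelet_kind) \<Rightarrow> int^'d \<Rightarrow> complex) \<Rightarrow> ennreal" where
  "besov_seq_norm L \<tau> p q c =
     (let a = \<tau> - real CARD('d) * recip p in
      if q = \<infinity>
      then (SUP j. SUP G\<in>wavelet_kinds j.
              ennreal (2 powr (real j * a) * lp_norm p (wavelet_shifts L j) (c j G)))
      else
       (let S = (\<Sum>j. ennreal (2 powr (real j * a * enn2real q) *
                   (\<Sum>G\<in>wavelet_kinds j.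
                      lp_norm p (wavelet_shifts L j) (c j G) powr enn2real q)))
        in if S = \<infinity> then \<infinity> else ennreal (enn2real S powr recip q)))"

text \<open>The space is defined relative to the wavelet system \<open>(\<psi>F, \<psi>M, L)\<close>; unconditional convergence
  in the (weak-*) dual means that \<open>has_sum\<close> holds against every test function.\<close>

definition besov_space ::
    "(real \<Rightarrow> real) \<Rightarrow> (real \<Rightarrow> real) \<Rightarrow> nat \<Rightarrow> real \<Rightarrow> ennreal \<Rightarrow> ennreal
      \<Rightarrow> ((real^'d \<Rightarrow> real) \<Rightarrow> real) set" where
  "besov_space \<psi>F \<psi>M L \<tau> p q = {f \<in> torus_dual.
     \<exists>c. besov_seq_norm L \<tau> p q c < \<infinity> \<and>
       (\<forall>\<phi>\<in>torus_test.
          ((\<lambda>(j, G, m). c j G m * of_real (2 powr (- real (j + L) * real CARD('d) / 2) *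
               (LINT r:cbox 0 1|lborel. periodic_wavelet \<psi>F \<psi>M L j G m r * \<phi> r)))
           has_sum of_real (f \<phi>))
          {(j, G, m). G \<in> wavelet_kinds j \<and> m \<in> wavelet_shifts L j})}"

end

theory Submission
  imports Defs
begin

text \<open>It suffices to find coefficients \<open>X\<^sub>i\<close>, formally \<open>\<langle>w, \<Psi>\<^sub>i\<rangle>\<close>, which represent \<open>w\<close> and satisfy
  \<open>\<Sum>\<^sub>i 2 powr (-2 j s) X\<^sub>i\<^sup>2 < \<infinity>\<close> almost surely for some \<open>s\<close> with \<open>d / 2 < s < u\<close>; all the parameters
  \<open>p, q, \<tau>\<close> of the claim then follow by elementary inequalities between \<open>\<ell>\<^sub>p\<close> norms.

  A Levy exponent satisfies \<open>\<bar>f \<xi>\<bar> \<le> \<delta> + C \<xi>\<^sup>2\<close>, with \<open>\<delta>\<close> as small as desired, so that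
  \<open>\<bar>1 - E (exp (i \<langle>w, \<phi>\<rangle>))\<bar> \<le> \<delta> + C \<parallel>\<phi>\<parallel>\<^sup>2\<close> in the \<open>L\<^sub>2\<close> norm. Writing \<open>exp (- \<Sum>\<^sub>k \<langle>w, \<phi>\<^sub>k\<rangle>\<^sup>2 / 2)\<close> as the mean of
  \<open>exp (i \<langle>w, \<Sum>\<^sub>k g\<^sub>k \<phi>\<^sub>k\<rangle>)\<close> over independent standard normal \<open>g\<^sub>k\<close>, as in the proof of Minlos's theorem,
  yields: if \<open>\<Sum>\<^sub>k \<parallel>\<phi>\<^sub>k\<parallel>\<^sup>2 < \<infinity>\<close> then \<open>\<Sum>\<^sub>k \<langle>w, \<phi>\<^sub>k\<rangle>\<^sup>2 < \<infinity>\<close> almost surely. No moment of the noise is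
  needed. As the wavelets are only \<open>C\<^sup>u\<close>, \<open>X\<^sub>i\<close> is the limit of \<open>\<langle>w, \<phi>\<^sub>n\<rangle>\<close> for trigonometric polynomials
  \<open>\<phi>\<^sub>n\<close> converging fast to \<open>\<Psi>\<^sub>i\<close>; the same statement, applied to the increments, gives
  the limits and the weighted square summability at once.

  For a test function \<open>\<phi>\<close>, the series \<open>\<Sum>\<^sub>i X\<^sub>i \<langle>\<Psi>\<^sub>i, \<phi>\<rangle>\<close> converges absolutely because
  \<open>\<langle>\<Psi>\<^sub>i, \<phi>\<rangle> = O(2 powr (- j (u + d / 2)))\<close> by the vanishing moments and \<open>s < u\<close>, and it equals \<open>\<langle>w, \<phi>\<rangle>\<close> almost
  surely since wavelet expansions of smooth functions converge uniformly. Both sides are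
  continuous in \<open>\<phi>\<close> and the test functions are separable, so one null set serves all \<open>\<phi>\<close>.\<close>

section \<open>Levy exponents near the origin\<close>

text \<open>The threshold splits as d(1/max(p,2) - 1) = -d/2 + d(1/max(p,2) - 1/2). The first loss
  is probabilistic: randomization controls a family whose squared L2 norms are summable, and with
  about 2^(jd) wavelets of bounded norm at scale j, the weights 2^(-2js) are summable exactly for s
  > d/2. The second loss is the passage from l_2 to l_p on a level when p > 2; for p < 2, Hoelder's
  inequality is compensated by the term d/p in the Besov norm.

  The wavelet hypotheses concern L2 of the line, whereas the expansion of a test function has to
  converge uniformly on the torus. The bridge is a pointwise kernel identity: the reproducing
  kernels of successive scales telescope, periodization and tensor products preserve this, and
  partial sums become integrals against a single scaling kernel. That this kernel is an approximate
  identity rests on the partition of unity by the scaling function, which is extracted from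
  completeness by testing on the indicator of [0, 1].\<close>

lemma levy_integrand_bound:
  "cmod (iexp (\<xi> * t) - 1 - \<i> * of_real (\<xi> * t * indicator {t. \<bar>t\<bar> \<le> 1} t))
     \<le> (2 + \<xi>\<^sup>2) * min 1 (t\<^sup>2)"
\<comment> \<open>The compensator is present precisely for |t| <= 1, where the Taylor remainder of
  order 2 applies; elsewhere the exponential is bounded trivially.\<close>
proof (cases "\<bar>t\<bar> \<le> 1")
  case True
  have "cmod (iexp (\<xi> * t) - (\<Sum>k\<le>1. (\<i> * complex_of_real (\<xi> * t)) ^ k / fact k)) \<le> \<bar>\<xi> * t\<bar>\<^sup>2 / 2"
    using iexp_approx1[of "\<xi> * t" 1] by (simp add: power2_eq_square)
  moreover have "t\<^sup>2 \<le> 1" using True by (simp add: abs_square_le_1)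
  moreover have "\<bar>\<xi> * t\<bar>\<^sup>2 / 2 \<le> (2 + \<xi>\<^sup>2) * t\<^sup>2" by (simp add: power_mult_distrib algebra_simps)
  ultimately show ?thesis using True by (simp add: diff_diff_eq)
next
  case False
  have "cmod (iexp (\<xi> * t) - 1) \<le> cmod (iexp (\<xi> * t)) + cmod 1" by (rule norm_triangle_ineq4)
  also have "\<dots> = 2" by simp
  finally have "cmod (iexp (\<xi> * t) - 1) \<le> 2" .
  moreover have "1 < t\<^sup>2" using False one_less_power[of "\<bar>t\<bar>" 2] by simp
  ultimately show ?thesis using False by (simp add: add_increasing2)
qed

lemma levy_measure_integrable:
  assumes "levy_measure V"
  shows "integrable V (\<lambda>t. min 1 (t\<^sup>2))"
proof -
  have [measurable_cong]: "sets V = sets (restrict_space borel (- {0}))"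
    using assms by (simp add: levy_measure_def)
  have "(\<lambda>t::real. min 1 (t\<^sup>2)) \<in> borel_measurable (restrict_space borel (- {0}))"
    by (rule measurable_restrict_space1) measurable
  then have "(\<lambda>t::real. min 1 (t\<^sup>2)) \<in> borel_measurable V" by (subst measurable_cong_sets) (auto simp: \<open>sets V = _\<close>)
  then show ?thesis using assms
    by (intro integrableI_bounded) (auto simp: levy_measure_def)
qed

text \<open>Continuity at 0 together with \<open>f 0 = 0\<close> keeps \<open>f\<close> below
  \<open>\<delta>\<close> near the origin; away from it the growth is at most quadratic and
  constants can be absorbed into \<open>\<xi>\<^sup>2\<close>. The additive \<open>\<delta>\<close>
  is what replaces a finite variance: large jumps enter only through
  \<open>min 1 (t\<^sup>2)\<close>.\<close>

lemma levy_exponent_bound: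
  assumes "levy_exponent f" "0 < \<delta>"
  shows "\<exists>C\<ge>0. \<forall>\<xi>. cmod (f \<xi>) \<le> \<delta> + C * \<xi>\<^sup>2"
proof -
  obtain \<mu> \<sigma> V where V: "levy_measure V" and f: "\<And>\<xi>. f \<xi> = \<i> * of_real (\<mu> * \<xi>) - of_real (\<sigma>\<^sup>2 * \<xi>\<^sup>2 / 2)
        + (CLINT t|V. iexp (\<xi> * t) - 1 - \<i> * of_real (\<xi> * t * indicator {t. \<bar>t\<bar> \<le> 1} t))"
    using assms(1) unfolding levy_exponent_def by blast
  define g where "g = (\<lambda>\<xi> t. iexp (\<xi> * t) - 1 - \<i> * of_real (\<xi> * t * indicator {t. \<bar>t\<bar> \<le> 1} t))"
  define J where "J = (\<lambda>\<xi>. CLINT t|V. g \<xi> t)"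
  have sV: "sets V = sets (restrict_space borel (- {0}))"
    using V by (simp add: levy_measure_def)
  have g_meas: "g \<xi> \<in> borel_measurable V" for \<xi>
  proof -
    have "g \<xi> \<in> borel_measurable (restrict_space borel (- {0}))"
      unfolding g_def by (rule measurable_restrict_space1) measurable
    then show ?thesis by (subst measurable_cong_sets[OF sV refl])
  qed
  note iV = levy_measure_integrable[OF V]
  have f': "f \<xi> = \<i> * of_real (\<mu> * \<xi>) - of_real (\<sigma>\<^sup>2 * \<xi>\<^sup>2 / 2) + J \<xi>" for \<xi>
    unfolding f J_def g_def ..
  define K where "K = (LINT t|V. min 1 (t\<^sup>2))"
  have K: "0 \<le> K" unfolding K_def by (rule integral_nonneg_AE) auto
  have gb: "cmod (g \<xi> t) \<le> (2 + \<xi>\<^sup>2) * min 1 (t\<^sup>2)" for \<xi> t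
    unfolding g_def by (rule levy_integrand_bound)
  have ig: "integrable V (g \<xi>)" for \<xi>
    by (rule Bochner_Integration.integrable_bound[OF integrable_mult_right[OF iV, of "2 + \<xi>\<^sup>2"] g_meas])
      (use gb in \<open>auto intro!: AE_I2 order_trans[OF gb] abs_ge_self\<close>)
  have Jb: "cmod (J \<xi>) \<le> (2 + \<xi>\<^sup>2) * K" for \<xi>
  proof -
    have "cmod (J \<xi>) \<le> (LINT t|V. (2 + \<xi>\<^sup>2) * min 1 (t\<^sup>2))"
      unfolding J_def by (rule Bochner_Integration.integral_norm_bound_integral[OF ig integrable_mult_right[OF iV] gb])
    then show ?thesis by (simp add: K_def)
  qed
  have Jlim: "J \<midarrow>0\<rightarrow> 0"
  proof -
    have "(\<lambda>n. J (x n)) \<longlonglongrightarrow> J 0" if x: "x \<longlonglongrightarrow> 0" "\<And>n. \<bar>x n\<bar> \<le> 1" for x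
      unfolding J_def
    proof (rule integral_dominated_convergence[where w="\<lambda>t. 3 * min 1 (t\<^sup>2)"])
      show "integrable V (\<lambda>t. 3 * min 1 (t\<^sup>2))" by (rule integrable_mult_right[OF iV])
      show "AE t in V. (\<lambda>n. g (x n) t) \<longlonglongrightarrow> g 0 t"
        unfolding g_def by (intro AE_I2 tendsto_intros x)
      show "AE t in V. cmod (g (x n) t) \<le> 3 * min 1 (t\<^sup>2)" for n
      proof (intro AE_I2)
        fix t
        have "(x n)\<^sup>2 \<le> 1" using x(2)[of n] by (simp add: abs_square_le_1)
        then have "(2 + (x n)\<^sup>2) * min 1 (t\<^sup>2) \<le> 3 * min 1 (t\<^sup>2)" by (intro mult_right_mono) auto
        then show "cmod (g (x n) t) \<le> 3 * min 1 (t\<^sup>2)" using gb[of "x n" t] by linarith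
      qed
    qed (rule g_meas)+
    then have *: "(\<lambda>n. J (x n)) \<longlonglongrightarrow> 0" if x: "x \<longlonglongrightarrow> 0" "\<And>n. \<bar>x n\<bar> \<le> 1" for x
      using that by (simp add: J_def g_def)
    \<comment> \<open>Clamping to [-1, 1] changes nothing near 0 and gives every sequence the bound
      by 1 on which the integrable majorant depends.\<close>
    have "((\<lambda>x. J (max (-1) (min 1 x))) \<longlongrightarrow> 0) (at 0)"
      unfolding tendsto_at_iff_sequentially comp_def
    proof (intro allI impI)
      fix x :: "nat \<Rightarrow> real" assume "x \<longlonglongrightarrow> 0"
      then have "(\<lambda>n. max (-1) (min 1 (x n))) \<longlonglongrightarrow> max (-1) (min 1 0)" by (intro tendsto_intros)
      then show "(\<lambda>n. J (max (-1) (min 1 (x n)))) \<longlonglongrightarrow> 0" by (intro *) auto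
    qed
    moreover have "\<forall>\<^sub>F x in at 0. max (-1) (min 1 x) = (x::real)"
      unfolding eventually_at by (intro exI[of _ 1]) auto
    ultimately show ?thesis by (smt (verit, best) Lim_transform_eventually eventually_mono)
  qed
  have "(f \<longlongrightarrow> \<i> * of_real (\<mu> * 0) - of_real (\<sigma>\<^sup>2 * 0\<^sup>2 / 2) + 0) (at 0)"
    unfolding f'[abs_def] by (intro tendsto_intros Jlim) auto
  then have "\<forall>\<^sub>F x in at 0. cmod (f x) < \<delta>"
    using assms(2) by (auto dest!: tendstoD simp: dist_norm)
  then obtain e where e: "e > 0" "\<And>x. x \<noteq> 0 \<Longrightarrow> \<bar>x\<bar> < e \<Longrightarrow> cmod (f x) < \<delta>"
    unfolding eventually_at by auto
  have f0: "f 0 = 0" unfolding f by simp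
  \<comment> \<open>Outside the neighbourhood of radius \<open>e\<close>, 1 <= x^2 / e^2; this
    converts the constant term of the global bound into a quadratic one.\<close>
  define C where "C = (\<bar>\<mu>\<bar> + 2 * K) / e\<^sup>2 + \<bar>\<mu>\<bar> + \<sigma>\<^sup>2 + K"
  have "cmod (f x) \<le> \<delta> + C * x\<^sup>2" for x
  proof (cases "\<bar>x\<bar> < e")
    case True
    then have "cmod (f x) \<le> \<delta>" using e(2)[of x] f0 assms(2) by (cases "x = 0") auto
    moreover have "0 \<le> C * x\<^sup>2" unfolding C_def using K by auto
    ultimately show ?thesis by linarith
  next
    case False
    then have x2: "e\<^sup>2 \<le> x\<^sup>2" using e(1) by (simp add: abs_le_square_iff[symmetric])
    have "cmod (f x) \<le> cmod (\<i> * of_real (\<mu> * x) - of_real (\<sigma>\<^sup>2 * x\<^sup>2 / 2)) + cmod (J x)"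
      unfolding f' by (rule norm_triangle_ineq)
    also have "\<dots> \<le> (cmod (\<i> * of_real (\<mu> * x)) + cmod (of_real (\<sigma>\<^sup>2 * x\<^sup>2 / 2))) + (2 + x\<^sup>2) * K"
      by (intro add_mono Jb norm_triangle_ineq4)
    also have "\<dots> \<le> (\<bar>\<mu>\<bar> * (1 + x\<^sup>2) + \<sigma>\<^sup>2 * x\<^sup>2) + (2 + x\<^sup>2) * K"
    proof -
      have "\<bar>x\<bar> \<le> 1 + x\<^sup>2"
        using sum_power2_ge_zero[of "\<bar>x\<bar> - 1" 0] by (smt (verit) power2_abs power2_diff power2_eq_square mult_cancel_left2 zero_le_power2 one_power2)
      then have "\<bar>\<mu>\<bar> * \<bar>x\<bar> \<le> \<bar>\<mu>\<bar> * (1 + x\<^sup>2)" by (rule mult_left_mono) auto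
      moreover have "cmod (\<i> * of_real (\<mu> * x)) = \<bar>\<mu>\<bar> * \<bar>x\<bar>" by (simp add: norm_mult)
      moreover have "cmod (of_real (\<sigma>\<^sup>2 * x\<^sup>2 / 2)) \<le> \<sigma>\<^sup>2 * x\<^sup>2" 
        by (subst norm_of_real) simp
      ultimately show ?thesis by linarith
    qed
    also have "\<dots> = (\<bar>\<mu>\<bar> + 2 * K) + (\<bar>\<mu>\<bar> + \<sigma>\<^sup>2 + K) * x\<^sup>2" by (simp add: algebra_simps)
    also have "(\<bar>\<mu>\<bar> + 2 * K) \<le> (\<bar>\<mu>\<bar> + 2 * K) / e\<^sup>2 * x\<^sup>2"
      using mult_left_mono[OF x2, of "(\<bar>\<mu>\<bar> + 2 * K) / e\<^sup>2"] K e(1) by simp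
    finally show ?thesis using assms(2) by (simp add: C_def algebra_simps)
  qed
  moreover have "0 \<le> C" unfolding C_def using K by auto
  ultimately show ?thesis by blast
qed

section \<open>Gaussian randomization of the noise\<close>

lemma norm_integral_le:
  fixes f :: "'a \<Rightarrow> 'b::{banach, second_countable_topology}"
  assumes "integrable M f" "integrable M g" "\<And>x. x \<in> space M \<Longrightarrow> norm (f x) \<le> g x"
  shows "norm (integral\<^sup>L M f) \<le> integral\<^sup>L M g"
  using integral_norm_bound[of M f] integral_mono[OF integrable_norm[OF assms(1)] assms(2,3)] by linarith

lemma torus_test_continuous: "\<phi> \<in> torus_test \<Longrightarrow> continuous_on S \<phi>"
proof -
  assume "\<phi> \<in> torus_test"
  then have "cont_diff 0 \<phi>" unfolding torus_test_def by blast
  then show ?thesis using continuous_on_subset by auto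
qed

lemma integrable_cube:
  fixes f :: "real^'d \<Rightarrow> 'b::{banach, second_countable_topology}"
  assumes "continuous_on (cbox 0 1) f"
  shows "set_integrable lborel (cbox 0 1) f"
  unfolding set_integrable_def
  by (rule borel_integrable_compact[OF compact_cbox assms])

definition cube_sq :: "(real^'d \<Rightarrow> real) \<Rightarrow> real" where
  "cube_sq f = (LINT r:cbox 0 1|lborel. (f r)\<^sup>2)"

lemma cube_sq_nonneg: "0 \<le> cube_sq f"
  unfolding cube_sq_def set_lebesgue_integral_def by (rule integral_nonneg_AE) auto

lemma measure_cube: "measure lborel (cbox (0::real^'d) 1) = 1"
  using content_cbox_cart[of "0::real^'d" 1] by (simp add: interval_eq_empty_cart)

text \<open>Mean value inequality on the left half plane, which is convex and on which the
  derivative of \<open>exp\<close> has modulus at most 1.\<close>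

lemma cmod_exp_minus_1_le:
  assumes "Re z \<le> 0"
  shows "cmod (1 - exp z) \<le> cmod z"
proof -
  have "norm (exp z - exp 0) \<le> 1 * norm (z - 0)"
  proof (rule field_differentiable_bound[where S="{z. Re z \<le> 0}"])
    show "convex {z. Re z \<le> 0}" by (rule convex_halfspace_Re_le)
    show "(exp has_field_derivative exp z) (at z within {z. Re z \<le> 0})" for z :: complex
      by (rule DERIV_subset[OF DERIV_exp]) simp
  qed (use assms in auto)
  then show ?thesis by (simp add: norm_minus_commute)
qed

lemma torus_test_lin:
  assumes "w \<in> torus_dual" "\<phi> \<in> torus_test"
  shows "\<psi> \<in> torus_test \<Longrightarrow> w (\<lambda>x. \<phi> x + \<psi> x) = w \<phi> + w \<psi>" "w (\<lambda>x. c * \<phi> x) = c * w \<phi>"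
  using assms by (auto simp: torus_dual_def)

lemma cont_diff_add: "cont_diff k f \<Longrightarrow> cont_diff k g \<Longrightarrow> cont_diff k (\<lambda>x. f x + g x)"
proof (induction k arbitrary: f g)
  case (Suc k)
  have "partial_deriv b (\<lambda>x. f x + g x) = (\<lambda>x. partial_deriv b f x + partial_deriv b g x)" for b
  proof
    fix x
    have "(f has_derivative frechet_derivative f (at x)) (at x)" "(g has_derivative frechet_derivative g (at x)) (at x)"
      using Suc.prems by (simp_all add: frechet_derivative_works)
    then have "((\<lambda>x. f x + g x) has_derivative (\<lambda>h. frechet_derivative f (at x) h + frechet_derivative g (at x) h)) (at x)"
      by (rule has_derivative_add)
    then show "partial_deriv b (\<lambda>x. f x + g x) x = partial_deriv b f x + partial_deriv b g x"
      unfolding partial_deriv_def by (simp add: frechet_derivative_at[symmetric])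
  qed
  then show ?case using Suc by (auto intro!: derivative_intros)
qed (auto intro: continuous_intros)

lemma cont_diff_scale: "cont_diff k f \<Longrightarrow> cont_diff k (\<lambda>x. c * f x)"
proof (induction k arbitrary: f)
  case (Suc k)
  have "partial_deriv b (\<lambda>x. c * f x) = (\<lambda>x. c * partial_deriv b f x)" for b
  proof
    fix x
    have "(f has_derivative frechet_derivative f (at x)) (at x)"
      using Suc.prems by (simp add: frechet_derivative_works)
    then have "((\<lambda>x. c * f x) has_derivative (\<lambda>h. c * frechet_derivative f (at x) h)) (at x)"
      by (rule has_derivative_mult_right)
    then show "partial_deriv b (\<lambda>x. c * f x) x = c * partial_deriv b f x"
      unfolding partial_deriv_def by (simp add: frechet_derivative_at[symmetric])
  qed
  then show ?case using Suc by (auto intro!: derivative_intros)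
qed (auto intro: continuous_intros)

lemma torus_test_add: "\<phi> \<in> torus_test \<Longrightarrow> \<psi> \<in> torus_test \<Longrightarrow> (\<lambda>x. \<phi> x + \<psi> x) \<in> torus_test"
  by (auto simp: torus_test_def cont_diff_add)

lemma torus_test_scale: "\<phi> \<in> torus_test \<Longrightarrow> (\<lambda>x. c * \<phi> x) \<in> torus_test"
  by (auto simp: torus_test_def cont_diff_scale)

lemma torus_test_diff: "\<phi> \<in> torus_test \<Longrightarrow> \<psi> \<in> torus_test \<Longrightarrow> (\<lambda>x. \<phi> x - \<psi> x) \<in> torus_test"
  using torus_test_add[OF _ torus_test_scale[of \<psi> "-1"]] by simp

locale levy_noise =
  fixes P :: "'w measure" and w :: "'w \<Rightarrow> (real^'d \<Rightarrow> real) \<Rightarrow> real"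
  assumes noise: "periodic_levy_noise P w"

sublocale levy_noise \<subseteq> prob_space P
  using noise by (simp add: periodic_levy_noise_def generalized_periodic_process_def)

context levy_noise begin

lemma w_measurable_cylindrical: "w \<in> measurable P cylindrical_algebra"
  using noise by (simp add: periodic_levy_noise_def generalized_periodic_process_def)

lemma space_cylindrical: "space cylindrical_algebra = torus_dual"
  unfolding cylindrical_algebra_def by (rule space_measure_of) blast

lemma w_dual: "\<omega> \<in> space P \<Longrightarrow> w \<omega> \<in> torus_dual"
  using measurable_space[OF w_measurable_cylindrical] by (simp add: space_cylindrical)

lemma w_measurable [measurable (raw)]:
  assumes "\<phi> \<in> torus_test"
  shows "(\<lambda>\<omega>. w \<omega> \<phi>) \<in> borel_measurable P"
proof (rule measurableI)
  fix A :: "real set" assume A: "A \<in> sets borel"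
  let ?B = "{x \<in> space (\<Pi>\<^sub>M i\<in>{..<1::nat}. (borel :: real measure)). x 0 \<in> A}"
  have B: "?B \<in> sets (\<Pi>\<^sub>M i\<in>{..<1::nat}. (borel :: real measure))"
    using A by measurable
  have "{u \<in> torus_dual. (\<lambda>i\<in>{..<1::nat}. u \<phi>) \<in> ?B} \<in> sets cylindrical_algebra"
    unfolding cylindrical_algebra_def
  proof (rule in_measure_of)
    show "{{u \<in> torus_dual. (\<lambda>i\<in>{..<N}. u (\<phi> i)) \<in> B} | N \<phi> B.
        (\<forall>i<N. \<phi> i \<in> torus_test) \<and> B \<in> sets (\<Pi>\<^sub>M i\<in>{..<N::nat}. (borel :: real measure))} \<subseteq> Pow torus_dual"
      by blast
  qed (rule CollectI, rule exI[of _ "1::nat"], rule exI[of _ "\<lambda>_. \<phi>"], rule exI[of _ ?B],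
      intro conjI refl B allI impI assms)
  moreover have "{u \<in> torus_dual. (\<lambda>i\<in>{..<1::nat}. u \<phi>) \<in> ?B} = {u \<in> torus_dual. u \<phi> \<in> A}"
    by (auto simp: space_PiM)
  ultimately have "{u \<in> torus_dual. u \<phi> \<in> A} \<in> sets cylindrical_algebra" by simp
  then have "w -` {u \<in> torus_dual. u \<phi> \<in> A} \<inter> space P \<in> sets P"
    by (rule measurable_sets[OF w_measurable_cylindrical])
  moreover have "w -` {u \<in> torus_dual. u \<phi> \<in> A} \<inter> space P = (\<lambda>\<omega>. w \<omega> \<phi>) -` A \<inter> space P"
    using w_dual by auto
  ultimately show "(\<lambda>\<omega>. w \<omega> \<phi>) -` A \<inter> space P \<in> sets P" by simp
qed simp

lemma char_bound:
  assumes "0 < \<delta>"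
  shows "\<exists>C\<ge>0. \<forall>\<phi>\<in>torus_test. cmod (1 - char_functional P w \<phi>) \<le> \<delta> + C * cube_sq \<phi>"
proof -
  obtain f where "levy_exponent f"
    and f: "\<And>\<phi>. \<phi> \<in> torus_test \<Longrightarrow> char_functional P w \<phi> = exp (LINT r:cbox 0 1|lborel. f (\<phi> r))"
    using noise by (auto simp: periodic_levy_noise_def)
  then obtain C where C: "C \<ge> 0" "\<And>\<xi>. cmod (f \<xi>) \<le> \<delta> + C * \<xi>\<^sup>2"
    using levy_exponent_bound assms by blast
  have "cmod (1 - char_functional P w \<phi>) \<le> \<delta> + C * cube_sq \<phi>" if \<phi>: "\<phi> \<in> torus_test" for \<phi>
  proof -
    define z where "z = (LINT r:cbox 0 1|lborel. f (\<phi> r))"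
    have "cmod (char_functional P w \<phi>) \<le> (LINT \<omega>|P. 1)"
      unfolding char_functional_def
      by (rule norm_integral_le)
        (use \<phi> in \<open>auto intro!: integrable_const_bound[where B=1]\<close>)
    \<comment> \<open>A characteristic functional has modulus at most 1, which gives the sign of the
      real part without any analysis of \<open>f\<close>.\<close>
    then have "cmod (exp z) \<le> 1" using f[OF \<phi>] by (simp add: z_def prob_space)
    then have "Re z \<le> 0" by simp
    then have "cmod (1 - char_functional P w \<phi>) \<le> cmod z"
      using cmod_exp_minus_1_le f[OF \<phi>] by (simp add: z_def)
    also have "cmod z \<le> \<delta> + C * cube_sq \<phi>"
    proof (cases "set_integrable lborel (cbox 0 1) (\<lambda>r. f (\<phi> r))")
      case True
      have i1: "set_integrable lborel (cbox 0 1) (\<lambda>r. (\<phi> r)\<^sup>2)"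
        by (intro integrable_cube continuous_intros torus_test_continuous \<phi>)
      have i2: "set_integrable lborel (cbox 0 1) (\<lambda>r::real^'d. \<delta>)"
        by (intro integrable_cube continuous_intros)
      have i3: "set_integrable lborel (cbox 0 1) (\<lambda>r. \<delta> + C * (\<phi> r)\<^sup>2)"
        by (intro integrable_cube continuous_intros torus_test_continuous \<phi>)
      have "cmod z \<le> (LINT r:cbox 0 1|lborel. \<delta> + C * (\<phi> r)\<^sup>2)"
        unfolding z_def set_lebesgue_integral_def
        by (rule norm_integral_le)
          (use True i3 C in \<open>auto simp: set_integrable_def indicator_def\<close>)
      also have "\<dots> = \<delta> + C * cube_sq \<phi>"
        unfolding cube_sq_def
        by (subst set_integral_add(2)) (use i1 i2 in \<open>auto simp: measure_cube set_lebesgue_integral_def[of _ _ "\<lambda>_. \<delta>"]\<close>)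
      finally show ?thesis .
    next
      \<comment> \<open>A non-integrable integrand has integral 0 by convention and the bound is
        trivial; this case distinction stands in for a proof that \<open>f\<close> is
        measurable.\<close>
      case False
      then have "z = 0" unfolding z_def set_lebesgue_integral_def set_integrable_def
        by (rule not_integrable_integral_eq)
      then show ?thesis using assms C(1) cube_sq_nonneg[of \<phi>] by simp
    qed
    finally show ?thesis .
  qed
  then show ?thesis using C(1) by blast
qed

end

text \<open>Arranged as a polynomial in \<open>g\<close>, so that averaging over a standard normal
  \<open>g\<close> leaves the sum of the two squared norms.\<close>

lemma cube_sq_add_scale:
  assumes "\<psi> \<in> torus_test" "\<phi> \<in> torus_test"
  shows "cube_sq (\<lambda>x. \<psi> x + g * \<phi> x)
    = cube_sq \<psi> + g * (2 * (LINT r:cbox 0 1|lborel. \<psi> r * \<phi> r)) + g\<^sup>2 * cube_sq \<phi>"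
proof -
  note [continuous_intros] = torus_test_continuous
  have i: "set_integrable lborel (cbox 0 1) (\<lambda>r. (\<psi> r)\<^sup>2)"
    "set_integrable lborel (cbox 0 1) (\<lambda>r. g * (2 * (\<psi> r * \<phi> r)))"
    "set_integrable lborel (cbox 0 1) (\<lambda>r. g\<^sup>2 * (\<phi> r)\<^sup>2)"
    "set_integrable lborel (cbox 0 1) (\<lambda>r. (\<psi> r)\<^sup>2 + g * (2 * (\<psi> r * \<phi> r)))"
    by (intro integrable_cube continuous_intros assms)+
  have "cube_sq (\<lambda>x. \<psi> x + g * \<phi> x) = (LINT r:cbox 0 1|lborel. ((\<psi> r)\<^sup>2 + g * (2 * (\<psi> r * \<phi> r))) + g\<^sup>2 * (\<phi> r)\<^sup>2)"
    unfolding cube_sq_def by (intro arg_cong2[where f="set_lebesgue_integral lborel"] refl ext)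
      (simp add: power2_eq_square algebra_simps)
  also have "\<dots> = cube_sq \<psi> + g * (2 * (LINT r:cbox 0 1|lborel. \<psi> r * \<phi> r)) + g\<^sup>2 * cube_sq \<phi>"
    unfolding cube_sq_def by (simp add: set_integral_add i)
  finally show ?thesis .
qed

lemma cube_sq_scale: "cube_sq (\<lambda>x. c * f x) = c\<^sup>2 * cube_sq f"
  unfolding cube_sq_def by (simp add: power_mult_distrib)

lemma iexp_std_normal: "(CLINT g|std_normal_distribution. iexp (x * g)) = of_real (exp (- (x\<^sup>2) / 2))"
  using fun_cong[OF char_std_normal_distribution, of x] by (simp add: char_def)

context levy_noise begin

text \<open>The Gaussian factors are peeled off one at a time, by writing each as the mean of
  \<open>iexp (g * w \<omega> \<phi>)\<close> over a standard normal variable \<open>g\<close>.\<close>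

lemma gauss_bound:
  fixes N :: nat
  assumes C: "C \<ge> 0" "\<And>\<phi>. \<phi> \<in> torus_test \<Longrightarrow> cmod (1 - char_functional P w \<phi>) \<le> \<delta> + C * cube_sq \<phi>"
    and \<phi>: "\<And>i. i < N \<Longrightarrow> \<phi> i \<in> torus_test" and \<psi>: "\<psi> \<in> torus_test"
  shows "cmod (1 - (CLINT \<omega>|P. iexp (w \<omega> \<psi>) * of_real (exp (- (\<Sum>i<N. (w \<omega> (\<phi> i))\<^sup>2) / 2))))
    \<le> \<delta> + C * (cube_sq \<psi> + (\<Sum>i<N. cube_sq (\<phi> i)))"
  using \<phi> \<psi>
\<comment> \<open>\<open>\<psi>\<close> has to vary, because for a fixed Gaussian value
  \<open>g\<close> the function \<open>g * \<phi> N\<close> is moved into it.\<close>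
proof (induction N arbitrary: \<psi>)
  case 0
  then show ?case using C(2)[OF 0(2)] by (simp add: char_functional_def)
next
  case (Suc N)
  let ?G = "std_normal_distribution"
  interpret G: real_distribution ?G by (rule real_dist_normal_dist)
  interpret pair_sigma_finite ?G P ..
  interpret GP: pair_prob_space ?G P ..
  have [measurable]: "(\<lambda>\<omega>. w \<omega> \<psi>) \<in> borel_measurable P" "(\<lambda>\<omega>. w \<omega> (\<phi> N)) \<in> borel_measurable P"
    using Suc.prems by (auto intro!: w_measurable)
  have [measurable]: "(\<lambda>\<omega>. \<Sum>i<N. (w \<omega> (\<phi> i))\<^sup>2) \<in> borel_measurable P"
    using Suc.prems by (intro borel_measurable_sum borel_measurable_power w_measurable) auto
  define E where "E = (\<lambda>\<omega>. exp (- (\<Sum>i<N. (w \<omega> (\<phi> i))\<^sup>2) / 2))"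
  have [measurable]: "E \<in> borel_measurable P" unfolding E_def by measurable
  have E: "0 \<le> E \<omega>" "E \<omega> \<le> 1" for \<omega>
    unfolding E_def by (auto intro!: sum_nonneg)
  define F where "F = (\<lambda>g \<omega>. iexp (w \<omega> \<psi>) * of_real (E \<omega>) * iexp (w \<omega> (\<phi> N) * g))"
  have Fb: "cmod (F g \<omega>) \<le> 1" for g \<omega>
    unfolding F_def using E[of \<omega>] by (simp add: norm_mult)
  have Fi: "integrable (?G \<Otimes>\<^sub>M P) (case_prod F)"
    by (rule GP.integrable_const_bound[where B=1]) (use Fb in \<open>auto simp: F_def split_beta\<close>)
  have step: "(CLINT \<omega>|P. F g \<omega>) = (CLINT \<omega>|P. iexp (w \<omega> (\<lambda>x. \<psi> x + g * \<phi> N x)) * of_real (E \<omega>))" for g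
  proof (rule Bochner_Integration.integral_cong[OF refl])
    fix \<omega> assume "\<omega> \<in> space P"
    then have "w \<omega> (\<lambda>x. \<psi> x + g * \<phi> N x) = w \<omega> \<psi> + g * w \<omega> (\<phi> N)"
      using torus_test_lin(1)[OF w_dual Suc.prems(2) torus_test_scale, of \<omega> "\<phi> N" g] torus_test_lin(2)[OF w_dual, of \<omega> "\<phi> N" g] Suc.prems(1)[of N]
      by simp
    then show "F g \<omega> = iexp (w \<omega> (\<lambda>x. \<psi> x + g * \<phi> N x)) * of_real (E \<omega>)"
      unfolding F_def by (simp add: exp_add algebra_simps)
  qed
  have "(CLINT \<omega>|P. iexp (w \<omega> \<psi>) * of_real (exp (- (\<Sum>i<Suc N. (w \<omega> (\<phi> i))\<^sup>2) / 2)))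
      = (CLINT \<omega>|P. (CLINT g|?G. F g \<omega>))"
  proof (rule Bochner_Integration.integral_cong[OF refl])
    fix \<omega>
    have "(CLINT g|?G. F g \<omega>) = iexp (w \<omega> \<psi>) * (of_real (E \<omega>) * of_real (exp (- ((w \<omega> (\<phi> N))\<^sup>2) / 2)))"
      unfolding F_def by (simp only: integral_mult_right_zero iexp_std_normal mult.assoc)
    also have "of_real (E \<omega>) * complex_of_real (exp (- ((w \<omega> (\<phi> N))\<^sup>2) / 2)) = of_real (exp (- (\<Sum>i<Suc N. (w \<omega> (\<phi> i))\<^sup>2) / 2))"
      unfolding of_real_mult[symmetric] E_def exp_add[symmetric] by (simp add: add_divide_distrib)
    finally show "iexp (w \<omega> \<psi>) * of_real (exp (- (\<Sum>i<Suc N. (w \<omega> (\<phi> i))\<^sup>2) / 2)) = (CLINT g|?G. F g \<omega>)"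
      by simp
  qed
  also have "\<dots> = (CLINT g|?G. (CLINT \<omega>|P. F g \<omega>))"
    by (rule Fubini_integral[OF Fi])
  finally have eq: "1 - (CLINT \<omega>|P. iexp (w \<omega> \<psi>) * of_real (exp (- (\<Sum>i<Suc N. (w \<omega> (\<phi> i))\<^sup>2) / 2)))
      = 1 - (CLINT g|?G. (CLINT \<omega>|P. F g \<omega>))" by simp
  have Gi: "integrable ?G (\<lambda>g. (CLINT \<omega>|P. F g \<omega>))"
    using integrable_fst'[OF Fi] by simp
  have eq2: "1 - (CLINT g|?G. (CLINT \<omega>|P. F g \<omega>)) = (CLINT g|?G. 1 - (CLINT \<omega>|P. F g \<omega>))"
    using Gi G.prob_space by simp
  define S where "S = (\<Sum>i<N. cube_sq (\<phi> i))"
  define R where "R = 2 * (LINT r:cbox 0 1|lborel. \<psi> r * \<phi> N r)"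
  \<comment> \<open>Mean 0 removes the cross term \<open>R\<close>, whose sign is unknown; variance
    1 turns the quadratic term into \<open>cube_sq (\<phi> N)\<close>.\<close>
  have gm: "integrable ?G (\<lambda>g. g)" "integrable ?G (\<lambda>g. g\<^sup>2)" "(LINT g|?G. g) = 0" "(LINT g|?G. g\<^sup>2) = 1"
    using integrable_std_normal_distribution_moment[of 1] integrable_std_normal_distribution_moment[of 2]
      integral_std_normal_distribution_moment_odd[of 1] std_normal_distribution_even_moments(1)[of 1] by simp_all
  have bd: "cmod (1 - (CLINT \<omega>|P. F g \<omega>)) \<le> (\<delta> + C * (cube_sq \<psi> + S)) + (C * R) * g + (C * cube_sq (\<phi> N)) * g\<^sup>2" for g
  proof -
    have "cmod (1 - (CLINT \<omega>|P. F g \<omega>)) \<le> \<delta> + C * (cube_sq (\<lambda>x. \<psi> x + g * \<phi> N x) + (\<Sum>i<N. cube_sq (\<phi> i)))"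
      unfolding step E_def using Suc.prems
      by (intro Suc.IH torus_test_add torus_test_scale) auto
    then show ?thesis unfolding S_def[symmetric]
      by (subst (asm) cube_sq_add_scale) (use Suc.prems in \<open>auto simp: R_def algebra_simps\<close>)
  qed
  have "cmod (CLINT g|?G. 1 - (CLINT \<omega>|P. F g \<omega>))
     \<le> (LINT g|?G. (\<delta> + C * (cube_sq \<psi> + S)) + (C * R) * g + (C * cube_sq (\<phi> N)) * g\<^sup>2)"
    by (rule norm_integral_le) (use Gi gm bd in auto)
  also have "\<dots> = \<delta> + C * (cube_sq \<psi> + S) + C * cube_sq (\<phi> N)"
    using gm G.prob_space by simp
  finally show ?case unfolding eq eq2 by (simp add: S_def algebra_simps)
qed

text \<open>For the partial sums Q_N the Gaussian bound reads E(1 - exp(-t^2 Q_N / 2)) <= delta + C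
  t^2 T. On the event of divergence the integrand tends to 1, so this event has probability at most
  2 delta, for every delta > 0.\<close>

lemma AE_summable_squares:
  assumes \<phi>: "\<And>i::nat. \<phi> i \<in> torus_test" and S: "summable (\<lambda>i. cube_sq (\<phi> i))"
  shows "AE \<omega> in P. summable (\<lambda>i. (w \<omega> (\<phi> i))\<^sup>2)"
proof -
  have [measurable]: "(\<lambda>\<omega>. w \<omega> (\<phi> i)) \<in> borel_measurable P" for i
    using \<phi> by (rule w_measurable)
  define B where "B = {\<omega> \<in> space P. (\<Sum>i. ennreal ((w \<omega> (\<phi> i))\<^sup>2)) = \<infinity>}"
  have B[measurable]: "B \<in> sets P" unfolding B_def by measurable
  define T where "T = (\<Sum>i. cube_sq (\<phi> i))"
  have T: "T \<ge> 0" unfolding T_def by (intro suminf_nonneg S cube_sq_nonneg)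
  define Q where "Q = (\<lambda>N \<omega>. \<Sum>i<N. (w \<omega> (\<phi> i))\<^sup>2)"
  have Qm[measurable]: "Q N \<in> borel_measurable P" for N unfolding Q_def by measurable
  have Q0: "0 \<le> Q N \<omega>" for N \<omega> unfolding Q_def by (intro sum_nonneg) auto
  have main: "prob B \<le> 2 * \<delta>" if \<delta>: "0 < \<delta>" for \<delta>
  proof -
    obtain C where C: "C \<ge> 0" "\<And>\<phi>. \<phi> \<in> torus_test \<Longrightarrow> cmod (1 - char_functional P w \<phi>) \<le> \<delta> + C * cube_sq \<phi>"
      using char_bound[OF \<delta>] by blast
    \<comment> \<open>Chosen to make \<open>C * (t\<^sup>2 * T)\<close> at most
      \<open>\<delta>\<close>; the 1 in the denominator covers the case
      \<open>C * T = 0\<close>.\<close>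
    define t where "t = sqrt (\<delta> / (C * T + 1))"
    have CT: "0 < C * T + 1" using C(1) T by (simp add: add_nonneg_pos)
    have t2: "t\<^sup>2 = \<delta> / (C * T + 1)" "t > 0" unfolding t_def using \<delta> CT by simp_all
    have "C * T * t\<^sup>2 \<le> (C * T + 1) * t\<^sup>2" by (intro mult_right_mono) auto
    then have t3: "C * (t\<^sup>2 * T) \<le> \<delta>" using CT t2 by (simp add: mult_ac)
    have bound: "(LINT \<omega>|P. 1 - exp (- t\<^sup>2 * Q N \<omega> / 2)) \<le> 2 * \<delta>" for N
    proof -
      \<comment> \<open>The parameter \<open>t\<close> enters by scaling the test functions. Taking
        \<open>\<psi>\<close> to be 0 leaves the Gaussian factor alone under the
        expectation.\<close>
      let ?\<theta> = "\<lambda>i x. t * \<phi> i x"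
      have \<theta>: "?\<theta> i \<in> torus_test" for i by (intro torus_test_scale \<phi>)
      have z: "(\<lambda>x::real^'d. 0) \<in> torus_test" using torus_test_scale[OF \<phi>, of 0] by simp
      have wz: "w \<omega> (\<lambda>x. 0) = 0" if "\<omega> \<in> space P" for \<omega>
        using torus_test_lin(2)[OF w_dual[OF that] \<phi>, of 0 0] by simp
      have ei: "integrable P (\<lambda>\<omega>. exp (- t\<^sup>2 * Q N \<omega> / 2))"
        by (rule integrable_const_bound[where B=1]) (use Q0 in auto)
      have "cmod (1 - (CLINT \<omega>|P. iexp (w \<omega> (\<lambda>x. 0)) * of_real (exp (- (\<Sum>i<N. (w \<omega> (?\<theta> i))\<^sup>2) / 2))))
         \<le> \<delta> + C * (cube_sq (\<lambda>x::real^'d. 0) + (\<Sum>i<N. cube_sq (?\<theta> i)))"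
        by (rule gauss_bound[OF C \<theta> z])
      also have "(\<Sum>i<N. cube_sq (?\<theta> i)) = t\<^sup>2 * (\<Sum>i<N. cube_sq (\<phi> i))"
        by (simp add: cube_sq_scale sum_distrib_left)
      also have "\<delta> + C * (cube_sq (\<lambda>x::real^'d. 0) + t\<^sup>2 * (\<Sum>i<N. cube_sq (\<phi> i))) \<le> \<delta> + C * (t\<^sup>2 * T)"
        unfolding T_def using sum_le_suminf[OF S, of "{..<N}"] cube_sq_nonneg C(1)
        by (intro add_left_mono mult_left_mono) (auto simp: cube_sq_def intro!: mult_left_mono)
      also have "\<dots> \<le> 2 * \<delta>" using t3 by simp
      also have "(CLINT \<omega>|P. iexp (w \<omega> (\<lambda>x. 0)) * of_real (exp (- (\<Sum>i<N. (w \<omega> (?\<theta> i))\<^sup>2) / 2)))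
         = (CLINT \<omega>|P. of_real (exp (- t\<^sup>2 * Q N \<omega> / 2)))"
        by (rule Bochner_Integration.integral_cong[OF refl])
          (simp add: wz torus_test_lin(2)[OF w_dual \<phi>] Q_def power_mult_distrib sum_distrib_left sum_negf)
      also have "\<dots> = of_real (LINT \<omega>|P. exp (- t\<^sup>2 * Q N \<omega> / 2))" by (rule integral_complex_of_real)
      also have "1 - complex_of_real (LINT \<omega>|P. exp (- t\<^sup>2 * Q N \<omega> / 2)) = of_real (1 - (LINT \<omega>|P. exp (- t\<^sup>2 * Q N \<omega> / 2)))" by simp
      finally have "\<bar>1 - (LINT \<omega>|P. exp (- t\<^sup>2 * Q N \<omega> / 2))\<bar> \<le> 2 * \<delta>" by (simp only: norm_of_real)
      then show ?thesis using ei prob_space by simp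
    qed
    have lim: "(\<lambda>N. LINT \<omega>|P. indicator B \<omega> * (1 - exp (- t\<^sup>2 * Q N \<omega> / 2))) \<longlonglongrightarrow> (LINT \<omega>|P. indicator B \<omega> * 1)"
    proof (rule integral_dominated_convergence[where w="\<lambda>_. 1"])
      show "AE \<omega> in P. (\<lambda>N. indicator B \<omega> * (1 - exp (- t\<^sup>2 * Q N \<omega> / 2))) \<longlonglongrightarrow> indicator B \<omega> * 1"
      proof (intro AE_I2)
        fix \<omega>
        show "(\<lambda>N. indicator B \<omega> * (1 - exp (- t\<^sup>2 * Q N \<omega> / 2))) \<longlonglongrightarrow> indicator B \<omega> * 1"
        proof (cases "\<omega> \<in> B")
          case True
          then have ns: "\<not> summable (\<lambda>i. (w \<omega> (\<phi> i))\<^sup>2)"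
            unfolding B_def using suminf_ennreal2[of "\<lambda>i. (w \<omega> (\<phi> i))\<^sup>2"] by auto
          have "filterlim (\<lambda>N. Q N \<omega>) at_top sequentially"
            unfolding filterlim_at_top
          proof
            fix Z
            have "\<exists>N. \<not> Q N \<omega> \<le> Z"
              using ns summableI_nonneg_bounded[of "\<lambda>i. (w \<omega> (\<phi> i))\<^sup>2" Z] unfolding Q_def by auto
            then obtain N where "Q N \<omega> > Z" by (auto simp: not_le)
            moreover have "Q N \<omega> \<le> Q M \<omega>" if "N \<le> M" for M
              unfolding Q_def using that by (intro sum_mono2) auto
            ultimately show "\<forall>\<^sub>F N in sequentially. Z \<le> Q N \<omega>"
              unfolding eventually_sequentially by (meson less_imp_le order_trans)
          qed
          then have "filterlim (\<lambda>N. (t\<^sup>2 / 2) * Q N \<omega>) at_top sequentially"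
            by (rule filterlim_tendsto_pos_mult_at_top[OF tendsto_const, rotated]) (use \<open>t > 0\<close> in simp)
          then have "filterlim (\<lambda>N. - ((t\<^sup>2 / 2) * Q N \<omega>)) at_bot sequentially"
            by (rule filterlim_compose[OF filterlim_uminus_at_bot_at_top])
          then have "(\<lambda>N. exp (- ((t\<^sup>2 / 2) * Q N \<omega>))) \<longlonglongrightarrow> 0"
            by (rule filterlim_compose[OF exp_at_bot])
          then have "(\<lambda>N. indicator B \<omega> * (1 - exp (- ((t\<^sup>2 / 2) * Q N \<omega>)))) \<longlonglongrightarrow> indicator B \<omega> * (1 - 0)"
            by (intro tendsto_intros)
          then show ?thesis by simp
        qed simp
      qed
      show "AE \<omega> in P. norm (indicator B \<omega> * (1 - exp (- t\<^sup>2 * Q N \<omega> / 2))) \<le> 1" for N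
        using Q0[of N] by (intro AE_I2) (auto simp: indicator_def abs_le_iff intro: order_trans[of _ 0])
    qed simp_all
    have "(LINT \<omega>|P. indicator B \<omega> * 1) \<le> 2 * \<delta>"
    proof (rule LIMSEQ_le_const2[OF lim], intro exI allI impI)
      fix N
      have "(LINT \<omega>|P. indicator B \<omega> * (1 - exp (- t\<^sup>2 * Q N \<omega> / 2))) \<le> (LINT \<omega>|P. 1 - exp (- t\<^sup>2 * Q N \<omega> / 2))"
        using Q0[of N] by (intro integral_mono integrable_const_bound[where B=1])
           (auto simp: indicator_def abs_le_iff intro: order_trans[of _ 0])
      then show "(LINT \<omega>|P. indicator B \<omega> * (1 - exp (- t\<^sup>2 * Q N \<omega> / 2))) \<le> 2 * \<delta>" using bound[of N] by linarith
    qed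
    then show ?thesis using B by simp
  qed
  have "prob B \<le> 0"
    by (rule field_le_epsilon) (use main[of "e / 2" for e] in auto)
  then have "B \<in> null_sets P" using B measure_le_0_iff by (auto simp: null_sets_def emeasure_eq_measure)
  then have "AE \<omega> in P. \<omega> \<notin> B" by (rule AE_not_in)
  then show ?thesis
    by (rule AE_mp) (auto intro!: AE_I2 summable_suminf_not_top simp: B_def)
qed

end

section \<open>Test functions\<close>

lemma cont_diff_Suc_D: "cont_diff (Suc k) f \<Longrightarrow> cont_diff k f"
proof (induction k arbitrary: f)
  case 0
  then show ?case
    by (auto simp: continuous_on_eq_continuous_within intro: differentiable_imp_continuous_within)
next
  case (Suc k)
  have "\<forall>b\<in>Basis. cont_diff k (partial_deriv b f)"
    using Suc.prems by (auto intro!: Suc.IH simp del: cont_diff.simps(2) simp: cont_diff.simps(2)[of "Suc k"])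
  then show ?case using Suc.prems by simp
qed

lemma cont_diff_const: "cont_diff k (\<lambda>x::'a::euclidean_space. c)"
proof (induction k arbitrary: c)
  case (Suc k)
  have "partial_deriv b (\<lambda>x::'a. c) = (\<lambda>x. 0)" for b by (simp add: partial_deriv_def)
  then show ?case using Suc by simp
qed simp

lemma cont_diff_mult: "cont_diff k f \<Longrightarrow> cont_diff k g \<Longrightarrow> cont_diff k (\<lambda>x. f x * g x)"
proof (induction k arbitrary: f g)
  case (Suc k)
  have "partial_deriv b (\<lambda>x. f x * g x) = (\<lambda>x. f x * partial_deriv b g x + partial_deriv b f x * g x)" for b
  proof
    fix x
    have "(f has_derivative frechet_derivative f (at x)) (at x)" "(g has_derivative frechet_derivative g (at x)) (at x)"
      using Suc.prems by (simp_all add: frechet_derivative_works)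
    then have "((\<lambda>x. f x * g x) has_derivative (\<lambda>h. f x * frechet_derivative g (at x) h + frechet_derivative f (at x) h * g x)) (at x)"
      by (rule has_derivative_mult)
    then show "partial_deriv b (\<lambda>x. f x * g x) x = f x * partial_deriv b g x + partial_deriv b f x * g x"
      unfolding partial_deriv_def by (simp add: frechet_derivative_at[symmetric])
  qed
  moreover have "cont_diff k f" "cont_diff k g" using Suc.prems by (auto intro: cont_diff_Suc_D simp del: cont_diff.simps)
  ultimately show ?case using Suc by (auto intro!: derivative_intros cont_diff_add)
qed (auto intro: continuous_intros)

text \<open>Sine and cosine need a common induction, since differentiation exchanges them.\<close>

lemma cont_diff_trig:
  fixes i :: "'d::finite"
  shows "cont_diff k (\<lambda>x::real^'d. cos (2 * pi * x $ i)) \<and> cont_diff k (\<lambda>x::real^'d. sin (2 * pi * x $ i))"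
proof (induction k)
  case (Suc k)
  have c: "((\<lambda>x::real^'d. cos (2 * pi * x $ i)) has_derivative (\<lambda>h. (- (2 * pi) * h $ i) * sin (2 * pi * x $ i))) (at x)"
    and s: "((\<lambda>x::real^'d. sin (2 * pi * x $ i)) has_derivative (\<lambda>h. ((2 * pi) * h $ i) * cos (2 * pi * x $ i))) (at x)" for x
    by (auto intro!: derivative_eq_intros simp: bounded_linear_vec_nth bounded_linear_imp_has_derivative)
  have "partial_deriv b (\<lambda>x::real^'d. cos (2 * pi * x $ i)) = (\<lambda>x. (- (2 * pi) * b $ i) * sin (2 * pi * x $ i))"
    "partial_deriv b (\<lambda>x::real^'d. sin (2 * pi * x $ i)) = (\<lambda>x. ((2 * pi) * b $ i) * cos (2 * pi * x $ i))" for b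
    unfolding partial_deriv_def frechet_derivative_at[OF c, symmetric] frechet_derivative_at[OF s, symmetric] by simp_all
  then show ?case
    by (simp only: cont_diff.simps) (intro conjI allI ballI cont_diff_scale differentiableI[OF c] differentiableI[OF s]; use Suc in blast)
qed (auto intro!: continuous_intros)

lemma torus_test_const: "(\<lambda>x. c) \<in> torus_test"
  by (simp add: torus_test_def cont_diff_const)

lemma torus_test_mult: "\<phi> \<in> torus_test \<Longrightarrow> \<psi> \<in> torus_test \<Longrightarrow> (\<lambda>x. \<phi> x * \<psi> x) \<in> torus_test"
  by (auto simp: torus_test_def cont_diff_mult)

lemma torus_test_sum: "finite I \<Longrightarrow> (\<And>i. i \<in> I \<Longrightarrow> \<phi> i \<in> torus_test) \<Longrightarrow> (\<lambda>x. \<Sum>i\<in>I. \<phi> i x) \<in> torus_test"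
  by (induction I rule: finite_induct) (auto intro: torus_test_const torus_test_add)

lemma torus_test_periodic: "\<phi> \<in> torus_test \<Longrightarrow> \<phi> (x + int_vec n) = \<phi> x"
  by (simp add: torus_test_def)

lemma torus_test_trig:
  "(\<lambda>x::real^'d. cos (2 * pi * x $ i)) \<in> torus_test" "(\<lambda>x::real^'d. sin (2 * pi * x $ i)) \<in> torus_test"
proof -
  have "\<exists>k::int. 2 * pi * (x + int_vec n) $ i = 2 * pi * x $ i + 2 * pi * of_int k" for x :: "real^'d" and n
    by (rule exI[of _ "n $ i"]) (simp add: int_vec_def algebra_simps)
  then have "cos (2 * pi * (x + int_vec n) $ i) = cos (2 * pi * x $ i)" "sin (2 * pi * (x + int_vec n) $ i) = sin (2 * pi * x $ i)" for x :: "real^'d" and n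
    by (metis sin_cos_eq_iff)+
  then show "(\<lambda>x::real^'d. cos (2 * pi * x $ i)) \<in> torus_test" "(\<lambda>x::real^'d. sin (2 * pi * x $ i)) \<in> torus_test"
    using cont_diff_trig[of _ i] by (auto simp: torus_test_def)
qed

lemma torus_test_partial_deriv:
  assumes "\<phi> \<in> torus_test" "b \<in> Basis"
  shows "partial_deriv b \<phi> \<in> torus_test"
proof -
  have "cont_diff (Suc k) \<phi>" for k using assms by (auto simp: torus_test_def simp del: cont_diff.simps)
  then have 1: "cont_diff k (partial_deriv b \<phi>)" for k using assms(2) by auto
  have d: "\<phi> differentiable (at x)" for x using \<open>cont_diff (Suc 0) \<phi>\<close> by simp
  have "partial_deriv b \<phi> (x + int_vec n) = partial_deriv b \<phi> x" for x n
  proof -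
    let ?D = "frechet_derivative \<phi> (at (x + int_vec n))"
    have "(\<phi> has_derivative ?D) (at (x + int_vec n))" using d by (simp add: frechet_derivative_works)
    then have "((\<lambda>x. \<phi> (x + int_vec n)) has_derivative ?D) (at x)"
      by (rule has_derivative_compose[of "\<lambda>x. x + int_vec n" "\<lambda>h. h" x UNIV \<phi>, rotated]) (auto intro!: derivative_eq_intros)
    then have "(\<phi> has_derivative ?D) (at x)"
      using assms(1) by (simp add: torus_test_periodic)
    then show ?thesis unfolding partial_deriv_def by (simp add: frechet_derivative_at[symmetric])
  qed
  then show ?thesis using 1 by (simp add: torus_test_def)
qed

lemma torus_test_foldr: "\<phi> \<in> torus_test \<Longrightarrow> set bs \<subseteq> Basis \<Longrightarrow> foldr partial_deriv bs \<phi> \<in> torus_test"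
  by (induction bs) (auto intro: torus_test_partial_deriv)

lemma torus_test_differentiable: "\<phi> \<in> torus_test \<Longrightarrow> \<phi> differentiable (at x)"
proof -
  assume "\<phi> \<in> torus_test"
  then have "cont_diff (Suc 0) \<phi>" by (auto simp: torus_test_def simp del: cont_diff.simps)
  then show ?thesis by simp
qed

lemma partial_deriv_diff:
  assumes "\<phi> \<in> torus_test" "\<psi> \<in> torus_test"
  shows "partial_deriv b (\<lambda>x. \<phi> x - \<psi> x) = (\<lambda>x. partial_deriv b \<phi> x - partial_deriv b \<psi> x)"
proof
  fix x
  have "(\<phi> has_derivative frechet_derivative \<phi> (at x)) (at x)" "(\<psi> has_derivative frechet_derivative \<psi> (at x)) (at x)"
    using assms by (auto simp: frechet_derivative_works[symmetric] torus_test_differentiable)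
  then have "((\<lambda>x. \<phi> x - \<psi> x) has_derivative (\<lambda>h. frechet_derivative \<phi> (at x) h - frechet_derivative \<psi> (at x) h)) (at x)"
    by (rule has_derivative_diff)
  then show "partial_deriv b (\<lambda>x. \<phi> x - \<psi> x) x = partial_deriv b \<phi> x - partial_deriv b \<psi> x"
    unfolding partial_deriv_def by (simp add: frechet_derivative_at[symmetric])
qed

lemma foldr_partial_deriv_diff:
  assumes "\<phi> \<in> torus_test" "\<psi> \<in> torus_test" "set bs \<subseteq> Basis"
  shows "foldr partial_deriv bs (\<lambda>x. \<phi> x - \<psi> x) = (\<lambda>x. foldr partial_deriv bs \<phi> x - foldr partial_deriv bs \<psi> x)"
  using assms(3) by (induction bs) (simp_all add: partial_deriv_diff torus_test_foldr assms)

lemma cube_representative: "\<exists>y n. y \<in> cbox 0 1 \<and> x = y + int_vec n" for x :: "real^'d"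
proof (intro exI conjI)
  show "(\<chi> i. x $ i - of_int \<lfloor>x $ i\<rfloor>) \<in> cbox 0 1"
    by (simp add: mem_box_cart) linarith
  show "x = (\<chi> i. x $ i - of_int \<lfloor>x $ i\<rfloor>) + int_vec (\<chi> i. \<lfloor>x $ i\<rfloor>)"
    by (simp add: vec_eq_iff int_vec_def)
qed

lemma periodic_all_cube:
  assumes "\<And>x n. f (x + int_vec n) = f x" "\<And>x. x \<in> cbox 0 1 \<Longrightarrow> Q (f x)"
  shows "Q (f (x :: real^'d))"
  using cube_representative[of x] assms by metis

lemma torus_test_bounded: 
  assumes "\<phi> \<in> torus_test" shows "\<exists>B. \<forall>x. \<bar>\<phi> x\<bar> \<le> B"
proof -
  have "compact (\<phi> ` cbox 0 1)"
    by (intro compact_continuous_image torus_test_continuous assms compact_cbox)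
  then obtain B where "\<And>x. x \<in> cbox 0 1 \<Longrightarrow> \<bar>\<phi> x\<bar> \<le> B"
    using compact_imp_bounded bounded_iff by (metis imageI real_norm_def)
  then have "\<bar>\<phi> x\<bar> \<le> B" for x
    using periodic_all_cube[of \<phi> "\<lambda>y. \<bar>y\<bar> \<le> B" x] torus_test_periodic[OF assms] by auto
  then show ?thesis by blast
qed

lemma torus_seminorm_le: "(\<And>x. \<bar>foldr partial_deriv bs \<phi> x\<bar> \<le> e) \<Longrightarrow> torus_seminorm bs \<phi> \<le> e"
  unfolding torus_seminorm_def by (intro cSUP_least) auto

lemma torus_seminorm_ge:
  assumes "\<phi> \<in> torus_test" "set bs \<subseteq> Basis"
  shows "\<bar>foldr partial_deriv bs \<phi> x\<bar> \<le> torus_seminorm bs \<phi>"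
proof -
  obtain B where "\<And>x. \<bar>foldr partial_deriv bs \<phi> x\<bar> \<le> B"
    using torus_test_bounded[OF torus_test_foldr[OF assms]] by blast
  then have "bdd_above (range (\<lambda>x. \<bar>foldr partial_deriv bs \<phi> x\<bar>))"
    by (intro bdd_aboveI[of _ B]) auto
  then show ?thesis unfolding torus_seminorm_def by (rule cSUP_upper[rotated]) simp
qed

text \<open>Stated with sequences, because these suffice to carry an identity from a countable dense
  set to all test functions.\<close>

definition smooth_limit :: "(nat \<Rightarrow> real^'d \<Rightarrow> real) \<Rightarrow> (real^'d \<Rightarrow> real) \<Rightarrow> bool" where
  "smooth_limit \<psi> \<phi> \<longleftrightarrow> (\<forall>bs. set bs \<subseteq> Basis \<longrightarrow>
     uniform_limit UNIV (\<lambda>n. foldr partial_deriv bs (\<psi> n)) (foldr partial_deriv bs \<phi>) sequentially)"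

lemma torus_dual_tendsto:
  fixes u :: "(real^'d \<Rightarrow> real) \<Rightarrow> real"
  assumes u: "u \<in> torus_dual" and \<phi>: "\<phi> \<in> torus_test" and \<psi>: "\<And>n. \<psi> n \<in> torus_test"
    and lim: "smooth_limit \<psi> \<phi>"
  shows "(\<lambda>n. u (\<psi> n)) \<longlonglongrightarrow> u \<phi>"
proof -
  let ?S = "{{\<psi> \<in> torus_test. torus_seminorm bs (\<lambda>x. \<psi> x - \<phi> x) < e} | (\<phi>::real^'d \<Rightarrow> real) bs e.
        \<phi> \<in> torus_test \<and> set bs \<subseteq> Basis \<and> 0 < e}"
  \<comment> \<open>The generating sets are only a subbasis; eventual membership is carried through
    finite intersections and arbitrary unions by induction.\<close>
  have ev: "\<forall>\<^sub>F n in sequentially. \<psi> n \<in> U" if "generate_topology_on ?S U" "\<phi> \<in> U" for U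
    using that
  proof (induction U rule: generate_topology_on.induct)
    case (Basis U)
    then obtain \<theta> bs e where U: "U = {\<psi> \<in> torus_test. torus_seminorm bs (\<lambda>x. \<psi> x - \<theta> x) < e}"
      and \<theta>: "\<theta> \<in> torus_test" "set bs \<subseteq> Basis" "0 < e" by blast
    \<comment> \<open>The ball is centred at \<open>\<theta>\<close> and not at
      \<open>\<phi>\<close>; \<open>d\<close> is the room that \<open>\<phi>\<close> leaves inside
      it.\<close>
    define d where "d = e - torus_seminorm bs (\<lambda>x. \<phi> x - \<theta> x)"
    have d: "d > 0" using Basis U by (simp add: d_def)
    have "\<forall>\<^sub>F n in sequentially. \<forall>x\<in>UNIV. dist (foldr partial_deriv bs (\<psi> n) x) (foldr partial_deriv bs \<phi> x) < d / 2"
      using lim \<theta>(2) half_gt_zero[OF d] unfolding smooth_limit_def uniform_limit_iff by blast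
    then show ?case
    proof (rule eventually_mono)
      fix n assume n: "\<forall>x\<in>UNIV. dist (foldr partial_deriv bs (\<psi> n) x) (foldr partial_deriv bs \<phi> x) < d / 2"
      have "torus_seminorm bs (\<lambda>x. \<psi> n x - \<theta> x) \<le> d / 2 + torus_seminorm bs (\<lambda>x. \<phi> x - \<theta> x)"
      proof (rule torus_seminorm_le)
        fix x
        have "\<bar>foldr partial_deriv bs \<phi> x - foldr partial_deriv bs \<theta> x\<bar> \<le> torus_seminorm bs (\<lambda>x. \<phi> x - \<theta> x)"
          using torus_seminorm_ge[OF torus_test_diff[OF \<phi> \<theta>(1)] \<theta>(2), of x]
          by (simp add: foldr_partial_deriv_diff[OF \<phi> \<theta>(1) \<theta>(2)])
        moreover have "\<bar>foldr partial_deriv bs (\<psi> n) x - foldr partial_deriv bs \<phi> x\<bar> < d / 2"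
          using n by (simp add: dist_real_def)
        ultimately show "\<bar>foldr partial_deriv bs (\<lambda>x. \<psi> n x - \<theta> x) x\<bar> \<le> d / 2 + torus_seminorm bs (\<lambda>x. \<phi> x - \<theta> x)"
          unfolding foldr_partial_deriv_diff[OF \<psi> \<theta>(1) \<theta>(2)] by linarith
      qed
      then have "torus_seminorm bs (\<lambda>x. \<psi> n x - \<theta> x) < e" using d unfolding d_def by argo
      then show "\<psi> n \<in> U" using U \<psi> by simp
    qed
  next
    case (Int a b)
    then show ?case by (simp add: eventually_conj_iff)
  next
    case (UN K)
    then obtain k where "k \<in> K" "\<phi> \<in> k" by auto
    then show ?case using UN.IH[of k] by (auto elim: eventually_mono)
  qed simp
  have top: "topspace (torus_test_topology :: (real^'d \<Rightarrow> real) topology) = torus_test"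
  proof
    show "topspace (torus_test_topology :: (real^'d \<Rightarrow> real) topology) \<subseteq> torus_test"
      unfolding torus_test_topology_def topology_generated_by_topspace by blast
    show "torus_test \<subseteq> topspace (torus_test_topology :: (real^'d \<Rightarrow> real) topology)"
    proof
      fix \<theta> :: "real^'d \<Rightarrow> real" assume \<theta>: "\<theta> \<in> torus_test"
      have "{\<psi> \<in> torus_test. torus_seminorm [] (\<lambda>x. \<psi> x - \<theta> x) < 1} \<in> ?S"
        using \<theta> by (intro CollectI exI[of _ \<theta>] exI[of _ "[]"] exI[of _ 1]) simp
      moreover have "\<theta> \<in> {\<psi> \<in> torus_test. torus_seminorm [] (\<lambda>x. \<psi> x - \<theta> x) < 1}"
        using \<theta> by (simp add: torus_seminorm_def)
      ultimately show "\<theta> \<in> topspace torus_test_topology"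
        unfolding torus_test_topology_def topology_generated_by_topspace by (rule UnionI)
    qed
  qed
  have "limitin torus_test_topology \<psi> \<phi> sequentially"
    unfolding limitin_def
  proof (intro conjI allI impI)
    show "\<phi> \<in> topspace torus_test_topology" using \<phi> top by simp
    fix U assume "openin torus_test_topology U \<and> \<phi> \<in> U"
    then show "\<forall>\<^sub>F n in sequentially. \<psi> n \<in> U"
      using ev unfolding torus_test_topology_def openin_topology_generated_by_iff by blast
  qed
  moreover have "continuous_map torus_test_topology euclideanreal u"
    using u by (simp add: torus_dual_def)
  ultimately have "limitin euclideanreal (u \<circ> \<psi>) (u \<phi>) sequentially"
    by (rule continuous_map_limit[rotated])
  then show ?thesis by (simp add: comp_def)
qed

text \<open>Functions with the same rounded values on a fine finite net are uniformly close, and there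
  are only countably many tables of rounded values.\<close>

lemma countable_uniformly_dense:
  fixes ev :: "'a \<Rightarrow> 't \<Rightarrow> 'x::metric_space \<Rightarrow> real"
  assumes A: "finite A" and K: "compact K"
    and cont: "\<And>a t. a \<in> A \<Longrightarrow> t \<in> T \<Longrightarrow> continuous_on K (ev a t)"
  shows "\<exists>D\<subseteq>T. countable D \<and> (\<forall>t\<in>T. \<forall>e>0. \<exists>s\<in>D. \<forall>a\<in>A. \<forall>x\<in>K. \<bar>ev a s x - ev a t x\<bar> < e)"
proof -
  define r where "r = (\<lambda>n. 1 / real (Suc n))"
  have r: "0 < r n" for n by (simp add: r_def)
  have "\<exists>F. finite F \<and> F \<subseteq> K \<and> K \<subseteq> (\<Union>x\<in>F. ball x (r n))" for n
    using seq_compact_imp_totally_bounded[OF compact_imp_seq_compact[OF K]] r[of n] by simp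
  then obtain F where F: "\<And>n. finite (F n)" "\<And>n. F n \<subseteq> K" "\<And>n. K \<subseteq> (\<Union>x\<in>F n. ball x (r n))" by metis
  \<comment> \<open>Functions whose oscillation over distances below \<open>r n\<close> is less than
    \<open>r m\<close>. For every \<open>m\<close>, each \<open>t\<close> lies in such a class for
    some \<open>n\<close>; within a class, values on the net \<open>F n\<close> determine a function
    up to errors of size \<open>r m\<close>.\<close>
  define U where "U = (\<lambda>n m. {t\<in>T. \<forall>a\<in>A. \<forall>x\<in>K. \<forall>y\<in>K. dist x y < r n \<longrightarrow> \<bar>ev a t x - ev a t y\<bar> < r m})"
  define key where "key = (\<lambda>n m t. \<lambda>(a, x)\<in>A \<times> F n. \<lfloor>ev a t x / r m\<rfloor>)"
  \<comment> \<open>One representative for each table that occurs. It is taken inside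
    \<open>U n m\<close>, so it oscillates as little as the function it replaces.\<close>
  define pick where "pick = (\<lambda>n m. inv_into (U n m) (key n m))"
  define D where "D = (\<Union>n. \<Union>m. pick n m ` (key n m ` U n m))"
  have pick: "pick n m (key n m t) \<in> U n m" "key n m (pick n m (key n m t)) = key n m t" if "t \<in> U n m" for n m t
    unfolding pick_def using that by (auto intro: inv_into_into f_inv_into_f)
  have "D \<subseteq> T"
  proof
    fix s assume "s \<in> D"
    then obtain n m t where "t \<in> U n m" "s = pick n m (key n m t)" by (auto simp: D_def)
    then have "s \<in> U n m" using pick(1) by simp
    then show "s \<in> T" by (simp add: U_def)
  qed
  moreover have "countable D"
  proof -
    have "countable (key n m ` U n m)" for n m
    proof (rule countable_subset)
      show "key n m ` U n m \<subseteq> PiE (A \<times> F n) (\<lambda>_. UNIV)"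
        by (simp add: key_def image_subset_iff restrict_PiE_iff)
      show "countable (PiE (A \<times> F n) (\<lambda>_. UNIV :: int set))"
        by (rule countable_PiE) (use A F(1) in auto)
    qed
    then show ?thesis unfolding D_def by blast
  qed
  moreover have "\<exists>s\<in>D. \<forall>a\<in>A. \<forall>x\<in>K. \<bar>ev a s x - ev a t x\<bar> < e" if t: "t \<in> T" and e: "e > 0" for t e
  proof -
    \<comment> \<open>Three errors add up: the oscillation of each of the two functions between
      \<open>x\<close> and a net point, and the rounding.\<close>
    obtain m where m: "r m < e / 3" using e unfolding r_def
      by (meson nat_approx_posE divide_pos_pos zero_less_numeral)
    \<comment> \<open>Finitely many functions share one modulus of uniform continuity, obtained by
      taking minima.\<close>
    have "A' \<subseteq> A \<Longrightarrow> \<exists>d>0. \<forall>a\<in>A'. \<forall>x\<in>K. \<forall>y\<in>K. dist x y < d \<longrightarrow> \<bar>ev a t x - ev a t y\<bar> < r m" for A'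
      using finite_subset[OF _ A, of A']
    proof (induction A' rule: infinite_finite_induct)
      case (insert a A')
      then obtain d where d: "d > 0" "\<And>a x y. a \<in> A' \<Longrightarrow> x \<in> K \<Longrightarrow> y \<in> K \<Longrightarrow> dist x y < d \<Longrightarrow> \<bar>ev a t x - ev a t y\<bar> < r m"
        by auto
      have "uniformly_continuous_on K (ev a t)"
        using insert t by (intro compact_uniformly_continuous cont K) auto
      then obtain d' where d': "d' > 0" "\<And>x y. x \<in> K \<Longrightarrow> y \<in> K \<Longrightarrow> dist x y < d' \<Longrightarrow> \<bar>ev a t x - ev a t y\<bar> < r m"
        unfolding uniformly_continuous_on_def dist_real_def using r[of m] by (metis dist_commute abs_minus_commute)
      show ?case by (rule exI[of _ "min d d'"]) (use d d' in auto)
    qed (auto intro: exI[of _ 1])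
    from this[OF subset_refl] obtain d where d: "d > 0" "\<And>a x y. a \<in> A \<Longrightarrow> x \<in> K \<Longrightarrow> y \<in> K \<Longrightarrow> dist x y < d \<Longrightarrow> \<bar>ev a t x - ev a t y\<bar> < r m" by blast
    obtain n where n: "r n < d" using d(1) unfolding r_def by (meson nat_approx_posE)
    have tU: "t \<in> U n m" unfolding U_def using t d(2) n by force
    define s where "s = pick n m (key n m t)"
    have s: "s \<in> U n m" "key n m s = key n m t" using pick[OF tU] by (simp_all add: s_def)
    have "s \<in> D" unfolding D_def s_def using tU by blast
    moreover have "\<bar>ev a s x - ev a t x\<bar> < e" if a: "a \<in> A" and x: "x \<in> K" for a x
    proof -
      obtain y where y: "y \<in> F n" "dist x y < r n" using F(3)[of n] x by (auto simp: dist_commute)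
      have yK: "y \<in> K" using y F by blast
      have "\<bar>ev a s x - ev a s y\<bar> < r m" "\<bar>ev a t x - ev a t y\<bar> < r m"
        using s(1) tU a x yK y(2) unfolding U_def by blast+
      moreover have "\<lfloor>ev a s y / r m\<rfloor> = \<lfloor>ev a t y / r m\<rfloor>"
        using fun_cong[OF s(2), of "(a, y)"] a y(1) by (simp add: key_def)
      then have "\<bar>ev a s y / r m - ev a t y / r m\<bar> < 1" by linarith
      then have "\<bar>ev a s y - ev a t y\<bar> < r m"
        using r[of m] by (simp add: diff_divide_distrib[symmetric] abs_divide divide_less_eq)
      ultimately show ?thesis using m by linarith
    qed
    ultimately show ?thesis by blast
  qed
  ultimately show ?thesis by blast
qed

text \<open>For each \<open>k\<close> the net construction is applied to the derivatives of order at
  most \<open>k\<close> on the compact cube. A diagonal choice from \<open>D k\<close> with accuracy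
  \<open>1 / Suc k\<close> converges in every derivative, and periodicity extends the estimates
  beyond the cube.\<close>

lemma torus_test_separable:
  "\<exists>D. countable D \<and> D \<subseteq> (torus_test :: (real^'d \<Rightarrow> real) set) \<and>
     (\<forall>\<phi>\<in>torus_test. \<exists>\<psi>. range \<psi> \<subseteq> D \<and> smooth_limit \<psi> \<phi>)"
proof -
  define A where "A = (\<lambda>k. {bs :: (real^'d) list. set bs \<subseteq> Basis \<and> length bs \<le> k})"
  have "\<exists>D\<subseteq>torus_test. countable D \<and> (\<forall>t\<in>torus_test. \<forall>e>0. \<exists>s\<in>D. \<forall>bs\<in>A k. \<forall>x\<in>cbox (0::real^'d) 1.
      \<bar>foldr partial_deriv bs s x - foldr partial_deriv bs t x\<bar> < e)" for k
  proof (rule countable_uniformly_dense)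
    show "finite (A k)" unfolding A_def by (rule finite_lists_length_le) simp
    show "continuous_on (cbox 0 1) (foldr partial_deriv bs t)" if "bs \<in> A k" "t \<in> torus_test" for bs t
      using that by (auto simp: A_def intro: torus_test_continuous torus_test_foldr)
  qed simp
  then obtain D where D: "\<And>k. D k \<subseteq> torus_test" "\<And>k. countable (D k)"
    "\<And>k t e. t \<in> torus_test \<Longrightarrow> 0 < e \<Longrightarrow> \<exists>s\<in>D k. \<forall>bs\<in>A k. \<forall>x\<in>cbox (0::real^'d) 1.
      \<bar>foldr partial_deriv bs s x - foldr partial_deriv bs t x\<bar> < e" by metis
  show ?thesis
  proof (intro exI[of _ "\<Union>k. D k"] conjI ballI)
    show "countable (\<Union>k. D k)" using D(2) by blast
    show "(\<Union>k. D k) \<subseteq> torus_test" using D(1) by blast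
    fix \<phi> :: "real^'d \<Rightarrow> real" assume \<phi>: "\<phi> \<in> torus_test"
    have "\<forall>k. \<exists>s\<in>D k. \<forall>bs\<in>A k. \<forall>x\<in>cbox (0::real^'d) 1.
      \<bar>foldr partial_deriv bs s x - foldr partial_deriv bs \<phi> x\<bar> < 1 / Suc k"
      using D(3)[OF \<phi>] by simp
    then obtain \<psi> where \<psi>: "\<And>k. \<psi> k \<in> D k" "\<And>k bs x. bs \<in> A k \<Longrightarrow> x\<in>cbox (0::real^'d) 1 \<Longrightarrow>
      \<bar>foldr partial_deriv bs (\<psi> k) x - foldr partial_deriv bs \<phi> x\<bar> < 1 / Suc k" by metis
    have "smooth_limit \<psi> \<phi>"
      unfolding smooth_limit_def uniform_limit_iff
    proof (intro allI impI)
      fix bs :: "(real^'d) list" and e :: real assume bs: "set bs \<subseteq> Basis" and "e > 0"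
      obtain N where N: "1 / Suc N < e" using \<open>e > 0\<close> by (meson nat_approx_posE)
      show "\<forall>\<^sub>F n in sequentially. \<forall>x\<in>UNIV. dist (foldr partial_deriv bs (\<psi> n) x) (foldr partial_deriv bs \<phi> x) < e"
        unfolding eventually_sequentially
      \<comment> \<open>From the index \<open>length bs\<close> on, this derivative is among those
        controlled by \<open>A n\<close>.\<close>
      proof (intro exI[of _ "max N (length bs)"] allI impI ballI)
        fix n x assume n: "max N (length bs) \<le> n"
        have t: "\<psi> n \<in> torus_test" using \<psi>(1) D(1) by blast
        let ?f = "\<lambda>x. foldr partial_deriv bs (\<psi> n) x - foldr partial_deriv bs \<phi> x"
        have "\<bar>?f x\<bar> < 1 / Suc n"
        proof (rule periodic_all_cube[of ?f "\<lambda>y. \<bar>y\<bar> < 1 / Suc n"])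
          show "?f (x + int_vec m) = ?f x" for x m
            using torus_test_periodic[OF torus_test_foldr[OF t bs]] torus_test_periodic[OF torus_test_foldr[OF \<phi> bs]] by simp
          show "\<bar>?f x\<bar> < 1 / Suc n" if "x \<in> cbox 0 1" for x
            using \<psi>(2)[of bs n x] that bs n by (simp add: A_def)
        qed
        also have "1 / Suc n \<le> 1 / Suc N" using n by (simp add: frac_le)
        finally show "dist (foldr partial_deriv bs (\<psi> n) x) (foldr partial_deriv bs \<phi> x) < e"
          using N by (simp add: dist_real_def)
      qed
    qed
    then show "\<exists>\<psi>. range \<psi> \<subseteq> (\<Union>k. D k) \<and> smooth_limit \<psi> \<phi>" using \<psi>(1) by blast
  qed
qed

text \<open>Periodic functions on \<open>real^'d\<close> become functions on a compact set, to which the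
  Stone-Weierstrass theorem applies.\<close>

definition torus_embed :: "real^'d \<Rightarrow> (real^'d) \<times> (real^'d)" where
  "torus_embed x = ((\<chi> i. cos (2 * pi * x $ i)), (\<chi> i. sin (2 * pi * x $ i)))"

lemma torus_test_polynomial:
  assumes "real_polynomial_function g"
  shows "(\<lambda>x::real^'d. g (torus_embed x)) \<in> torus_test"
  using assms
proof (induction g rule: real_polynomial_function.induct)
  case (linear f)
  have b: "(\<lambda>x::real^'d. torus_embed x \<bullet> b) \<in> torus_test" if "b \<in> Basis" for b
  proof -
    have "(\<exists>i. b = (axis i 1, 0)) \<or> (\<exists>i. b = (0, axis i 1))"
      using that by (auto simp: Basis_prod_def Basis_vec_def)
    then show ?thesis
      using torus_test_trig by (auto simp: torus_embed_def inner_axis)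
  qed
  have eq: "f z = (\<Sum>b\<in>Basis. (z \<bullet> b) * f b)" for z
    using linear_sum[OF bounded_linear.linear[OF linear], of "\<lambda>b. (z \<bullet> b) *\<^sub>R b" Basis]
      linear_cmul[OF bounded_linear.linear[OF linear]] by (simp add: euclidean_representation)
  have "(\<lambda>x::real^'d. f (torus_embed x)) = (\<lambda>x. \<Sum>b\<in>Basis. f b * (torus_embed x \<bullet> b))"
    by (rule ext, rule trans[OF eq]) (simp only: mult.commute)
  also have "\<dots> \<in> torus_test" using b by (intro torus_test_sum torus_test_scale) auto
  finally show ?case .
qed (auto intro: torus_test_const torus_test_add torus_test_mult)

text \<open>Points of the cube with equal image under \<open>torus_embed\<close> differ by an
  integer vector, so \<open>f\<close> factors through the compact image. Polynomials are dense
  there, and pulled back they are trigonometric polynomials.\<close>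

lemma torus_test_uniformly_dense:
  fixes f :: "real^'d \<Rightarrow> real"
  assumes cont: "continuous_on (cbox 0 1) f" and per: "\<And>x n. f (x + int_vec n) = f x" and e: "0 < e"
  shows "\<exists>\<phi>\<in>torus_test. \<forall>x\<in>cbox 0 1. \<bar>f x - \<phi> x\<bar> < e"
proof -
  let ?C = "cbox (0::real^'d) 1"
  define S where "S = torus_embed ` ?C"
  have ce: "continuous_on X torus_embed" for X :: "(real^'d) set"
    unfolding torus_embed_def by (intro continuous_intros)
  have S: "compact S" unfolding S_def by (intro compact_continuous_image ce compact_cbox)
  define h where "h = (\<lambda>z. f (inv_into ?C torus_embed z))"
  have h: "h (torus_embed x) = f x" if x: "x \<in> ?C" for x
  proof -
    let ?y = "inv_into ?C torus_embed (torus_embed x)"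
    have "torus_embed ?y = torus_embed x" using x by (intro f_inv_into_f) simp
    then have "\<forall>i. \<exists>n::int. 2 * pi * ?y $ i = 2 * pi * x $ i + 2 * pi * of_int n"
      by (simp add: torus_embed_def vec_eq_iff sin_cos_eq_iff[symmetric])
    then obtain n where n: "\<And>i. 2 * pi * ?y $ i = 2 * pi * x $ i + 2 * pi * of_int (n i)" by metis
    have "?y = x + int_vec (\<chi> i. n i)"
    proof (subst vec_eq_iff, intro allI)
      fix i
      have "2 * pi * ?y $ i = 2 * pi * (x $ i + of_int (n i))" using n[of i] by (simp add: distrib_left)
      then show "?y $ i = (x + int_vec (\<chi> i. n i)) $ i" by (simp add: int_vec_def)
    qed
    then show ?thesis unfolding h_def using per by metis
  qed
  \<comment> \<open>The selection \<open>inv_into\<close> may jump, so continuity of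
    \<open>h\<close> comes from closed sets: their preimages are images of compact sets.\<close>
  have "continuous_on S h"
    unfolding continuous_on_closed_vimage[OF compact_imp_closed[OF S]]
  proof (intro allI impI)
    fix B :: "real set" assume "closed B"
    have "h -` B \<inter> S = torus_embed ` (f -` B \<inter> ?C)" using h unfolding S_def by auto
    moreover have "compact (f -` B \<inter> ?C)"
      using compact_Int_closed[OF compact_cbox continuous_closed_preimage[OF cont closed_cbox \<open>closed B\<close>], of 0 1]
      unfolding Int_left_absorb by (simp add: Int_commute)
    ultimately show "closed (h -` B \<inter> S)"
      using compact_imp_closed[OF compact_continuous_image[OF ce]] by simp
  qed
  from Stone_Weierstrass_real_polynomial_function[OF S this e]
  obtain g where g: "real_polynomial_function g" "\<And>z. z \<in> S \<Longrightarrow> \<bar>h z - g z\<bar> < e" by blast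
  show ?thesis
  proof (intro bexI[of _ "\<lambda>x. g (torus_embed x)"] ballI)
    show "\<bar>f x - g (torus_embed x)\<bar> < e" if "x \<in> ?C" for x
      using g(2)[of "torus_embed x"] h[OF that] that by (simp add: S_def)
  qed (rule torus_test_polynomial[OF g(1)])
qed

section \<open>Periodized functions on the line\<close>

definition ccont :: "(real \<Rightarrow> real) \<Rightarrow> bool" where
  "ccont f \<longleftrightarrow> continuous_on UNIV f \<and> (\<exists>r. \<forall>x. r < \<bar>x\<bar> \<longrightarrow> f x = 0)"

lemma ccont_integrable:
  assumes "ccont f" shows "integrable lborel f"
proof -
  obtain r where r: "\<And>x. r < \<bar>x\<bar> \<Longrightarrow> f x = 0" and c: "continuous_on UNIV f"
    using assms by (auto simp: ccont_def)
  have "integrable lborel (\<lambda>x. indicator {-r..r} x *\<^sub>R f x)"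
    by (rule borel_integrable_compact) (use c continuous_on_subset in auto)
  moreover have "(\<lambda>x. indicator {-r..r} x *\<^sub>R f x) = f"
  proof
    fix x show "indicator {-r..r} x *\<^sub>R f x = f x"
      using r[of x] by (cases "x \<in> {-r..r}") auto
  qed
  ultimately show ?thesis by simp
qed

lemma ccont_continuous: "ccont f \<Longrightarrow> continuous_on S f"
  unfolding ccont_def using continuous_on_subset by blast

lemma ccont_mult_left: "ccont f \<Longrightarrow> continuous_on UNIV h \<Longrightarrow> ccont (\<lambda>x. f x * h x)"
  unfolding ccont_def by (auto intro!: continuous_intros)

lemma ccont_mult_right: "ccont f \<Longrightarrow> continuous_on UNIV h \<Longrightarrow> ccont (\<lambda>x. h x * f x)"
  unfolding ccont_def by (auto intro!: continuous_intros)

lemma ccont_add: assumes "ccont f" "ccont g" shows "ccont (\<lambda>x. f x + g x)"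
proof -
  obtain r1 r2 where "\<And>x. r1 < \<bar>x\<bar> \<Longrightarrow> f x = 0" "\<And>x. r2 < \<bar>x\<bar> \<Longrightarrow> g x = 0"
    using assms by (auto simp: ccont_def)
  then have "\<forall>x. max r1 r2 < \<bar>x\<bar> \<longrightarrow> f x + g x = 0" by auto
  then show ?thesis using assms unfolding ccont_def by (blast intro: continuous_intros)
qed

lemma ccont_const_mult: "ccont f \<Longrightarrow> ccont (\<lambda>x. c * f x)"
  by (rule ccont_mult_right) auto

lemma ccont_diff: "ccont f \<Longrightarrow> ccont g \<Longrightarrow> ccont (\<lambda>x. f x - g x)"
  using ccont_add[of f "\<lambda>x. -1 * g x"] ccont_const_mult[of g "-1"] by simp

lemma ccont_zero: "ccont (\<lambda>x. 0)"
  by (simp add: ccont_def)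

lemma ccont_sum: "(\<And>i. i \<in> I \<Longrightarrow> ccont (f i)) \<Longrightarrow> ccont (\<lambda>x. \<Sum>i\<in>I. f i x)"
  by (induction I rule: infinite_finite_induct) (auto intro: ccont_add ccont_zero)

lemma ccont_abs: "ccont f \<Longrightarrow> ccont (\<lambda>x. \<bar>f x\<bar>)"
  unfolding ccont_def by (auto intro!: continuous_intros)

lemma ccont_power2: "ccont f \<Longrightarrow> ccont (\<lambda>x. (f x)\<^sup>2)"
  unfolding power2_eq_square by (rule ccont_mult_left) (simp_all add: ccont_continuous)

lemma ccont_affine: assumes "ccont f" "a \<noteq> 0" shows "ccont (\<lambda>x. f (a * x - b))"
proof -
  obtain r where r: "\<And>x. r < \<bar>x\<bar> \<Longrightarrow> f x = 0" and c: "continuous_on UNIV f"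
    using assms by (auto simp: ccont_def)
  have "continuous_on UNIV (\<lambda>x. f (a * x - b))"
    by (rule continuous_on_compose2[OF c]) (auto intro!: continuous_intros)
  moreover have "f (a * x - b) = 0" if "(r + \<bar>b\<bar>) / \<bar>a\<bar> < \<bar>x\<bar>" for x
  proof (rule r)
    have "r + \<bar>b\<bar> < \<bar>a * x\<bar>" using that assms(2) by (simp add: divide_less_eq abs_mult mult.commute)
    then show "r < \<bar>a * x - b\<bar>" by linarith
  qed
  ultimately show ?thesis unfolding ccont_def by blast
qed

lemma ccont_shift: "ccont f \<Longrightarrow> ccont (\<lambda>x. f (x - b))"
  using ccont_affine[of f 1 b] by simp

lemmas ccont_intros = ccont_mult_left ccont_mult_right ccont_add ccont_diff ccont_sum
  ccont_abs ccont_power2 ccont_affine ccont_shift ccont_continuous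

lemma infsum_finite_support:
  assumes "finite N" "\<And>n. n \<notin> N \<Longrightarrow> f n = 0"
  shows "infsum f UNIV = sum f N"
  using infsum_cong_neutral[of N UNIV f f] assms by simp

lemma int_near_set:
  fixes x r :: real
  shows "finite {k::int. \<bar>of_int k - x\<bar> \<le> r}"
    and "0 \<le> r \<Longrightarrow> real (card {k::int. \<bar>of_int k - x\<bar> \<le> r}) \<le> 2 * r + 1"
proof -
  have eq: "{k::int. \<bar>of_int k - x\<bar> \<le> r} = {\<lceil>x - r\<rceil>..\<lfloor>x + r\<rfloor>}"
    by (auto simp: ceiling_le_iff le_floor_iff)
  show "finite {k::int. \<bar>of_int k - x\<bar> \<le> r}" unfolding eq by simp
  show "real (card {k::int. \<bar>of_int k - x\<bar> \<le> r}) \<le> 2 * r + 1" if "0 \<le> r"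
  proof -
    have "of_int (\<lfloor>x + r\<rfloor> - \<lceil>x - r\<rceil> + 1) \<le> 2 * r + 1" using that by linarith
    then show ?thesis unfolding eq card_atLeastAtMost_int using that by linarith
  qed
qed

text \<open>Compact support with an explicit radius: the number of overlapping translates is to be
  bounded through \<open>B\<close>, uniformly in scale and position.\<close>

definition bump :: "nat \<Rightarrow> (real \<Rightarrow> real) \<Rightarrow> bool" where
  "bump B \<psi> \<longleftrightarrow> continuous_on UNIV \<psi> \<and> (\<forall>x. real B < \<bar>x\<bar> \<longrightarrow> \<psi> x = 0)"

lemma bump_ccont: "bump B \<psi> \<Longrightarrow> ccont \<psi>"
  unfolding bump_def ccont_def by blast

definition dil :: "(real \<Rightarrow> real) \<Rightarrow> nat \<Rightarrow> int \<Rightarrow> real \<Rightarrow> real" where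
  "dil \<psi> J k t = 2 powr (real J / 2) * \<psi> (2 ^ J * t - of_int k)"

definition per :: "(real \<Rightarrow> real) \<Rightarrow> nat \<Rightarrow> int \<Rightarrow> real \<Rightarrow> real" where
  "per \<psi> J k t = (\<Sum>\<^sub>\<infinity>n\<in>UNIV. dil \<psi> J k (t - of_int n))"

lemma powr_half_sq: "2 powr (real J / 2) * 2 powr (real J / 2) = (2::real) ^ J"
  by (simp add: powr_add[symmetric] powr_realpow)

lemma powr_half_div: "2 powr (real J / 2) / 2 ^ J = (2::real) powr (- real J / 2)"
  by (simp add: powr_realpow[symmetric] powr_diff[symmetric])

lemma dil_ccont: "ccont \<psi> \<Longrightarrow> ccont (dil \<psi> J k)"
  unfolding dil_def[abs_def] by (intro ccont_const_mult ccont_affine) auto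

lemma dil_shift: "dil \<psi> J k (t - of_int n) = dil \<psi> J (k + 2 ^ J * n) t"
  by (simp add: dil_def algebra_simps)

lemma dil_zero: "bump B \<psi> \<Longrightarrow> real B < \<bar>2 ^ J * t - of_int k\<bar> \<Longrightarrow> dil \<psi> J k t = 0"
  by (simp add: bump_def dil_def)

text \<open>A finite set of shifts serving all \<open>t\<close> in [0, 1] at once. The centre is
  minus the position of the dilate, as the dilate is evaluated at \<open>t - of_int n\<close>; the
  additional 1 is the length of the interval.\<close>

definition translates :: "nat \<Rightarrow> nat \<Rightarrow> int \<Rightarrow> int set" where
  "translates B J k = {n. \<bar>of_int n - (- (of_int k / 2 ^ J))\<bar> \<le> real B + 1}"

lemma translates: "finite (translates B J k)" "real (card (translates B J k)) \<le> 2 * B + 3"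
  unfolding translates_def using int_near_set[where x="- (of_int k / 2 ^ J)" and r="real B + 1"] by auto

lemma dil_translates:
  assumes "bump B \<psi>" "0 \<le> t" "t \<le> 1" "n \<notin> translates B J k"
  shows "dil \<psi> J k (t - of_int n) = 0"
proof (rule dil_zero[OF assms(1)])
  have "2 ^ J * (t - of_int n) - of_int k = 2 ^ J * (t - of_int n - of_int k / 2 ^ J)" by (simp add: field_simps)
  moreover have "real B < \<bar>t - of_int n - of_int k / 2 ^ J\<bar>"
    using assms by (auto simp: translates_def)
  moreover have "\<bar>t - of_int n - of_int k / 2 ^ J\<bar> \<le> 2 ^ J * \<bar>t - of_int n - of_int k / 2 ^ J\<bar>"
    by (simp add: mult_le_cancel_right1)
  ultimately show "real B < \<bar>2 ^ J * (t - of_int n) - of_int k\<bar>" by (simp add: abs_mult)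
qed

lemma per_eq:
  assumes "bump B \<psi>" "0 \<le> t" "t \<le> 1"
  shows "per \<psi> J k t = (\<Sum>n\<in>translates B J k. dil \<psi> J k (t - of_int n))"
  unfolding per_def by (rule infsum_finite_support) (use translates dil_translates assms in auto)

lemma per_continuous:
  assumes "bump B \<psi>"
  shows "continuous_on {0..1} (per \<psi> J k)"
proof -
  have "continuous_on {0..1} (\<lambda>t. \<Sum>n\<in>translates B J k. dil \<psi> J k (t - of_int n))"
    by (intro continuous_on_sum ccont_intros dil_ccont bump_ccont[OF assms])
  then show ?thesis by (rule continuous_on_cong[THEN iffD1, rotated 2]) (use per_eq[OF assms] in auto)
qed

lemma per_periodic: "per \<psi> J k (t + of_int n) = per \<psi> J k t"
proof -
  have "per \<psi> J k (t + of_int n) = (\<Sum>\<^sub>\<infinity>m\<in>UNIV. ((\<lambda>l. dil \<psi> J k (t - of_int l)) \<circ> (\<lambda>m. m - n)) m)"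
    unfolding per_def by (simp add: comp_def algebra_simps)
  also have "\<dots> = (\<Sum>\<^sub>\<infinity>l\<in>range (\<lambda>m. m - n). dil \<psi> J k (t - of_int l))"
    by (rule infsum_reindex[symmetric]) (simp add: inj_on_def)
  also have "range (\<lambda>m. m - n) = UNIV" using surj_plus[of "-n"] by (simp add: add.commute)
  finally show ?thesis by (simp add: per_def)
qed

text \<open>A step of \<open>2 ^ J\<close> in the position is a shift by one period, so that the
  circle carries \<open>2 ^ J\<close> positions of scale \<open>J\<close>.\<close>

lemma per_index: "per \<psi> J (k + 2 ^ J * n) t = per \<psi> J k t"
proof -
  have "dil \<psi> J (k + 2 ^ J * n) (t - of_int m) = dil \<psi> J k (t - of_int n - of_int m)" for m
    using dil_shift[of \<psi> J k "t - of_int m" n] by (simp add: algebra_simps)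
  then have "per \<psi> J (k + 2 ^ J * n) t = per \<psi> J k (t - of_int n)" unfolding per_def by simp
  also have "\<dots> = per \<psi> J k t" using per_periodic[of \<psi> J k "t - of_int n" n] by simp
  finally show ?thesis .
qed

text \<open>The half-open unit cells partition the line, and \<open>t\<close> is moved into [0, 1)
  by exactly one shift, \<open>- \<lfloor>t\<rfloor>\<close>. Closing the cell adds a null
  set.\<close>

lemma unfold_integral:
  fixes g :: "real \<Rightarrow> real"
  assumes g: "integrable lborel g" and N: "finite N" "\<And>t. g t \<noteq> 0 \<Longrightarrow> - \<lfloor>t\<rfloor> \<in> N"
  shows "(LINT t|lborel. g t) = (\<Sum>n\<in>N. LINT t:{0..1}|lborel. g (t - of_int n))"
proof -
  have i: "integrable lborel (\<lambda>t. indicator {0..<1} (t + of_int n) * g t)" for n :: int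
    by (rule Bochner_Integration.integrable_bound[OF g]) (use g in \<open>auto simp: indicator_def\<close>)
  have pt: "g t = (\<Sum>n\<in>N. indicator {0..<1} (t + of_int n) * g t)" for t
  proof (cases "g t = 0")
    case False
    have "indicator {0..<1} (t + of_int n) * g t = (if n = - \<lfloor>t\<rfloor> then g t else 0)" for n
    proof -
      have "t + of_int n \<in> {0..<1} \<longleftrightarrow> n = - \<lfloor>t\<rfloor>" by (auto; linarith)
      then show ?thesis by (simp add: indicator_def)
    qed
    then show ?thesis using N False by simp
  qed simp
  have "(LINT t|lborel. g t) = (LINT t|lborel. (\<Sum>n\<in>N. indicator {0..<1} (t + of_int n) * g t))"
    by (rule Bochner_Integration.integral_cong[OF refl pt])
  also have "\<dots> = (\<Sum>n\<in>N. LINT t|lborel. indicator {0..<1} (t + of_int n) * g t)"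
    by (rule Bochner_Integration.integral_sum[OF i])
  also have "\<dots> = (\<Sum>n\<in>N. LINT t:{0..1}|lborel. g (t - of_int n))"
  proof (rule sum.cong[OF refl])
    fix n :: int
    have "(LINT t|lborel. indicator {0..<1} (t + of_int n) * g t) = (LINT t|lborel. indicator {0..<1} t * g (t - of_int n))"
      using lborel_integral_real_affine[of 1 "\<lambda>t. indicator {0..<1} (t + of_int n) * g t" "- of_int n"] by (simp add: algebra_simps)
    also have "\<dots> = (LINT t:{0..1}|lborel. g (t - of_int n))"
      unfolding set_lebesgue_integral_def
    proof (rule integral_cong_AE)
      have [measurable]: "g \<in> borel_measurable borel" using g by (simp add: borel_measurable_integrable)
      show "(\<lambda>t. indicator {0..<1} t * g (t - of_int n)) \<in> borel_measurable lborel" by measurable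
      show "(\<lambda>t. indicator {0..1} t *\<^sub>R g (t - of_int n)) \<in> borel_measurable lborel" by measurable
      show "AE t in lborel. indicator {0..<1} t * g (t - of_int n) = indicator {0..1} t *\<^sub>R g (t - of_int n)"
        using AE_lborel_singleton[of 1] by (rule AE_mp) (auto intro!: AE_I2 simp: indicator_def)
    qed
    finally show "(LINT t|lborel. indicator {0..<1} (t + of_int n) * g t) = (LINT t:{0..1}|lborel. g (t - of_int n))" .
  qed
  finally show ?thesis .
qed

lemma set_integral_sum:
  fixes f :: "'i \<Rightarrow> 'a \<Rightarrow> real"
  assumes "\<And>i. i \<in> I \<Longrightarrow> set_integrable M A (f i)"
  shows "(LINT x:A|M. \<Sum>i\<in>I. f i x) = (\<Sum>i\<in>I. LINT x:A|M. f i x)"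
  using assms unfolding set_lebesgue_integral_def set_integrable_def scaleR_sum_right
  by (rule Bochner_Integration.integral_sum)

lemma integrable_unit:
  fixes f :: "real \<Rightarrow> real"
  shows "continuous_on {0..1} f \<Longrightarrow> set_integrable lborel {0..1} f"
  unfolding set_integrable_def by (rule borel_integrable_compact) auto

lemma dil_translates':
  assumes "bump B \<psi>" "dil \<psi> J k t \<noteq> 0"
  shows "- \<lfloor>t\<rfloor> \<in> translates B J k"
proof (rule ccontr)
  assume "- \<lfloor>t\<rfloor> \<notin> translates B J k"
  moreover have "0 \<le> t - of_int \<lfloor>t\<rfloor>" "t - of_int \<lfloor>t\<rfloor> \<le> 1" by linarith+
  ultimately have "dil \<psi> J k (t - of_int \<lfloor>t\<rfloor> - of_int (- \<lfloor>t\<rfloor>)) = 0"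
    by (intro dil_translates[OF assms(1)])
  then show False using assms(2) by simp
qed

text \<open>A periodic factor is the same on all cells, so the cell integrals of the dilate
  reassemble into its periodization.\<close>

lemma integral_per:
  assumes \<psi>: "bump B \<psi>" and h: "continuous_on UNIV h" "\<And>t n::int. h (t - of_int n) = h t"
  shows "(LINT t:{0..1}|lborel. per \<psi> J k t * h t) = (LINT t|lborel. dil \<psi> J k t * h t)"
proof -
  note cc = dil_ccont[OF bump_ccont[OF \<psi>], of J k]
  have "(LINT t|lborel. dil \<psi> J k t * h t)
      = (\<Sum>n\<in>translates B J k. LINT t:{0..1}|lborel. dil \<psi> J k (t - of_int n) * h (t - of_int n))"
    by (rule unfold_integral) (auto intro!: ccont_integrable ccont_mult_left cc h translates dil_translates'[OF \<psi>])
  also have "\<dots> = (LINT t:{0..1}|lborel. \<Sum>n\<in>translates B J k. dil \<psi> J k (t - of_int n) * h (t - of_int n))"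
    by (rule set_integral_sum[symmetric], intro integrable_unit continuous_on_mult
        ccont_continuous[OF ccont_shift[OF cc]] continuous_on_compose2[OF h(1)]) (auto intro!: continuous_intros)
  also have "\<dots> = (LINT t:{0..1}|lborel. per \<psi> J k t * h t)"
    by (rule set_lebesgue_integral_cong) (auto simp: per_eq[OF \<psi>] h(2) sum_distrib_right)
  finally show ?thesis by simp
qed

lemma integral_dil:
  "(LINT t|lborel. dil \<psi> J k t * h t) = 2 powr (- real J / 2) * (LINT s|lborel. \<psi> s * h ((s + of_int k) / 2 ^ J))"
proof -
  have "(LINT t|lborel. dil \<psi> J k t * h t)
      = \<bar>1 / 2 ^ J\<bar> *\<^sub>R (LINT s|lborel. dil \<psi> J k (of_int k / 2 ^ J + 1 / 2 ^ J * s) * h (of_int k / 2 ^ J + 1 / 2 ^ J * s))"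
    by (rule lborel_integral_real_affine) simp
  also have "(\<lambda>s. dil \<psi> J k (of_int k / 2 ^ J + 1 / 2 ^ J * s) * h (of_int k / 2 ^ J + 1 / 2 ^ J * s))
      = (\<lambda>s. 2 powr (real J / 2) * (\<psi> s * h ((s + of_int k) / 2 ^ J)))"
    by (simp add: dil_def algebra_simps add_divide_distrib)
  finally show ?thesis unfolding powr_half_div[symmetric] by simp
qed

lemma bump_bounded: assumes "bump B \<psi>" shows "\<exists>C\<ge>0. \<forall>x. \<bar>\<psi> x\<bar> \<le> C"
proof -
  have "compact (\<psi> ` {- real B..real B})"
    using assms continuous_on_subset by (intro compact_continuous_image) (auto simp: bump_def)
  then obtain C where C: "\<And>x. x \<in> {- real B..real B} \<Longrightarrow> \<bar>\<psi> x\<bar> \<le> C"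
    using compact_imp_bounded bounded_iff by (metis imageI real_norm_def)
  have "\<bar>\<psi> x\<bar> \<le> max C 0" for x
    using C[of x] assms unfolding bump_def by (cases "x \<in> {- real B..real B}") auto
  then show ?thesis by (intro exI[of _ "max C 0"]) auto
qed

text \<open>At each point boundedly many translates overlap, and periodization does not increase the
  L1 norm. The two powers of 2 are reciprocal, so the product of the bounds is free of the scale;
  this later controls L2 norms.\<close>

lemma per_bounds:
  assumes \<psi>: "bump B \<psi>"
  shows "\<exists>C\<ge>0. \<forall>J k. (\<forall>t\<in>{0..1}. \<bar>per \<psi> J k t\<bar> \<le> C * 2 powr (real J / 2)) \<and>
     (LINT t:{0..1}|lborel. \<bar>per \<psi> J k t\<bar>) \<le> C * 2 powr (- real J / 2)"
proof -
  obtain C0 where C0: "C0 \<ge> 0" "\<And>x. \<bar>\<psi> x\<bar> \<le> C0" using bump_bounded[OF \<psi>] by blast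
  define C1 where "C1 = (LINT t|lborel. \<bar>\<psi> t\<bar>)"
  have C1: "C1 \<ge> 0" unfolding C1_def by (rule integral_nonneg_AE) auto
  have 1: "\<bar>per \<psi> J k t\<bar> \<le> (2 * B + 3) * C0 * 2 powr (real J / 2)" if "t \<in> {0..1}" for J k t
  proof -
    have "\<bar>per \<psi> J k t\<bar> \<le> (\<Sum>n\<in>translates B J k. \<bar>dil \<psi> J k (t - of_int n)\<bar>)"
      using that by (subst per_eq[OF \<psi>]) auto
    also have "\<dots> \<le> (\<Sum>n\<in>translates B J k. C0 * 2 powr (real J / 2))"
      by (rule sum_mono) (simp add: dil_def abs_mult C0 mult.commute)
    also have "\<dots> = real (card (translates B J k)) * (C0 * 2 powr (real J / 2))" by simp
    also have "\<dots> \<le> (2 * B + 3) * (C0 * 2 powr (real J / 2))"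
      using translates(2)[of B J k] C0(1) by (intro mult_right_mono) auto
    finally show ?thesis by (simp add: mult.assoc)
  qed
  have 2: "(LINT t:{0..1}|lborel. \<bar>per \<psi> J k t\<bar>) \<le> C1 * 2 powr (- real J / 2)" for J k
  proof -
    note cc = dil_ccont[OF bump_ccont[OF \<psi>], of J k]
    have i: "set_integrable lborel {0..1} (\<lambda>t. \<bar>dil \<psi> J k (t - of_int n)\<bar>)" for n :: int
      by (intro integrable_unit ccont_intros cc)
    have "(LINT t:{0..1}|lborel. \<bar>per \<psi> J k t\<bar>) \<le> (LINT t:{0..1}|lborel. \<Sum>n\<in>translates B J k. \<bar>dil \<psi> J k (t - of_int n)\<bar>)"
    proof (rule set_integral_mono)
      show "set_integrable lborel {0..1} (\<lambda>t. \<bar>per \<psi> J k t\<bar>)"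
        by (intro integrable_unit continuous_on_rabs per_continuous[OF \<psi>])
      show "set_integrable lborel {0..1} (\<lambda>t. \<Sum>n\<in>translates B J k. \<bar>dil \<psi> J k (t - of_int n)\<bar>)"
        by (intro integrable_unit ccont_intros cc)
    qed (auto simp: per_eq[OF \<psi>])
    also have "\<dots> = (\<Sum>n\<in>translates B J k. LINT t:{0..1}|lborel. \<bar>dil \<psi> J k (t - of_int n)\<bar>)"
      by (rule set_integral_sum) (use translates i in auto)
    also have "\<dots> = (LINT t|lborel. \<bar>dil \<psi> J k t\<bar>)"
      by (rule unfold_integral[symmetric]) (auto intro!: ccont_integrable ccont_abs cc translates dil_translates'[OF \<psi>])
    also have "\<dots> = (LINT t|lborel. dil (\<lambda>x. \<bar>\<psi> x\<bar>) J k t * 1)"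
      by (simp add: dil_def abs_mult)
    also have "\<dots> = C1 * 2 powr (- real J / 2)" by (subst integral_dil) (simp add: C1_def)
    finally show ?thesis .
  qed
  show ?thesis
  proof (intro exI[of _ "(2 * B + 3) * C0 + C1"] conjI allI ballI)
    fix J k t assume "t \<in> {0..1::real}"
    have "(2 * B + 3) * C0 * 2 powr (real J / 2) \<le> ((2 * B + 3) * C0 + C1) * 2 powr (real J / 2)"
      using C1 by (intro mult_right_mono) auto
    then show "\<bar>per \<psi> J k t\<bar> \<le> ((2 * B + 3) * C0 + C1) * 2 powr (real J / 2)" using 1[OF \<open>t \<in> _\<close>, of J k] by linarith
  next
    fix J k
    have "C1 * 2 powr (- real J / 2) \<le> ((2 * B + 3) * C0 + C1) * 2 powr (- real J / 2)"
      using C0 by (intro mult_right_mono) auto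
    then show "(LINT t:{0..1}|lborel. \<bar>per \<psi> J k t\<bar>) \<le> ((2 * B + 3) * C0 + C1) * 2 powr (- real J / 2)" using 2[of J k] by linarith
  qed (use C0 C1 in auto)
qed

text \<open>The family \<open>d\<close> consists of a periodic function and its successive
  derivatives. The moments annihilate its Taylor polynomial at the centre \<open>k / 2 ^ J\<close>;
  in the rescaled variable the remainder contributes \<open>2 powr (- J * u)\<close>, and the
  normalization contributes \<open>2 powr (- J / 2)\<close>.\<close>

lemma per_moment_decay:
  assumes \<psi>: "bump B \<psi>" and u: "0 < u" and mom: "\<And>v. v < u \<Longrightarrow> (LINT x|lborel. x ^ v * \<psi> x) = 0"
  shows "\<exists>C\<ge>0. \<forall>J k d K. (\<forall>v t. v < u \<longrightarrow> (d v has_real_derivative d (Suc v) t) (at t)) \<longrightarrow>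
     (\<forall>t n. d 0 (t - of_int n) = d 0 t) \<longrightarrow> (\<forall>t. \<bar>d u t\<bar> \<le> K) \<longrightarrow>
     \<bar>LINT t:{0..1}|lborel. per \<psi> J k t * d 0 t\<bar> \<le> C * K * 2 powr (- real J * (real u + 1 / 2))"
proof -
  define C where "C = (LINT s|lborel. \<bar>\<psi> s\<bar> * \<bar>s\<bar> ^ u)"
  have C: "C \<ge> 0" unfolding C_def by (rule integral_nonneg_AE) auto
  note cc = bump_ccont[OF \<psi>]
  have "\<bar>LINT t:{0..1}|lborel. per \<psi> J k t * d 0 t\<bar> \<le> C * K * 2 powr (- real J * (real u + 1 / 2))"
    if d: "\<And>v t. v < u \<Longrightarrow> (d v has_real_derivative d (Suc v) t) (at t)"
      and p: "\<And>t n::int. d 0 (t - of_int n) = d 0 t" and K: "\<And>t. \<bar>d u t\<bar> \<le> K" for J k d K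
  proof -
    have c0: "continuous_on UNIV (d 0)"
      using d[OF u] by (meson DERIV_isCont continuous_at_imp_continuous_on)
    have K0: "0 \<le> K" using K[of 0] by linarith
    define c where "c = of_int k / (2 ^ J :: real)"
    define T where "T = (\<lambda>s. \<Sum>v<u. d v c / fact v / (2 ^ J) ^ v * s ^ v)"
    have cT: "continuous_on UNIV T" unfolding T_def by (intro continuous_intros)
    have ch: "continuous_on UNIV (\<lambda>s. d 0 ((s + of_int k) / 2 ^ J))"
      by (rule continuous_on_compose2[OF c0]) (auto intro!: continuous_intros)
    have R: "\<bar>d 0 ((s + of_int k) / 2 ^ J) - T s\<bar> \<le> K * (\<bar>s\<bar> ^ u / (2 ^ J) ^ u)" for s
    proof (cases "s = 0")
      \<comment> \<open>Taylor's formula is available for two distinct points only, so the centre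
        itself is treated separately.\<close>
      case True
      have "T 0 = d 0 c" unfolding T_def using u by (subst sum.remove[of _ 0]) auto
      then show ?thesis using True u K0 by (simp add: c_def)
    next
      case False
      define x where "x = (s + of_int k) / 2 ^ J"
      have xc: "x - c = s / 2 ^ J" unfolding x_def c_def by (simp add: add_divide_distrib)
      then have "x \<noteq> c" using False by auto
      then obtain t where t: "d 0 x = (\<Sum>v<u. d v c / fact v * (x - c) ^ v) + d u t / fact u * (x - c) ^ u"
        using Taylor[OF u, of d "d 0" "min x c" "max x c" c x] d by auto
      have "T s = (\<Sum>v<u. d v c / fact v * (x - c) ^ v)"
        unfolding T_def xc by (simp add: power_divide)
      then have "\<bar>d 0 x - T s\<bar> = \<bar>d u t\<bar> / fact u * (\<bar>s\<bar> ^ u / (2 ^ J) ^ u)"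
        unfolding t xc by (simp add: abs_mult power_abs power_divide)
      also have "\<dots> \<le> K * (\<bar>s\<bar> ^ u / (2 ^ J) ^ u)"
      proof (rule mult_right_mono)
        have "\<bar>d u t\<bar> / fact u \<le> \<bar>d u t\<bar> / 1" by (rule divide_left_mono) auto
        then show "\<bar>d u t\<bar> / fact u \<le> K" using K[of t] by simp
      qed auto
      finally show ?thesis by (simp add: x_def)
    qed
    have i1: "integrable lborel (\<lambda>s. \<psi> s * d 0 ((s + of_int k) / 2 ^ J))"
      and i2: "integrable lborel (\<lambda>s. \<psi> s * T s)"
      by (intro ccont_integrable ccont_mult_left cc ch cT)+
    have "(LINT s|lborel. \<psi> s * T s) = (LINT s|lborel. (\<Sum>v<u. d v c / fact v / (2 ^ J) ^ v * (s ^ v * \<psi> s)))"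
      unfolding T_def by (simp add: sum_distrib_left mult_ac)
    also have "\<dots> = (\<Sum>v<u. LINT s|lborel. d v c / fact v / (2 ^ J) ^ v * (s ^ v * \<psi> s))"
      by (intro Bochner_Integration.integral_sum ccont_integrable ccont_mult_right continuous_intros cc)
    also have "\<dots> = 0" using mom by simp
    finally have "(LINT s|lborel. \<psi> s * T s) = 0" .
    then have "(LINT s|lborel. \<psi> s * d 0 ((s + of_int k) / 2 ^ J)) = (LINT s|lborel. \<psi> s * (d 0 ((s + of_int k) / 2 ^ J) - T s))"
      using i1 i2 by (simp add: right_diff_distrib)
    also have "\<bar>\<dots>\<bar> \<le> (LINT s|lborel. K / (2 ^ J) ^ u * (\<bar>\<psi> s\<bar> * \<bar>s\<bar> ^ u))"
    proof (rule norm_integral_le[where 'b=real, unfolded real_norm_def])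
      show "integrable lborel (\<lambda>s. \<psi> s * (d 0 ((s + of_int k) / 2 ^ J) - T s))"
        using i1 i2 by (simp add: right_diff_distrib)
      show "integrable lborel (\<lambda>s. K / (2 ^ J) ^ u * (\<bar>\<psi> s\<bar> * \<bar>s\<bar> ^ u))"
        by (intro ccont_integrable ccont_const_mult ccont_mult_left ccont_abs cc continuous_intros)
      show "\<bar>\<psi> s * (d 0 ((s + of_int k) / 2 ^ J) - T s)\<bar> \<le> K / (2 ^ J) ^ u * (\<bar>\<psi> s\<bar> * \<bar>s\<bar> ^ u)" for s
        using mult_left_mono[OF R[of s], of "\<bar>\<psi> s\<bar>"] by (simp add: abs_mult mult_ac)
    qed
    also have "\<dots> = K / (2 ^ J) ^ u * C" by (simp add: C_def)
    finally have *: "\<bar>LINT s|lborel. \<psi> s * d 0 ((s + of_int k) / 2 ^ J)\<bar> \<le> K / (2 ^ J) ^ u * C" .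
    have "\<bar>LINT t:{0..1}|lborel. per \<psi> J k t * d 0 t\<bar> = 2 powr (- real J / 2) * \<bar>LINT s|lborel. \<psi> s * d 0 ((s + of_int k) / 2 ^ J)\<bar>"
      by (simp add: integral_per[OF \<psi> c0 p] integral_dil abs_mult)
    also have "\<dots> \<le> 2 powr (- real J / 2) * (K / (2 ^ J) ^ u * C)" by (rule mult_left_mono[OF *]) simp
    also have "\<dots> = C * K * (2 powr (- real J / 2) / 2 powr (real J * real u))"
      by (simp add: powr_realpow[symmetric] powr_powr)
    also have "2 powr (- real J / 2) / 2 powr (real J * real u) = (2::real) powr (- real J * (real u + 1 / 2))"
      unfolding powr_diff[symmetric] by (rule arg_cong[where f="\<lambda>x. 2 powr x"]) (simp add: algebra_simps)
    finally show ?thesis .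
  qed
  then show ?thesis using C by blast
qed

section \<open>The multiresolution kernels\<close>

definition near :: "nat \<Rightarrow> nat \<Rightarrow> real \<Rightarrow> int set" where
  "near B J s = {k. \<bar>of_int k - 2 ^ J * s\<bar> \<le> real B}"

lemma near: "finite (near B J s)" "real (card (near B J s)) \<le> 2 * B + 1"
  unfolding near_def using int_near_set[where x="2 ^ J * s" and r="real B"] by auto

lemma dil_near: "bump B \<psi> \<Longrightarrow> k \<notin> near B J s \<Longrightarrow> dil \<psi> J k s = 0"
  by (rule dil_zero) (auto simp: near_def abs_minus_commute)

text \<open>For orthonormal dilates this is the kernel of the projection onto their span; at a given
  \<open>s\<close>, the positions outside \<open>near B J s\<close> contribute 0 if
  \<open>\<psi>\<close> is supported within radius \<open>B\<close>.\<close>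

definition ker :: "nat \<Rightarrow> (real \<Rightarrow> real) \<Rightarrow> nat \<Rightarrow> real \<Rightarrow> real \<Rightarrow> real" where
  "ker B \<psi> J s t = (\<Sum>k\<in>near B J s. dil \<psi> J k s * dil \<psi> J k t)"

definition ip :: "(real \<Rightarrow> real) \<Rightarrow> (real \<Rightarrow> real) \<Rightarrow> real" where
  "ip f g = (LINT x|lborel. f x * g x)"

lemma ip_commute: "ip f g = ip g f"
  by (simp add: ip_def mult.commute)

lemma ip_sum_left:
  assumes "\<And>i. i \<in> I \<Longrightarrow> ccont (f i)" "ccont g"
  shows "ip (\<lambda>x. \<Sum>i\<in>I. c i * f i x) g = (\<Sum>i\<in>I. c i * ip (f i) g)"
proof -
  have "ip (\<lambda>x. \<Sum>i\<in>I. c i * f i x) g = (LINT x|lborel. (\<Sum>i\<in>I. c i * (f i x * g x)))"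
    by (simp add: ip_def sum_distrib_right mult.assoc)
  also have "\<dots> = (\<Sum>i\<in>I. LINT x|lborel. c i * (f i x * g x))"
    by (intro Bochner_Integration.integral_sum ccont_integrable ccont_const_mult ccont_mult_left
        assms ccont_continuous) auto
  finally show ?thesis by (simp add: ip_def)
qed

lemma ip_sum_right:
  assumes "\<And>i. i \<in> I \<Longrightarrow> ccont (f i)" "ccont g"
  shows "ip g (\<lambda>x. \<Sum>i\<in>I. c i * f i x) = (\<Sum>i\<in>I. c i * ip g (f i))"
  using ip_sum_left[OF assms] by (simp add: ip_commute)

lemma ip_diff_left:
  assumes "ccont f" "ccont h" "ccont g"
  shows "ip (\<lambda>x. f x - h x) g = (ip f g - ip h g)"
  unfolding ip_def left_diff_distrib
  by (intro Bochner_Integration.integral_diff ccont_integrable ccont_mult_left assms ccont_continuous)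

lemma dil_scale: "dil \<psi> (J + i) k s = 2 powr (real J / 2) * dil \<psi> i k (2 ^ J * s)"
  by (simp add: dil_def power_add powr_add[symmetric] add_divide_distrib mult_ac)

text \<open>Normalized dilations and integer translations preserve inner products. Thus
  orthogonality at every scale is read off at scale 0, the only scale at which the line basis
  contains scaling functions.\<close>

lemma ip_dil_scale: "ip (dil \<psi> J k) (dil \<theta> (J + i) l) = ip (dil \<psi> 0 0) (dil \<theta> i (l - 2 ^ i * k))"
proof -
  have "dil \<theta> (J + i) l ((s + of_int k) / 2 ^ J) = 2 powr (real J / 2) * dil \<theta> i (l - 2 ^ i * k) s" for s
    unfolding dil_scale by (simp add: dil_def) (simp add: algebra_simps)
  then have "ip (dil \<psi> J k) (dil \<theta> (J + i) l)
    = 2 powr (- real J / 2) * (LINT s|lborel. \<psi> s * (2 powr (real J / 2) * dil \<theta> i (l - 2 ^ i * k) s))"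
    unfolding ip_def integral_dil by simp
  also have "\<dots> = (2 powr (- real J / 2) * 2 powr (real J / 2)) * (LINT s|lborel. \<psi> s * dil \<theta> i (l - 2 ^ i * k) s)"
    by (simp add: mult.left_commute[of "\<psi> _"])
  also have "2 powr (- real J / 2) * 2 powr (real J / 2) = (1::real)" by (simp add: powr_add[symmetric])
  finally show ?thesis by (simp add: ip_def dil_def[of \<psi>])
qed

lemma ker_scale: "ker B \<psi> (J + i) s t = 2 ^ J * ker B \<psi> i (2 ^ J * s) (2 ^ J * t)"
proof -
  have "near B (J + i) s = near B i (2 ^ J * s)" by (simp add: near_def power_add mult_ac)
  then show ?thesis unfolding ker_def dil_scale sum_distrib_left powr_half_sq[symmetric]
    by (simp add: mult_ac)
qed

lemma ccont_ker: "bump B \<psi> \<Longrightarrow> ccont (ker B \<psi> J s)"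
  unfolding ker_def[abs_def] by (intro ccont_sum ccont_const_mult dil_ccont bump_ccont)

text \<open>A nonempty open set is not negligible; for continuous functions this turns an L2
  identity into a pointwise one.\<close>

lemma ccont_eq_0:
  assumes "ccont D" "(LINT x|lborel. (D x)\<^sup>2) \<le> 0"
  shows "D t = 0"
proof -
  have i: "integrable lborel (\<lambda>x. (D x)\<^sup>2)" by (intro ccont_integrable ccont_power2 assms)
  have "(LINT x|lborel. (D x)\<^sup>2) = 0"
    by (rule antisym[OF assms(2) integral_nonneg_AE]) auto
  then have ae: "AE x in lborel. D x = 0"
    using integral_nonneg_eq_0_iff_AE[OF i] by simp
  have c: "continuous_on UNIV D" by (rule ccont_continuous[OF assms(1)])
  have "open {x. D x \<noteq> 0}" using c by (intro open_Collect_neq) auto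
  moreover have "negligible {x. D x \<noteq> 0}"
  proof -
    obtain N where N: "{x. D x \<noteq> 0} \<subseteq> N" "N \<in> null_sets lborel"
      using ae by (auto elim!: AE_E3 simp: eventually_ae_filter)
    then have "negligible N" by (simp add: negligible_iff_null_sets null_sets_completionI)
    then show ?thesis using N(1) negligible_subset by blast
  qed
  ultimately have "{x. D x \<noteq> 0} = {}" using open_not_negligible by blast
  then show ?thesis by blast
qed

lemma ccont_on_eq_0:
  fixes D :: "real \<Rightarrow> real"
  assumes c: "continuous_on {0..1} D" and z: "(LINT x:{0..1}|lborel. (D x)\<^sup>2) \<le> 0" and t: "t \<in> {0..1}"
  shows "D t = 0"
proof -
  have "set_integrable lborel {0..1} (\<lambda>x. (D x)\<^sup>2)" by (intro integrable_unit continuous_intros c)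
  then have "((\<lambda>x. (D x)\<^sup>2) has_integral (LINT x:{0..1}|lborel. (D x)\<^sup>2)) {0..1}"
    using set_borel_integral_eq_integral[of "{0..1}" "\<lambda>x. (D x)\<^sup>2"] by (simp add: integrable_integral)
  moreover have "0 \<le> (LINT x:{0..1}|lborel. (D x)\<^sup>2)"
    unfolding set_lebesgue_integral_def by (rule integral_nonneg_AE) auto
  ultimately have "((\<lambda>x. (D x)\<^sup>2) has_integral 0) (cbox 0 1)" using z by simp
  then have "(D t)\<^sup>2 = 0"
    by (rule has_integral_0_cbox_imp_0[rotated 2]) (use t c in \<open>auto intro!: continuous_intros\<close>)
  then show ?thesis by simp
qed

locale line_wavelets =
  fixes F M :: "real \<Rightarrow> real" and B :: nat
  assumes F: "bump B F" and M: "bump B M"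
    and scaling: "\<exists>h :: int \<Rightarrow> real. finite {k. h k \<noteq> 0} \<and>
        (\<forall>x. F x = (\<Sum>k | h k \<noteq> 0. h k * sqrt 2 * F (2 * x - of_int k)))"
    and wavelet: "\<exists>g :: int \<Rightarrow> real. finite {k. g k \<noteq> 0} \<and>
        (\<forall>x. M x = (\<Sum>k | g k \<noteq> 0. g k * sqrt 2 * F (2 * x - of_int k)))"
    and onb: "orthonormal_basis_L2 (line_wavelet F M)"
begin

lemma line_wavelet_dil:
  "line_wavelet F M (Inl k) = dil F 0 k" "line_wavelet F M (Inr (j, k)) = dil M j k"
  by (auto simp: dil_def fun_eq_iff)

lemma ccF [intro, simp]: "ccont (dil F J k)" and ccM [intro, simp]: "ccont (dil M J k)"
  using F M by (auto intro: dil_ccont bump_ccont)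

lemma ccont_line_wavelet: "ccont (line_wavelet F M i)"
  by (cases i) (auto simp: line_wavelet_dil simp del: line_wavelet.simps)

lemma ip_basis: "ip (line_wavelet F M i) (line_wavelet F M j) = (if i = j then 1 else 0)"
  using onb unfolding orthonormal_basis_L2_def ip_def by blast

lemma ip_FF: "ip (dil F J k) (dil F J l) = (if k = l then 1 else 0)"
  using ip_dil_scale[of F J k F 0 l] ip_basis[of "Inl 0" "Inl (l - k)"]
  by (simp add: line_wavelet_dil del: line_wavelet.simps)

lemma ip_MM: "ip (dil M J k) (dil M J l) = (if k = l then 1 else 0)"
  using ip_dil_scale[of M J k M 0 l] ip_basis[of "Inr (0, 0)" "Inr (0, l - k)"]
  by (simp add: line_wavelet_dil del: line_wavelet.simps)

lemma ip_FM: "ip (dil F J k) (dil M (J + i) l) = 0"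
  using ip_dil_scale[of F J k M i l] ip_basis[of "Inl 0" "Inr (i, l - 2 ^ i * k)"]
  by (simp add: line_wavelet_dil del: line_wavelet.simps)

lemma ip_M0M: "ip (dil M 0 k) (dil M (Suc i) l) = 0"
  using ip_basis[of "Inr (0, k)" "Inr (Suc i, l)"]
  by (simp add: line_wavelet_dil del: line_wavelet.simps)

lemma refine:
  assumes "\<And>x. \<psi> x = (\<Sum>k | h k \<noteq> 0. h k * sqrt 2 * F (2 * x - of_int k))"
  shows "dil \<psi> J l t = (\<Sum>k | h k \<noteq> 0. h k * dil F (Suc J) (2 * l + k) t)"
proof -
  have s: "2 powr (real J / 2) * sqrt 2 = 2 powr (real (Suc J) / 2)"
    by (simp add: powr_half_sqrt[symmetric] powr_add[symmetric] add_divide_distrib add.commute)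
  have "dil \<psi> J l t = (\<Sum>k | h k \<noteq> 0. (2 powr (real J / 2) * sqrt 2) * (h k * F (2 * (2 ^ J * t - of_int l) - of_int k)))"
    unfolding dil_def by (subst assms) (simp add: sum_distrib_left mult_ac)
  also have "\<dots> = (\<Sum>k | h k \<noteq> 0. h k * dil F (Suc J) (2 * l + k) t)"
    unfolding s dil_def by (simp add: mult_ac algebra_simps)
  finally show ?thesis .
qed

lemma ip_ker:
  assumes "bump B \<psi>" "ccont e"
  shows "ip (ker B \<psi> J s) e = (\<Sum>k\<in>near B J s. dil \<psi> J k s * ip (dil \<psi> J k) e)"
  unfolding ker_def[abs_def] by (rule ip_sum_left) (use assms dil_ccont bump_ccont in auto)

lemma ip_ker_reproduce:
  assumes \<psi>: "bump B \<psi>" and o: "\<And>k l. ip (dil \<psi> J k) (dil \<psi> J l) = (if k = l then 1 else 0)"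
  shows "ip (ker B \<psi> J s) (dil \<psi> J l) = dil \<psi> J l s"
  by (subst ip_ker[OF \<psi> dil_ccont[OF bump_ccont[OF \<psi>]]])
    (use near[of B J s] dil_near[OF \<psi>, of l J s] in \<open>auto simp: o if_distrib cong: if_cong\<close>)

text \<open>By its two-scale equation \<open>dil \<psi> J l\<close> is a finite combination of
  scaling functions of scale \<open>Suc J\<close>, each of which the kernel reproduces.\<close>

lemma ip_ker_refined:
  assumes "\<And>x. \<psi> x = (\<Sum>k | h k \<noteq> 0. h k * sqrt 2 * F (2 * x - of_int k))"
  shows "ip (ker B F (Suc J) s) (dil \<psi> J l) = dil \<psi> J l s"
proof -
  have "dil \<psi> J l = (\<lambda>t. \<Sum>k | h k \<noteq> 0. h k * dil F (Suc J) (2 * l + k) t)"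
    using refine[OF assms] by auto
  then have "ip (ker B F (Suc J) s) (dil \<psi> J l) = (\<Sum>k | h k \<noteq> 0. h k * ip (ker B F (Suc J) s) (dil F (Suc J) (2 * l + k)))"
    by (simp add: ip_sum_right ccont_ker[OF F])
  then show ?thesis using refine[OF assms] by (simp add: ip_ker_reproduce[OF F ip_FF])
qed

text \<open>A combination \<open>f\<close> of basis functions is orthogonal to \<open>D\<close>, so
  by Pythagoras the norm of \<open>D\<close> is at most that of \<open>D - f\<close>, which
  completeness makes arbitrarily small.\<close>

lemma orthogonal_all_imp_0:
  assumes D: "ccont D" and o: "\<And>i. ip D (line_wavelet F M i) = 0"
  shows "D t = 0"
proof (rule ccont_eq_0[OF D])
  show "(LINT x|lborel. (D x)\<^sup>2) \<le> 0"
  proof (rule field_le_epsilon)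
    fix \<epsilon> :: real assume "0 < \<epsilon>"
    have "D \<in> borel_measurable lborel" "integrable lborel (\<lambda>x. (D x)\<^sup>2)"
      using ccont_integrable[OF D] ccont_integrable[OF ccont_power2[OF D]] by auto
    then obtain I c where "finite I" and less: "(LINT x|lborel. (D x - (\<Sum>i\<in>I. c i * line_wavelet F M i x))\<^sup>2) < \<epsilon>"
      using onb \<open>0 < \<epsilon>\<close> unfolding orthonormal_basis_L2_def by blast
    define f where "f = (\<lambda>x. \<Sum>i\<in>I. c i * line_wavelet F M i x)"
    have f: "ccont f" unfolding f_def by (intro ccont_sum ccont_const_mult ccont_line_wavelet)
    have "ip D f = 0" unfolding f_def by (subst ip_sum_right) (auto simp: ccont_line_wavelet D o)
    have "(LINT x|lborel. (D x - f x)\<^sup>2) = (LINT x|lborel. (D x)\<^sup>2 - 2 * (D x * f x) + (f x)\<^sup>2)"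
      by (simp add: power2_diff algebra_simps)
    also have "\<dots> = (LINT x|lborel. (D x)\<^sup>2) - 2 * ip D f + (LINT x|lborel. (f x)\<^sup>2)"
      unfolding ip_def by (simp add: ccont_integrable ccont_power2 ccont_mult_left ccont_continuous D f)
    also have "\<dots> \<ge> (LINT x|lborel. (D x)\<^sup>2)"
    proof -
      have "0 \<le> (LINT x|lborel. (f x)\<^sup>2)" by (rule integral_nonneg_AE) auto
      then show ?thesis using \<open>ip D f = 0\<close> by simp
    qed
    finally show "(LINT x|lborel. (D x)\<^sup>2) \<le> 0 + \<epsilon>" using less by (simp add: f_def)
  qed
qed

text \<open>As functions of \<open>t\<close>, both sides have the same inner products with the basis: the dilated
  scaling functions reproduce scaling functions and wavelets by the scaling and wavelet equations,
  and are orthogonal to the wavelets of higher scale.\<close>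

lemma ker_step_0: "ker B F 1 s t = ker B F 0 s t + ker B M 0 s t"
proof -
  obtain h where h: "\<And>x. F x = (\<Sum>k | h k \<noteq> 0. h k * sqrt 2 * F (2 * x - of_int k))" using scaling by blast
  obtain g where g: "\<And>x. M x = (\<Sum>k | g k \<noteq> 0. g k * sqrt 2 * F (2 * x - of_int k))" using wavelet by blast
  define D where "D = (\<lambda>t. ker B F 1 s t - ker B F 0 s t - ker B M 0 s t)"
  have cc: "ccont (ker B F 1 s)" "ccont (ker B F 0 s)" "ccont (ker B M 0 s)" by (simp_all add: ccont_ker F M)
  have D: "ccont D" unfolding D_def by (intro ccont_diff cc)
  have ipD: "ip D e = ip (ker B F 1 s) e - ip (ker B F 0 s) e - ip (ker B M 0 s) e" if "ccont e" for e
    unfolding D_def by (simp only: ip_diff_left ccont_diff cc that)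
  have zFM: "ip (ker B F J s) (dil M (J + i) l) = 0" for J i l
    by (simp add: ip_ker[OF F] ip_FM)
  have zMF: "ip (ker B M 0 s) (dil F 0 l) = 0" for l
    using ip_FM[of 0 l 0] by (simp add: ip_ker[OF M] ip_commute[of "dil M 0 _"])
  have zMM: "ip (ker B M 0 s) (dil M (Suc i) l) = 0" for i l
    by (simp add: ip_ker[OF M] ip_M0M)
  have "ip D (line_wavelet F M i) = 0" for i
  proof (cases i)
    case (Inl l)
    then show ?thesis
      using ip_ker_refined[OF h, of 0 s l] ip_ker_reproduce[OF F ip_FF, of 0 s l] zMF[of l]
      by (simp add: line_wavelet_dil ipD del: line_wavelet.simps)
  next
    case (Inr jl)
    then obtain j l where i: "i = Inr (j, l)" by (cases jl) auto
    show ?thesis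
    proof (cases j)
      case 0
      then show ?thesis
        using i ip_ker_refined[OF g, of 0 s l] ip_ker_reproduce[OF M ip_MM, of 0 s l] zFM[of 0 0 l]
        by (simp add: line_wavelet_dil ipD del: line_wavelet.simps)
    next
      case (Suc j')
      then show ?thesis
        using i zFM[of 1 j' l] zFM[of 0 j l] zMM[of j' l]
        by (simp add: line_wavelet_dil ipD del: line_wavelet.simps)
    qed
  qed
  then have "D t = 0" by (rule orthogonal_all_imp_0[OF D])
  then show ?thesis by (simp add: D_def)
qed

text \<open>Dilation by \<open>2 ^ J\<close> transports the identity from scale 0.\<close>

lemma ker_step: "ker B F (Suc J) s t = ker B F J s t + ker B M J s t"
  using ker_scale[of B F J 1 s t] ker_scale[of B F J 0 s t] ker_scale[of B M J 0 s t]
    ker_step_0[of "2 ^ J * s" "2 ^ J * t"]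
  by (simp add: distrib_left)

end

section \<open>The integral of the scaling function and the partition of unity\<close>

context line_wavelets begin

text \<open>The algebraic span of the scaling functions of scale \<open>J\<close>, that is, the
  multiresolution space before closure. The scaling equation makes these spaces increase with
  \<open>J\<close>.\<close>

definition level :: "nat \<Rightarrow> (real \<Rightarrow> real) set" where
  "level J = {\<lambda>t. \<Sum>k\<in>Q. b k * dil F J k t | Q b. finite Q}"

lemma levelI: "finite Q \<Longrightarrow> (\<lambda>t. \<Sum>k\<in>Q. b k * dil F J k t) \<in> level J"
  unfolding level_def by blast

lemma level_dil: "dil F J k \<in> level J"
  using levelI[of "{k}" "\<lambda>_. 1" J] by simp

lemma level_scale: assumes "f \<in> level J" shows "(\<lambda>t. c * f t) \<in> level J"
proof -
  obtain Q b where "finite Q" "f = (\<lambda>t. \<Sum>k\<in>Q. b k * dil F J k t)" using assms by (auto simp: level_def)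
  then show ?thesis using levelI[of Q "\<lambda>k. c * b k" J] by (simp add: sum_distrib_left mult.assoc)
qed

lemma level_add: assumes "f \<in> level J" "g \<in> level J" shows "(\<lambda>t. f t + g t) \<in> level J"
proof -
  obtain Q b where Q: "finite Q" "f = (\<lambda>t. \<Sum>k\<in>Q. b k * dil F J k t)" using assms by (auto simp: level_def)
  obtain R c where R: "finite R" "g = (\<lambda>t. \<Sum>k\<in>R. c k * dil F J k t)" using assms by (auto simp: level_def)
  have "f t = (\<Sum>k\<in>Q \<union> R. (if k \<in> Q then b k else 0) * dil F J k t)" for t
    unfolding Q(2) using Q R by (intro sum.mono_neutral_cong_left) auto
  moreover have "g t = (\<Sum>k\<in>Q \<union> R. (if k \<in> R then c k else 0) * dil F J k t)" for t
    unfolding R(2) using Q R by (intro sum.mono_neutral_cong_left) auto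
  ultimately have "(\<lambda>t. f t + g t) = (\<lambda>t. \<Sum>k\<in>Q \<union> R. ((if k \<in> Q then b k else 0) + (if k \<in> R then c k else 0)) * dil F J k t)"
    by (simp add: sum.distrib distrib_right)
  then show ?thesis using levelI[of "Q \<union> R"] Q R by simp
qed

lemma level_sum: "finite I \<Longrightarrow> (\<And>i. i \<in> I \<Longrightarrow> f i \<in> level J) \<Longrightarrow> (\<lambda>t. \<Sum>i\<in>I. c i * f i t) \<in> level J"
proof (induction I rule: finite_induct)
  case empty
  then show ?case using levelI[of "{}"] by simp
qed (auto intro!: level_add level_scale)

lemma level_refine:
  assumes "\<exists>h :: int \<Rightarrow> real. finite {k. h k \<noteq> 0} \<and>
        (\<forall>x. \<psi> x = (\<Sum>k | h k \<noteq> 0. h k * sqrt 2 * F (2 * x - of_int k)))"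
  shows "dil \<psi> J l \<in> level (Suc J)"
proof -
  obtain h where h: "finite {k. h k \<noteq> 0}" "\<And>x. \<psi> x = (\<Sum>k | h k \<noteq> 0. h k * sqrt 2 * F (2 * x - of_int k))"
    using assms by blast
  have "dil \<psi> J l = (\<lambda>t. \<Sum>k | h k \<noteq> 0. h k * dil F (Suc J) (2 * l + k) t)"
    using refine[OF h(2)] by auto
  then show ?thesis using level_sum[OF h(1), of "\<lambda>k. dil F (Suc J) (2 * l + k)"] level_dil by simp
qed

lemma level_mono: assumes "J \<le> J'" "f \<in> level J" shows "f \<in> level J'"
  using assms
proof (induction J' rule: dec_induct)
  case (step n)
  then obtain Q b where "finite Q" "f = (\<lambda>t. \<Sum>k\<in>Q. b k * dil F n k t)" by (auto simp: level_def)
  then show ?case using level_sum[of Q "dil F n" "Suc n" b] level_refine[OF scaling] by simp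
qed

lemma line_wavelet_level: "\<exists>J. line_wavelet F M i \<in> level J"
proof (cases i)
  case (Inl k)
  then show ?thesis using level_dil line_wavelet_dil(1) by metis
next
  case (Inr jk)
  then show ?thesis using level_refine[OF wavelet] line_wavelet_dil(2) by (metis surj_pair)
qed

definition mass :: real where "mass = (LINT x|lborel. F x)"

lemma unit_integrable: "ccont f \<Longrightarrow> integrable lborel (\<lambda>x. indicator {0..1} x * f x)"
  using integrable_unit[of f] ccont_continuous[of f] by (simp add: set_integrable_def)

text \<open>Completing the square around the coefficients of the indicator: by orthonormality no
  choice of \<open>b\<close> beats the projection. The leading 1 is the squared norm of the
  indicator.\<close>

lemma distance_to_level:
  assumes "finite Q"
  shows "1 - (\<Sum>k\<in>Q. (ip (indicator {0..1}) (dil F J k))\<^sup>2)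
     \<le> (LINT x|lborel. (indicator {0..1} x - (\<Sum>k\<in>Q. b k * dil F J k x))\<^sup>2)"
proof -
  define f where "f = (\<lambda>x. \<Sum>k\<in>Q. b k * dil F J k x)"
  have f: "ccont f" unfolding f_def by (intro ccont_sum ccont_const_mult ccF)
  let ?\<gamma> = "\<lambda>k. ip (indicator {0..1}) (dil F J k)"
  have i1: "integrable lborel (indicator {0..1} :: real \<Rightarrow> real)" by simp
  have i2: "integrable lborel (\<lambda>x. indicator {0..1} x * f x)" by (rule unit_integrable[OF f])
  have i3: "integrable lborel (\<lambda>x. (f x)\<^sup>2)" by (intro ccont_integrable ccont_power2 f)
  have "(LINT x|lborel. (indicator {0..1} x - f x)\<^sup>2)
     = (LINT x|lborel. indicator {0..1} x - 2 * (indicator {0..1} x * f x) + (f x)\<^sup>2)"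
    by (intro Bochner_Integration.integral_cong refl) (auto simp: power2_diff indicator_def)
  also have "\<dots> = 1 - 2 * ip (indicator {0..1}) f + ip f f"
    using i1 i2 i3 by (simp add: ip_def power2_eq_square)
  also have "ip (indicator {0..1}) f = (\<Sum>k\<in>Q. b k * ?\<gamma> k)"
  proof -
    have "ip (indicator {0..1}) f = (LINT x|lborel. (\<Sum>k\<in>Q. b k * (indicator {0..1} x * dil F J k x)))"
      unfolding ip_def f_def sum_distrib_left by (simp add: mult.left_commute)
    also have "\<dots> = (\<Sum>k\<in>Q. LINT x|lborel. b k * (indicator {0..1} x * dil F J k x))"
      by (intro Bochner_Integration.integral_sum integrable_mult_right unit_integrable ccF)
    finally show ?thesis by (simp add: ip_def)
  qed
  also have "ip f f = (\<Sum>k\<in>Q. (b k)\<^sup>2)"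
  proof -
    have "ip (dil F J k) f = b k" if "k \<in> Q" for k
      unfolding f_def using assms that
      by (subst ip_sum_right) (auto simp: ip_FF if_distrib cong: if_cong)
    then have "(\<Sum>k\<in>Q. b k * ip (dil F J k) f) = (\<Sum>k\<in>Q. (b k)\<^sup>2)" by (simp add: power2_eq_square)
    moreover have "ip f f = (\<Sum>k\<in>Q. b k * ip (dil F J k) f)"
      using ip_sum_left[of Q "dil F J" f b] f unfolding f_def by auto
    ultimately show ?thesis by simp
  qed
  also have "1 - 2 * (\<Sum>k\<in>Q. b k * ?\<gamma> k) + (\<Sum>k\<in>Q. (b k)\<^sup>2) = 1 - (\<Sum>k\<in>Q. (?\<gamma> k)\<^sup>2) + (\<Sum>k\<in>Q. (b k - ?\<gamma> k)\<^sup>2)"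
    by (simp add: power2_diff sum.distrib sum_subtractf sum_distrib_left mult_ac)
  also have "\<dots> \<ge> 1 - (\<Sum>k\<in>Q. (?\<gamma> k)\<^sup>2)" by (simp add: sum_nonneg)
  finally show ?thesis by (simp add: f_def)
qed

text \<open>Up to a bounded number of exceptions, the coefficients at scale \<open>J\<close> of the indicator of the
  unit interval are \<open>2 powr (- J / 2) * mass\<close> or \<open>0\<close>.\<close>

lemma unit_coeffs:
  shows "\<exists>C. \<forall>J Q. finite Q \<longrightarrow> (\<Sum>k\<in>Q. (ip (indicator {0..1}) (dil F J k))\<^sup>2) \<le> mass\<^sup>2 + C / 2 ^ J"
proof -
  define C1 where "C1 = (LINT x|lborel. \<bar>F x\<bar>)"
  define \<gamma> where "\<gamma> = (\<lambda>J k. ip (indicator {0..1}) (dil F J k))"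
  have cc: "ccont F" by (rule bump_ccont[OF F])
  have eq: "\<gamma> J k = 2 powr (- real J / 2) * (LINT s|lborel. F s * indicator {0..1} ((s + of_int k) / 2 ^ J))" for J k
    unfolding \<gamma>_def ip_commute[of "indicator _"] unfolding ip_def by (rule integral_dil)
  have sq: "(2 powr (- real J / 2))\<^sup>2 = 1 / (2::real) ^ J" for J
  proof -
    have "(2 powr (- real J / 2))\<^sup>2 = (2::real) powr (- real J)"
      by (simp add: power2_eq_square flip: powr_add)
    also have "\<dots> = 1 / 2 ^ J" using powr_realpow[of 2 J] powr_minus_divide[of 2 "real J"] by simp
    finally show ?thesis .
  qed
  have g1: "(\<gamma> J k)\<^sup>2 \<le> C1\<^sup>2 / 2 ^ J" for J k
  proof -
    have "\<bar>LINT s|lborel. F s * indicator {0..1} ((s + of_int k) / 2 ^ J)\<bar> \<le> C1"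
      unfolding C1_def
    proof (rule norm_integral_le[where 'b=real, unfolded real_norm_def])
      show "integrable lborel (\<lambda>s. F s * indicator {0..1} ((s + of_int k) / 2 ^ J))"
        by (rule Bochner_Integration.integrable_bound[OF ccont_integrable[OF cc]])
          (use ccont_integrable[OF cc] in \<open>auto simp: indicator_def\<close>)
    qed (auto intro!: ccont_integrable ccont_abs cc simp: indicator_def)
    then have "\<bar>\<gamma> J k\<bar> \<le> 2 powr (- real J / 2) * C1" unfolding eq abs_mult by (simp add: mult_left_mono)
    then have "(\<gamma> J k)\<^sup>2 \<le> (2 powr (- real J / 2) * C1)\<^sup>2" by (rule abs_le_square_iff[THEN iffD1, OF order_trans[OF _ abs_ge_self]])
    then show ?thesis unfolding power_mult_distrib sq by simp
  qed
  have g2: "(\<gamma> J k)\<^sup>2 = mass\<^sup>2 / 2 ^ J" if "int B \<le> k" "k \<le> 2 ^ J - int B" for J k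
  proof -
    have "F s * indicator {0..1} ((s + of_int k) / 2 ^ J) = F s" for s
    proof (cases "\<bar>s\<bar> \<le> real B")
      case True
      have "of_int (int B) \<le> (of_int k :: real)" "(of_int k :: real) \<le> of_int (2 ^ J - int B)"
        using that of_int_le_iff by blast+
      then have "(s + of_int k) / 2 ^ J \<in> {0..1}" using True by (simp add: divide_le_eq)
      then show ?thesis by simp
    qed (use F in \<open>auto simp: bump_def\<close>)
    then have "\<gamma> J k = 2 powr (- real J / 2) * mass" unfolding eq mass_def by (simp only:)
    then show ?thesis by (simp only: power_mult_distrib sq) simp
  qed
  have g3: "\<gamma> J k = 0" if "k < - int B \<or> 2 ^ J + int B < k" for J k
  proof -
    have "F s * indicator {0..1} ((s + of_int k) / 2 ^ J) = 0" for s
    proof (cases "\<bar>s\<bar> \<le> real B")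
      case True
      have "(of_int k :: real) < of_int (- int B) \<or> of_int (2 ^ J + int B) < (of_int k :: real)"
        using that of_int_less_iff by blast
      then have "s + of_int k < 0 \<or> 2 ^ J < s + of_int k" using True by auto
      then have "(s + of_int k) / 2 ^ J < 0 \<or> 1 < (s + of_int k) / 2 ^ J"
        by (auto simp: divide_neg_pos less_divide_eq)
      then have "(s + of_int k) / 2 ^ J \<notin> {0..1}" by auto
      then show ?thesis by simp
    qed (use F in \<open>auto simp: bump_def\<close>)
    then show ?thesis unfolding eq by (simp only: integral_zero mult_zero_right)
  qed
  have "(\<Sum>k\<in>Q. (\<gamma> J k)\<^sup>2) \<le> mass\<^sup>2 + ((2 * B + 1) * mass\<^sup>2 + (4 * B + 2) * C1\<^sup>2) / 2 ^ J" if "finite Q" for J Q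
  proof -
    let ?R = "{- int B..2 ^ J + int B}"
    \<comment> \<open>The positions near the endpoints, where the support of the scaling function
      may be cut by the interval; there are at most 4B of them at any scale.\<close>
    define E where "E = {- int B..<int B} \<union> {2 ^ J - int B<..2 ^ J + int B}"
    have "(\<Sum>k\<in>Q. (\<gamma> J k)\<^sup>2) = (\<Sum>k\<in>Q \<inter> ?R. (\<gamma> J k)\<^sup>2)"
      using that g3 by (intro sum.mono_neutral_right) force+
    also have "\<dots> \<le> (\<Sum>k\<in>?R. (\<gamma> J k)\<^sup>2)" by (intro sum_mono2) auto
    also have "\<dots> \<le> (\<Sum>k\<in>?R. mass\<^sup>2 / 2 ^ J + (if k \<in> E then C1\<^sup>2 / 2 ^ J else 0))"
    proof (rule sum_mono)
      fix k assume "k \<in> ?R"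
      then show "(\<gamma> J k)\<^sup>2 \<le> mass\<^sup>2 / 2 ^ J + (if k \<in> E then C1\<^sup>2 / 2 ^ J else 0)"
        using g1[of J k] g2[of k J] by (cases "k \<in> E") (auto simp: E_def not_le not_less add_increasing)
    qed
    also have "\<dots> = real (card ?R) * (mass\<^sup>2 / 2 ^ J) + real (card (?R \<inter> E)) * (C1\<^sup>2 / 2 ^ J)"
      by (simp add: sum.distrib sum.inter_restrict[symmetric])
    also have "\<dots> \<le> real (card ?R) * (mass\<^sup>2 / 2 ^ J) + (4 * B + 2) * (C1\<^sup>2 / 2 ^ J)"
    proof -
      have "card (?R \<inter> E) \<le> card E" by (rule card_mono) (auto simp: E_def)
      also have "\<dots> \<le> card {- int B..<int B} + card {2 ^ J - int B<..2 ^ J + int B}" unfolding E_def by (rule card_Un_le)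
      also have "\<dots> = 4 * B" by simp
      finally have "real (card (?R \<inter> E)) \<le> 4 * B + 2" by linarith
      then show ?thesis by (intro add_left_mono mult_right_mono) auto
    qed
    finally have le: "(\<Sum>k\<in>Q. (\<gamma> J k)\<^sup>2) \<le> real (card ?R) * (mass\<^sup>2 / 2 ^ J) + (4 * B + 2) * (C1\<^sup>2 / 2 ^ J)" .
    have card: "real (card ?R) = 2 ^ J + real (2 * B + 1)" by (simp add: nat_add_distrib nat_power_eq)
    have eq: "(2 ^ J + real (2 * B + 1)) * (mass\<^sup>2 / 2 ^ J) + real (4 * B + 2) * (C1\<^sup>2 / 2 ^ J)
        = mass\<^sup>2 + ((2 * B + 1) * mass\<^sup>2 + (4 * B + 2) * C1\<^sup>2) / 2 ^ J"
      by (simp add: field_simps)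
    show ?thesis using le unfolding card eq .
  qed
  then show ?thesis unfolding \<gamma>_def by blast
qed

text \<open>Any finite combination of basis functions lies in \<open>level J\<close> for all large
  \<open>J\<close>, and the squared distance of the indicator to that space is at least 1 - mass^2 -
  O(2^-J). Completeness makes the distance arbitrarily small.\<close>

lemma mass_ge_1: "1 \<le> mass\<^sup>2"
proof -
  obtain C where C: "\<And>J Q. finite Q \<Longrightarrow> (\<Sum>k\<in>Q. (ip (indicator {0..1}) (dil F J k))\<^sup>2) \<le> mass\<^sup>2 + C / 2 ^ J"
    using unit_coeffs by blast
  show ?thesis
  proof (rule field_le_epsilon)
    fix \<epsilon> :: real assume \<epsilon>: "0 < \<epsilon>"
    have "(\<lambda>x::real. indicator {0..1} x :: real) \<in> borel_measurable lborel" "integrable lborel (\<lambda>x::real. (indicator {0..1} x :: real)\<^sup>2)"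
      by (simp_all add: power2_eq_square flip: indicator_inter_arith)
    then obtain I c where I: "finite I" and less: "(LINT x|lborel. (indicator {0..1} x - (\<Sum>i\<in>I. c i * line_wavelet F M i x))\<^sup>2) < \<epsilon>"
      using onb \<epsilon> unfolding orthonormal_basis_L2_def by blast
    obtain lev where lev: "\<And>i. line_wavelet F M i \<in> level (lev i)" using line_wavelet_level by metis
    \<comment> \<open>A sum of levels dominates each of them, so all basis functions involved lie in
      \<open>level J\<close> from \<open>J0\<close> on.\<close>
    define J0 where "J0 = (\<Sum>i\<in>I. lev i)"
    have bound: "1 - \<epsilon> \<le> mass\<^sup>2 + C / 2 ^ J" if "J \<ge> J0" for J
    proof -
      have "line_wavelet F M i \<in> level J" if "i \<in> I" for i
        using level_mono[OF _ lev] member_le_sum[of i I lev] that I \<open>J \<ge> J0\<close> unfolding J0_def by auto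
      then have "(\<lambda>x. \<Sum>i\<in>I. c i * line_wavelet F M i x) \<in> level J" by (rule level_sum[OF I])
      then obtain Q b where "finite Q" "(\<lambda>x. \<Sum>i\<in>I. c i * line_wavelet F M i x) = (\<lambda>t. \<Sum>k\<in>Q. b k * dil F J k t)"
        by (auto simp: level_def)
      then show ?thesis using distance_to_level[of Q J b] C[of Q J] less by (simp add: fun_eq_iff)
    qed
    have "(\<lambda>J. mass\<^sup>2 + C / 2 ^ J) \<longlonglongrightarrow> mass\<^sup>2 + 0"
      by (intro tendsto_intros LIMSEQ_divide_realpow_zero) simp
    then have "1 - \<epsilon> \<le> mass\<^sup>2 + 0"
      by (rule LIMSEQ_le_const) (use bound in blast)
    then show "1 \<le> mass\<^sup>2 + \<epsilon>" by simp
  qed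
qed

text \<open>Through this identity the partition of unity at scale 0 becomes one at every
  scale.\<close>

lemma per_dil_sum: "per F 0 0 (2 ^ J * t) = 2 powr (- real J / 2) * (\<Sum>k\<in>near B J t. dil F J k t)"
proof -
  have "per F 0 0 (2 ^ J * t) = (\<Sum>k\<in>near B J t. F (2 ^ J * t - of_int k))"
    unfolding per_def using near(1)[of B J t] F
    by (subst infsum_finite_support[where N="near B J t"]) (auto simp: dil_def near_def bump_def abs_minus_commute)
  moreover have "2 powr (- real J / 2) * 2 powr (real J / 2) = (1::real)" by (simp flip: powr_add)
  ultimately show ?thesis by (simp add: dil_def sum_distrib_left mult.assoc[symmetric])
qed

lemma per_F_continuous: "continuous_on UNIV (per F 0 0)"
proof -
  have "isCont (per F 0 0) x" for x
  proof -
    define N where "N = {n::int. \<bar>of_int n - x\<bar> \<le> real B + 1}"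
    have N: "finite N" unfolding N_def by (rule int_near_set)
    have "per F 0 0 y = (\<Sum>n\<in>N. dil F 0 0 (y - of_int n))" if "\<bar>y - x\<bar> < 1" for y
      unfolding per_def
    proof (rule infsum_finite_support[OF N])
      fix n assume "n \<notin> N"
      then have "real B < \<bar>y - of_int n\<bar>" using that unfolding N_def by auto
      then show "dil F 0 0 (y - of_int n) = 0" using F by (simp add: dil_def bump_def)
    qed
    then have ev: "\<forall>\<^sub>F y in nhds x. per F 0 0 y = (\<Sum>n\<in>N. dil F 0 0 (y - of_int n))"
      by (intro eventually_nhds_metric[THEN iffD2] exI[of _ 1]) (auto simp: dist_real_def)
    have "continuous_on UNIV (\<lambda>y. \<Sum>n\<in>N. dil F 0 0 (y - of_int n))"
      by (intro ccont_continuous ccont_sum ccont_shift ccF)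
    then have "isCont (\<lambda>y. \<Sum>n\<in>N. dil F 0 0 (y - of_int n)) x"
      by (simp add: continuous_on_eq_continuous_at)
    then show ?thesis using isCont_cong[OF ev] by simp
  qed
  then show ?thesis by (simp add: continuous_at_imp_continuous_on)
qed

text \<open>The periodized scaling function \<open>p\<close> has mean \<open>mass\<close> and \<open>\<integral> p\<^sup>2 = 1\<close> over a period, by
  orthonormality. Hence \<open>\<integral> (p - mass)\<^sup>2 = 1 - mass\<^sup>2 \<le> 0\<close>.\<close>

lemma mass_per: "mass * per F 0 0 t = 1"
proof -
  let ?p = "per F 0 0"
  have per: "?p (t - of_int n) = ?p t" for t and n :: int
    using per_periodic[of F 0 0 t "-n"] by simp
  have m: "(LINT t:{0..1}|lborel. ?p t) = mass"
    using integral_per[OF F, of "\<lambda>_. 1" 0 0] by (simp add: dil_def mass_def)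
  \<comment> \<open>If \<open>t\<close> and \<open>t - of_int n\<close> both lie in the support,
    then \<open>\<bar>n\<bar>\<close> is at most 2B; multiplication by \<open>dil F 0 0 t\<close>
    therefore makes the periodic sum finite with an index set independent of
    \<open>t\<close>.\<close>
  define N where "N = {n::int. \<bar>of_int n - 0\<bar> \<le> 2 * real B}"
  have N: "finite N" unfolding N_def by (rule int_near_set)
  have pt: "dil F 0 0 t * ?p t = dil F 0 0 t * (\<Sum>n\<in>N. 1 * dil F 0 n t)" for t
  proof (cases "dil F 0 0 t = 0")
    case False
    then have t: "\<bar>t\<bar> \<le> real B" using F by (auto simp: dil_def bump_def not_less[symmetric])
    have "?p t = (\<Sum>n\<in>N. dil F 0 0 (t - of_int n))"
      unfolding per_def
    proof (rule infsum_finite_support[OF N])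
      fix n assume "n \<notin> N"
      then have "real B < \<bar>t - of_int n\<bar>" using t unfolding N_def by auto
      then show "dil F 0 0 (t - of_int n) = 0" using F by (simp add: dil_def bump_def)
    qed
    then show ?thesis by (simp add: dil_def)
  qed simp
  have "(LINT t|lborel. dil F 0 0 t * ?p t) = ip (dil F 0 0) (\<lambda>t. \<Sum>n\<in>N. 1 * dil F 0 n t)"
    unfolding ip_def by (simp only: pt)
  also have "\<dots> = (\<Sum>n\<in>N. 1 * ip (dil F 0 0) (dil F 0 n))" by (rule ip_sum_right) auto
  also have "\<dots> = 1" using N by (simp add: ip_FF) (simp add: N_def)
  finally have sq: "(LINT t:{0..1}|lborel. (?p t)\<^sup>2) = 1"
    using integral_per[OF F per_F_continuous per, of 0 0] by (simp add: power2_eq_square)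
  note c = continuous_on_subset[OF per_F_continuous subset_UNIV]
  have i: "set_integrable lborel {0..1} (\<lambda>t. (?p t)\<^sup>2)" "set_integrable lborel {0..1} (\<lambda>t. 2 * mass * ?p t)" "set_integrable lborel {0..1} (\<lambda>t::real. mass\<^sup>2)"
     "set_integrable lborel {0..1} (\<lambda>t. (?p t)\<^sup>2 - 2 * mass * ?p t)"
    by (intro integrable_unit continuous_intros c)+
  have "(LINT t:{0..1}|lborel. (?p t - mass)\<^sup>2) = (LINT t:{0..1}|lborel. (?p t)\<^sup>2 - 2 * mass * ?p t + mass\<^sup>2)"
    by (simp add: power2_diff algebra_simps)
  also have "\<dots> = 1 - 2 * mass * mass + mass\<^sup>2"
    using i m sq by (simp add: set_integral_add set_integral_diff) (simp add: set_lebesgue_integral_def)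
  also have "\<dots> \<le> 0" using mass_ge_1 by (simp add: power2_eq_square)
  finally have z: "(LINT t:{0..1}|lborel. (?p t - mass)\<^sup>2) \<le> 0" .
  have p: "?p t = mass" if "t \<in> {0..1}" for t
    using ccont_on_eq_0[OF continuous_on_diff[OF c continuous_on_const] z that] by simp
  \<comment> \<open>Replacing \<open>F\<close> by its negative shows that \<open>mass\<close> may be
    1 or -1; the product with the periodization is 1 in either case.\<close>
  have "mass\<^sup>2 = 1"
    using sq by (subst (asm) set_lebesgue_integral_cong[where g="\<lambda>_. mass\<^sup>2"]) (auto simp: p set_lebesgue_integral_def)
  moreover have "?p t = mass"
    using p[of "t - of_int \<lfloor>t\<rfloor>"] per[of t "\<lfloor>t\<rfloor>"] by (simp add: le_floor_iff) linarith
  ultimately show ?thesis by (simp add: power2_eq_square)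
qed

end

section \<open>Reproducing kernels on the circle\<close>

definition per_ker :: "(real \<Rightarrow> real) \<Rightarrow> nat \<Rightarrow> real \<Rightarrow> real \<Rightarrow> real" where
  "per_ker \<psi> J s t = (\<Sum>m\<in>{0..<2 ^ J}. per \<psi> J m s * per \<psi> J m t)"

text \<open>Periodizing in \<open>s\<close> sums over a residue class modulo \<open>2 ^ J\<close>,
  on which \<open>per \<psi> J k t\<close> is constant. The classes of all \<open>m\<close> together
  exhaust the positions near \<open>s\<close>.\<close>

lemma per_ker_unfold:
  assumes \<psi>: "bump B \<psi>"
  shows "per_ker \<psi> J s t = (\<Sum>k\<in>near B J s. dil \<psi> J k s * per \<psi> J k t)"
proof -
  define f where "f = (\<lambda>k. dil \<psi> J k s * per \<psi> J k t)"
  have f0: "f k = 0" if "k \<notin> near B J s" for k using dil_near[OF \<psi> that] by (simp add: f_def)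
  have "per \<psi> J m s * per \<psi> J m t = (\<Sum>k\<in>{k \<in> near B J s. k mod 2 ^ J = m}. f k)" if m: "m \<in> {0..<2 ^ J}" for m
  proof -
    have "per \<psi> J m s * per \<psi> J m t = (\<Sum>\<^sub>\<infinity>n\<in>UNIV. dil \<psi> J m (s - of_int n) * per \<psi> J m t)"
      unfolding per_def[of \<psi> J m s] by (rule infsum_cmult_left'[symmetric])
    also have "\<dots> = (\<Sum>\<^sub>\<infinity>n\<in>UNIV. (f \<circ> (\<lambda>n. m + 2 ^ J * n)) n)"
      unfolding dil_shift comp_def f_def per_index ..
    also have "\<dots> = infsum f (range (\<lambda>n. m + 2 ^ J * n))"
      by (rule infsum_reindex[symmetric]) (simp add: inj_on_def)
    also have "range (\<lambda>n. m + 2 ^ J * n) = {k. k mod 2 ^ J = m}"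
    proof (intro set_eqI iffI)
      fix k assume "k \<in> {k. k mod 2 ^ J = m}"
      then have "k = m + 2 ^ J * (k div 2 ^ J)" by (simp add: mod_mult_div_eq) (metis mod_mult_div_eq)
      then show "k \<in> range (\<lambda>n. m + 2 ^ J * n)" by blast
    qed (use m in auto)
    also have "infsum f {k. k mod 2 ^ J = m} = infsum f {k \<in> near B J s. k mod 2 ^ J = m}"
      by (rule infsum_cong_neutral) (use f0 in auto)
    also have "\<dots> = (\<Sum>k\<in>{k \<in> near B J s. k mod 2 ^ J = m}. f k)" by (rule infsum_finite) (simp add: near)
    finally show ?thesis .
  qed
  then have "per_ker \<psi> J s t = (\<Sum>m\<in>{0..<2 ^ J}. \<Sum>k\<in>{k \<in> near B J s. k mod 2 ^ J = m}. f k)"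
    unfolding per_ker_def by (rule sum.cong[OF refl])
  also have "\<dots> = sum f (near B J s)"
    by (rule sum.group) (auto simp: near)
  finally show ?thesis by (simp add: f_def)
qed

lemma dil_shift_summable:
  assumes \<psi>: "bump B \<psi>"
  shows "(\<lambda>n::int. c * dil \<psi> J k (t - of_int n)) summable_on UNIV"
proof (rule finite_nonzero_values_imp_summable_on, rule finite_subset)
  let ?x = "t - of_int k / 2 ^ J"
  show "finite {n::int. \<bar>of_int n - ?x\<bar> \<le> real B}" by (rule int_near_set)
  show "{n \<in> UNIV. c * dil \<psi> J k (t - of_int n) \<noteq> 0} \<subseteq> {n. \<bar>of_int n - ?x\<bar> \<le> real B}"
  proof (intro subsetI CollectI)
    fix n :: int assume "n \<in> {n \<in> UNIV. c * dil \<psi> J k (t - of_int n) \<noteq> 0}"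
    then have "dil \<psi> J k (t - of_int n) \<noteq> 0" by auto
    then have "\<not> real B < \<bar>2 ^ J * (t - of_int n) - of_int k\<bar>" using dil_zero[OF \<psi>] by blast
    moreover have "2 ^ J * (t - of_int n) - of_int k = 2 ^ J * (?x - of_int n)" by (simp add: field_simps)
    moreover have "\<bar>?x - of_int n\<bar> \<le> 2 ^ J * \<bar>?x - of_int n\<bar>" by (simp add: mult_le_cancel_right1)
    ultimately have "\<bar>?x - of_int n\<bar> \<le> real B" by (simp add: abs_mult)
    then show "\<bar>of_int n - ?x\<bar> \<le> real B" by linarith
  qed
qed

lemma has_sum_sum:
  fixes f :: "'i \<Rightarrow> 'a \<Rightarrow> real"
  assumes "\<And>i. i \<in> I \<Longrightarrow> (f i has_sum s i) A"
  shows "((\<lambda>x. \<Sum>i\<in>I. f i x) has_sum (\<Sum>i\<in>I. s i)) A"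
  using assms by (induction I rule: infinite_finite_induct) (auto intro: has_sum_add has_sum_0)

text \<open>The kernel on the circle is the line kernel periodized in one variable, so pointwise
  identities between line kernels descend to the circle.\<close>

lemma per_ker_line:
  assumes \<psi>: "bump B \<psi>"
  shows "((\<lambda>n::int. ker B \<psi> J s (t - of_int n)) has_sum per_ker \<psi> J s t) UNIV"
proof -
  have "((\<lambda>n::int. \<Sum>k\<in>near B J s. dil \<psi> J k s * dil \<psi> J k (t - of_int n)) has_sum
     (\<Sum>k\<in>near B J s. dil \<psi> J k s * per \<psi> J k t)) UNIV"
  proof (rule has_sum_sum)
    fix k
    show "((\<lambda>n::int. dil \<psi> J k s * dil \<psi> J k (t - of_int n)) has_sum dil \<psi> J k s * per \<psi> J k t) UNIV"
      unfolding per_def infsum_cmult_right'[symmetric]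
      by (rule has_sum_infsum[OF dil_shift_summable[OF \<psi>]])
  qed
  then show ?thesis unfolding ker_def per_ker_unfold[OF \<psi>] .
qed

text \<open>Where the kernel does not vanish, \<open>s\<close> and some integer translate of
  \<open>t\<close> are both within \<open>B / 2 ^ J\<close> of a common position
  \<open>k / 2 ^ J\<close>.\<close>

lemma per_ker_support:
  assumes \<psi>: "bump B \<psi>" and nz: "per_ker \<psi> J s t \<noteq> 0"
  shows "\<exists>n::int. \<bar>s - t + of_int n\<bar> \<le> 2 * real B / 2 ^ J"
proof -
  have "\<exists>n::int. ker B \<psi> J s (t - of_int n) \<noteq> 0"
  proof (rule ccontr)
    assume "\<not> ?thesis"
    then have "((\<lambda>n::int. ker B \<psi> J s (t - of_int n)) has_sum 0) UNIV" by (simp add: has_sum_0)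
    then show False using per_ker_line[OF \<psi>] nz has_sum_unique by blast
  qed
  then obtain n :: int where "ker B \<psi> J s (t - of_int n) \<noteq> 0" by blast
  then obtain k where k: "k \<in> near B J s" "dil \<psi> J k (t - of_int n) \<noteq> 0"
    unfolding ker_def by (metis (no_types, lifting) mult_eq_0_iff sum.neutral)
  then have "k \<in> near B J (t - of_int n)" using dil_near[OF \<psi>] by blast
  then have "\<bar>2 ^ J * s - 2 ^ J * (t - of_int n)\<bar> \<le> 2 * real B"
    using k(1) unfolding near_def by auto
  moreover have "2 ^ J * s - 2 ^ J * (t - of_int n) = 2 ^ J * (s - t + of_int n)" by (simp add: algebra_simps)
  ultimately have "2 ^ J * \<bar>s - t + of_int n\<bar> \<le> 2 * real B" by (simp add: abs_mult)
  then show ?thesis by (intro exI[of _ n]) (simp add: le_divide_eq mult.commute)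
qed

lemma per_ker_continuous:
  assumes \<psi>: "bump B \<psi>"
  shows "continuous_on {0..1} (per_ker \<psi> J s)"
  unfolding per_ker_def[abs_def] by (intro continuous_intros per_continuous[OF \<psi>])

text \<open>Boundedly many positions are near \<open>s\<close>; each contributes a value of order
  \<open>2 powr (J / 2)\<close> times an L1 norm of order \<open>2 powr (- J / 2)\<close>.\<close>

lemma per_ker_L1:
  assumes \<psi>: "bump B \<psi>"
  shows "\<exists>C\<ge>0. \<forall>J s. (LINT t:{0..1}|lborel. \<bar>per_ker \<psi> J s t\<bar>) \<le> C"
proof -
  obtain C where C: "C \<ge> 0" "\<And>J k. (LINT t:{0..1}|lborel. \<bar>per \<psi> J k t\<bar>) \<le> C * 2 powr (- real J / 2)"
    using per_bounds[OF \<psi>] by blast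
  obtain C0 where C0: "C0 \<ge> 0" "\<And>x. \<bar>\<psi> x\<bar> \<le> C0" using bump_bounded[OF \<psi>] by blast
  have "(LINT t:{0..1}|lborel. \<bar>per_ker \<psi> J s t\<bar>) \<le> (2 * B + 1) * (C0 * C)" for J s
  proof -
    have pc: "set_integrable lborel {0..1} (\<lambda>t. c * \<bar>per \<psi> J k t\<bar>)" for k c
      by (intro integrable_unit continuous_intros per_continuous[OF \<psi>])
    have "(LINT t:{0..1}|lborel. \<bar>per_ker \<psi> J s t\<bar>)
       \<le> (LINT t:{0..1}|lborel. (\<Sum>k\<in>near B J s. \<bar>dil \<psi> J k s\<bar> * \<bar>per \<psi> J k t\<bar>))"
    proof (rule set_integral_mono)
      show "set_integrable lborel {0..1} (\<lambda>t. \<bar>per_ker \<psi> J s t\<bar>)"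
        by (intro integrable_unit continuous_on_rabs per_ker_continuous[OF \<psi>])
      show "set_integrable lborel {0..1} (\<lambda>t. \<Sum>k\<in>near B J s. \<bar>dil \<psi> J k s\<bar> * \<bar>per \<psi> J k t\<bar>)"
        by (intro integrable_unit continuous_intros per_continuous[OF \<psi>])
      show "\<bar>per_ker \<psi> J s t\<bar> \<le> (\<Sum>k\<in>near B J s. \<bar>dil \<psi> J k s\<bar> * \<bar>per \<psi> J k t\<bar>)" for t
        unfolding per_ker_unfold[OF \<psi>] abs_mult[symmetric] by (rule sum_abs)
    qed
    also have "\<dots> = (\<Sum>k\<in>near B J s. LINT t:{0..1}|lborel. \<bar>dil \<psi> J k s\<bar> * \<bar>per \<psi> J k t\<bar>)"
      by (rule set_integral_sum[OF pc])
    also have "\<dots> \<le> (\<Sum>k\<in>near B J s. C0 * C)"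
    proof (rule sum_mono)
      fix k
      have "\<bar>dil \<psi> J k s\<bar> * (LINT t:{0..1}|lborel. \<bar>per \<psi> J k t\<bar>)
         \<le> (2 powr (real J / 2) * C0) * (C * 2 powr (- real J / 2))"
        using C C0 by (intro mult_mono) (auto simp: dil_def abs_mult set_lebesgue_integral_def)
      also have "\<dots> = C0 * C * (2 powr (real J / 2) * 2 powr (- real J / 2))" by simp
      also have "2 powr (real J / 2) * 2 powr (- real J / 2) = (1::real)" by (simp flip: powr_add)
      finally show "(LINT t:{0..1}|lborel. \<bar>dil \<psi> J k s\<bar> * \<bar>per \<psi> J k t\<bar>) \<le> C0 * C" by simp
    qed
    also have "\<dots> \<le> (2 * B + 1) * (C0 * C)"
      using near(2)[of B J s] C C0 by (simp add: mult_right_mono)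
    finally show ?thesis .
  qed
  then show ?thesis using C C0 by (intro exI[of _ "(2 * B + 1) * (C0 * C)"]) auto
qed

context line_wavelets begin

lemma per_ker_step: "per_ker F (Suc J) s t = per_ker F J s t + per_ker M J s t"
  using has_sum_add[OF per_ker_line[OF F, of J s t] per_ker_line[OF M, of J s t]]
    per_ker_line[OF F, of "Suc J" s t] by (simp add: ker_step has_sum_unique)

text \<open>Integration in \<open>t\<close> produces a factor \<open>mass\<close> from each term;
  the remaining sum over positions is the periodized scaling function, and \<open>mass_per\<close>
  applies.\<close>

lemma integral_per_ker: "(LINT t:{0..1}|lborel. per_ker F J s t) = 1"
proof -
  have "(LINT t:{0..1}|lborel. per_ker F J s t) = (LINT t:{0..1}|lborel. (\<Sum>k\<in>near B J s. dil F J k s * per F J k t))"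
    unfolding per_ker_unfold[OF F] ..
  also have "\<dots> = (\<Sum>k\<in>near B J s. LINT t:{0..1}|lborel. dil F J k s * per F J k t)"
    by (intro set_integral_sum integrable_unit continuous_intros per_continuous[OF F])
  also have "\<dots> = (\<Sum>k\<in>near B J s. dil F J k s * (2 powr (- real J / 2) * mass))"
  proof (rule sum.cong[OF refl])
    fix k
    have "(LINT t:{0..1}|lborel. per F J k t) = 2 powr (- real J / 2) * mass"
      using integral_per[OF F, of "\<lambda>_. 1" J k] integral_dil[of F J k "\<lambda>_. 1"] by (simp add: mass_def)
    then show "(LINT t:{0..1}|lborel. dil F J k s * per F J k t) = dil F J k s * (2 powr (- real J / 2) * mass)"
      by simp
  qed
  also have "\<dots> = mass * (2 powr (- real J / 2) * (\<Sum>k\<in>near B J s. dil F J k s))"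
    by (simp add: sum_distrib_left sum_distrib_right mult_ac)
  also have "\<dots> = 1" unfolding per_dil_sum[symmetric] by (rule mass_per)
  finally show ?thesis .
qed

end

section \<open>Integration over the cube\<close>

lemma prod_Basis_vec: "(\<Prod>b\<in>(Basis :: (real^'d) set). f b) = (\<Prod>i\<in>UNIV. f (axis i 1))"
proof -
  have eq: "(Basis :: (real^'d) set) = range (\<lambda>i. axis i 1)" by (auto simp: Basis_vec_def)
  have "inj (\<lambda>i::'d. axis i (1::real))" by (auto simp: inj_on_def axis_eq_axis)
  then show ?thesis unfolding eq by (subst prod.reindex) (simp_all add: comp_def)
qed

lemma measurable_vec_lambda [measurable]:
  "vec_lambda \<in> borel_measurable (\<Pi>\<^sub>M i\<in>(UNIV :: 'd::finite set). (lborel :: real measure))"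
  by (subst borel_measurable_euclidean_space) (auto simp: Basis_vec_def inner_axis)

text \<open>Identifying Lebesgue measure with a finite product measure makes Fubini's theorem
  available coordinate by coordinate; agreement on boxes is enough.\<close>

lemma lborel_vec: "(lborel :: (real^'d) measure) = distr (\<Pi>\<^sub>M i\<in>UNIV. lborel) borel vec_lambda"
proof (rule lborel_eqI)
  interpret product_sigma_finite "\<lambda>_::'d. lborel :: real measure" ..
  fix l u :: "real^'d" assume le: "\<And>b. b \<in> Basis \<Longrightarrow> l \<bullet> b \<le> u \<bullet> b"
  have le': "l $ i \<le> u $ i" for i
    using le[of "axis i 1"] by (simp add: inner_axis)
  have "emeasure (distr (\<Pi>\<^sub>M i\<in>UNIV. lborel) borel vec_lambda) (box l u)
      = emeasure (\<Pi>\<^sub>M i\<in>(UNIV::'d set). lborel) (vec_lambda -` box l u \<inter> space (\<Pi>\<^sub>M i\<in>(UNIV::'d set). lborel))"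
    by (rule emeasure_distr[OF measurable_vec_lambda]) simp
  also have "vec_lambda -` box l u \<inter> space (\<Pi>\<^sub>M i\<in>(UNIV::'d set). lborel) = PiE UNIV (\<lambda>i. {l $ i<..<u $ i})"
    by (auto simp: space_PiM mem_box_cart PiE_iff Pi_iff)
  also have "emeasure (\<Pi>\<^sub>M i\<in>(UNIV::'d set). lborel) (PiE UNIV (\<lambda>i. {l $ i<..<u $ i})) = (\<Prod>i\<in>UNIV. emeasure lborel {l $ i<..<u $ i})"
    by (rule emeasure_PiM) auto
  also have "\<dots> = ennreal (\<Prod>i\<in>UNIV. u $ i - l $ i)"
    using le' by (simp add: prod_ennreal)
  also have "(\<Prod>i\<in>UNIV. u $ i - l $ i) = (\<Prod>b\<in>Basis. (u - l) \<bullet> b)"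
    by (simp add: prod_Basis_vec inner_axis)
  finally show "emeasure (distr (\<Pi>\<^sub>M i\<in>UNIV. lborel) borel vec_lambda) (box l u) = (\<Prod>b\<in>Basis. (u - l) \<bullet> b)" .
qed simp

abbreviation unit_ind :: "real \<Rightarrow> real" where "unit_ind \<equiv> indicator {0..1}"

lemma indicator_cube: "indicator (cbox 0 1) (\<chi> i. x i) = (\<Prod>i\<in>(UNIV::'d::finite set). unit_ind (x i))"
proof (cases "\<forall>i. x i \<in> {0..1}")
  case True
  then show ?thesis by (simp add: mem_box_cart indicator_def)
next
  case False
  then have "(\<chi> i. x i) \<notin> cbox (0::real^'d) 1" by (auto simp: mem_box_cart)
  moreover obtain j where "x j \<notin> {0..1}" using False by blast
  then have "(\<Prod>i\<in>(UNIV::'d set). unit_ind (x i)) = 0" by (intro prod_zero bexI[of _ j]) auto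
  ultimately show ?thesis by simp
qed

lemma cube_integral_PiM:
  fixes f :: "real^'d \<Rightarrow> real"
  assumes "set_integrable lborel (cbox 0 1) f"
  shows "(LINT x:cbox 0 1|lborel. f x) = (LINT x|(\<Pi>\<^sub>M i\<in>UNIV. lborel). (\<Prod>i\<in>UNIV. unit_ind (x i)) * f (\<chi> i. x i))"
    and "integrable (\<Pi>\<^sub>M i\<in>UNIV. lborel) (\<lambda>x. (\<Prod>i\<in>UNIV. unit_ind (x i)) * f (\<chi> i. x i))"
proof -
  have m: "(\<lambda>x. indicator (cbox 0 1) x *\<^sub>R f x) \<in> borel_measurable borel"
    using assms unfolding set_integrable_def by (auto dest: borel_measurable_integrable)
  show "(LINT x:cbox 0 1|lborel. f x) = (LINT x|(\<Pi>\<^sub>M i\<in>UNIV. lborel). (\<Prod>i\<in>UNIV. unit_ind (x i)) * f (\<chi> i. x i))"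
    unfolding set_lebesgue_integral_def
    by (subst lborel_vec, subst integral_distr[OF measurable_vec_lambda m]) (simp add: indicator_cube)
  have "integrable (distr (\<Pi>\<^sub>M i\<in>UNIV. lborel) borel vec_lambda) (\<lambda>x. indicator (cbox 0 1) x *\<^sub>R f x)"
    using assms unfolding set_integrable_def lborel_vec[symmetric] .
  then show "integrable (\<Pi>\<^sub>M i\<in>UNIV. lborel) (\<lambda>x. (\<Prod>i\<in>UNIV. unit_ind (x i)) * f (\<chi> i. x i))"
    by (subst (asm) integrable_distr_eq[OF measurable_vec_lambda m]) (simp add: indicator_cube)
qed

lemma unit_ind_integrable:
  "continuous_on {0..1} f \<Longrightarrow> integrable lborel (\<lambda>t. unit_ind t * f t)"
  using integrable_unit[of f] by (simp add: set_integrable_def)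

lemma continuous_on_cube_component:
  fixes f :: "'d::finite \<Rightarrow> real \<Rightarrow> real"
  assumes "\<And>i. continuous_on {0..1} (f i)"
  shows "continuous_on (cbox 0 1) (\<lambda>x::real^'d. \<Prod>i\<in>UNIV. f i (x $ i))"
  by (intro continuous_on_prod continuous_on_compose2[OF assms] continuous_intros) (auto simp: mem_box_cart)

lemma cube_integral_prod:
  fixes f :: "'d::finite \<Rightarrow> real \<Rightarrow> real"
  assumes c: "\<And>i. continuous_on {0..1} (f i)"
  shows "(LINT x:cbox 0 1|lborel. (\<Prod>i\<in>UNIV. f i (x $ i))) = (\<Prod>i\<in>UNIV. LINT t:{0..1}|lborel. f i t)"
proof -
  interpret product_sigma_finite "\<lambda>_::'d. lborel :: real measure" ..
  have "(LINT x:cbox 0 1|lborel. (\<Prod>i\<in>UNIV. f i (x $ i))) = (LINT x|(\<Pi>\<^sub>M i\<in>UNIV. lborel). (\<Prod>i\<in>UNIV. unit_ind (x i) * f i (x i)))"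
    by (subst cube_integral_PiM(1)[OF integrable_cube[OF continuous_on_cube_component[OF c]]]) (simp add: prod.distrib)
  also have "\<dots> = (\<Prod>i\<in>UNIV. LINT t|lborel. unit_ind t * f i t)"
    by (rule product_integral_prod) (auto intro: unit_ind_integrable c)
  finally show ?thesis by (simp add: set_lebesgue_integral_def)
qed

text \<open>A non-integrable \<open>f\<close> has integral 0 by convention, and the dominating
  function is nonnegative.\<close>

lemma norm_integral_le_nonneg:
  fixes f :: "'a \<Rightarrow> 'b::{banach, second_countable_topology}"
  assumes "integrable M g" "\<And>x. x \<in> space M \<Longrightarrow> norm (f x) \<le> g x"
  shows "norm (integral\<^sup>L M f) \<le> integral\<^sup>L M g"
proof (cases "integrable M f")
  case True
  then show ?thesis by (rule norm_integral_le) (use assms in auto)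
next
  case False
  have "0 \<le> g x" if "x \<in> space M" for x using assms(2)[OF that] norm_ge_zero order_trans by blast
  then have "0 \<le> integral\<^sup>L M g" by (intro integral_nonneg_AE AE_I2)
  then show ?thesis using False by (simp add: not_integrable_integral_eq)
qed

lemma cube_integral_prod_bound:
  fixes f :: "'d::finite \<Rightarrow> real \<Rightarrow> real"
  assumes c: "\<And>i. continuous_on {0..1} (f i)" and \<phi>: "continuous_on (cbox 0 1) \<phi>" and K: "\<And>x. \<bar>\<phi> x\<bar> \<le> K"
  shows "\<bar>LINT x:cbox 0 1|lborel. (\<Prod>i\<in>UNIV. f i (x $ i)) * \<phi> x\<bar> \<le> K * (\<Prod>i\<in>UNIV. LINT t:{0..1}|lborel. \<bar>f i t\<bar>)"
proof -
  have c': "continuous_on {0..1} (\<lambda>t. \<bar>f i t\<bar>)" for i by (intro continuous_intros c)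
  have "\<bar>LINT x:cbox 0 1|lborel. (\<Prod>i\<in>UNIV. f i (x $ i)) * \<phi> x\<bar> \<le> (LINT x:cbox 0 1|lborel. K * (\<Prod>i\<in>UNIV. \<bar>f i (x $ i)\<bar>))"
    unfolding set_lebesgue_integral_def
  proof (rule norm_integral_le_nonneg[where 'b=real, unfolded real_norm_def])
    show "integrable lborel (\<lambda>x. indicator (cbox 0 1) x *\<^sub>R (K * (\<Prod>i\<in>UNIV. \<bar>f i (x $ i)\<bar>)))"
      using integrable_cube[OF continuous_on_mult[OF continuous_on_const continuous_on_cube_component[OF c']], of K]
      by (simp add: set_integrable_def)
    fix x :: "real^'d"
    show "\<bar>indicator (cbox 0 1) x *\<^sub>R ((\<Prod>i\<in>UNIV. f i (x $ i)) * \<phi> x)\<bar> \<le> indicator (cbox 0 1) x *\<^sub>R (K * (\<Prod>i\<in>UNIV. \<bar>f i (x $ i)\<bar>))"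
      using mult_left_mono[OF K[of x], of "\<Prod>i\<in>UNIV. \<bar>f i (x $ i)\<bar>"]
      by (simp add: indicator_def abs_mult abs_prod prod_nonneg mult.commute)
  qed
  also have "\<dots> = K * (\<Prod>i\<in>UNIV. LINT t:{0..1}|lborel. \<bar>f i t\<bar>)" by (simp add: cube_integral_prod[OF c'])
  finally show ?thesis .
qed

text \<open>The cancellation expressed by \<open>K\<close> takes place in the single coordinate
  \<open>a\<close>, which Fubini integrates first; in the others absolute values are taken.\<close>

lemma cube_integral_coordinate_bound:
  fixes f :: "'d::finite \<Rightarrow> real \<Rightarrow> real" and a :: 'd
  assumes c: "\<And>i. continuous_on {0..1} (f i)" and \<phi>: "continuous_on (cbox 0 1) \<phi>"
    and K: "\<And>x. \<bar>LINT t:{0..1}|lborel. f a t * \<phi> (\<chi> i. if i = a then t else x i)\<bar> \<le> K"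
  shows "\<bar>LINT x:cbox 0 1|lborel. (\<Prod>i\<in>UNIV. f i (x $ i)) * \<phi> x\<bar> \<le> K * (\<Prod>i\<in>UNIV - {a}. LINT t:{0..1}|lborel. \<bar>f i t\<bar>)"
proof -
  interpret product_sigma_finite "\<lambda>_::'d. lborel :: real measure" ..
  let ?g = "\<lambda>x. (\<Prod>i\<in>UNIV. f i (x $ i)) * \<phi> x"
  have ci: "set_integrable lborel (cbox 0 1) ?g"
    by (intro integrable_cube continuous_on_mult continuous_on_cube_component c \<phi>)
  have ins: "insert a (UNIV - {a}) = UNIV" by auto
  let ?h = "\<lambda>x. (\<Prod>i\<in>UNIV. unit_ind (x i)) * ?g (\<chi> i. x i)"
  have "(LINT x:cbox 0 1|lborel. ?g x) = (LINT x|(\<Pi>\<^sub>M i\<in>insert a (UNIV - {a}). lborel). ?h x)"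
    unfolding ins by (rule cube_integral_PiM(1)[OF ci])
  also have "\<dots> = (LINT x|(\<Pi>\<^sub>M i\<in>UNIV - {a}. lborel). (LINT t|lborel. ?h (x(a := t))))"
    by (rule product_integral_insert) (use cube_integral_PiM(2)[OF ci] in \<open>auto simp: insert_absorb ins\<close>)
  also have "\<bar>\<dots>\<bar> \<le> (LINT x|(\<Pi>\<^sub>M i\<in>UNIV - {a}. lborel). K * (\<Prod>i\<in>UNIV - {a}. unit_ind (x i) * \<bar>f i (x i)\<bar>))"
  proof (rule norm_integral_le_nonneg[where 'b=real, unfolded real_norm_def])
    show "integrable (\<Pi>\<^sub>M i\<in>UNIV - {a}. lborel) (\<lambda>x. K * (\<Prod>i\<in>UNIV - {a}. unit_ind (x i) * \<bar>f i (x i)\<bar>))"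
      by (intro integrable_mult_right product_integrable_prod unit_ind_integrable continuous_intros c) auto
    fix x
    have hx: "?h (x(a := t)) = (\<Prod>i\<in>UNIV - {a}. unit_ind (x i) * f i (x i)) * (unit_ind t * (f a t * \<phi> (\<chi> i. if i = a then t else x i)))" for t
    proof -
      have p: "(\<Prod>i\<in>UNIV. q i ((x(a := t)) i)) = q a t * (\<Prod>i\<in>UNIV - {a}. q i (x i))" for q :: "'d \<Rightarrow> real \<Rightarrow> real"
        by (subst prod.remove[of UNIV a]) (auto intro!: prod.cong)
      have "(\<chi> i. (x(a := t)) i) = (\<chi> i. if i = a then t else x i)" by (simp add: vec_eq_iff)
      then show ?thesis using p[of "\<lambda>_. unit_ind"] p[of f] by (simp add: prod.distrib)
    qed
    have "\<bar>LINT t|lborel. ?h (x(a := t))\<bar> = (\<Prod>i\<in>UNIV - {a}. unit_ind (x i) * \<bar>f i (x i)\<bar>) * \<bar>LINT t:{0..1}|lborel. f a t * \<phi> (\<chi> i. if i = a then t else x i)\<bar>"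
      unfolding hx by (simp add: abs_mult abs_prod set_lebesgue_integral_def)
    also have "\<dots> \<le> (\<Prod>i\<in>UNIV - {a}. unit_ind (x i) * \<bar>f i (x i)\<bar>) * K"
      by (intro mult_left_mono K prod_nonneg) auto
    finally show "\<bar>LINT t|lborel. ?h (x(a := t))\<bar> \<le> K * (\<Prod>i\<in>UNIV - {a}. unit_ind (x i) * \<bar>f i (x i)\<bar>)" by (simp add: mult.commute)
  qed
  also have "\<dots> = K * (\<Prod>i\<in>UNIV - {a}. LINT t|lborel. unit_ind t * \<bar>f i t\<bar>)"
    by (subst integral_mult_right_zero, subst product_integral_prod)
      (auto intro!: unit_ind_integrable continuous_intros c)
  finally show ?thesis by (simp add: set_lebesgue_integral_def)
qed

lemma partial_deriv_line:
  fixes \<phi> :: "real^'d \<Rightarrow> real"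
  assumes \<phi>: "\<phi> \<in> torus_test"
  shows "((\<lambda>t. \<phi> (\<chi> i. if i = a then t else x i)) has_real_derivative
     partial_deriv (axis a 1) \<phi> (\<chi> i. if i = a then t else x i)) (at t)"
proof -
  let ?c = "\<lambda>t. (\<chi> i. if i = a then t else x i) :: real^'d"
  let ?D = "frechet_derivative \<phi> (at (?c t))"
  have c: "?c = (\<lambda>t. ?c 0 + t *\<^sub>R axis a 1)" by (auto simp: vec_eq_iff axis_def)
  have "(?c has_derivative (\<lambda>h. h *\<^sub>R axis a 1)) (at t)"
    by (subst c) (auto intro!: derivative_eq_intros)
  moreover have D: "(\<phi> has_derivative ?D) (at (?c t))"
    using torus_test_differentiable[OF \<phi>] frechet_derivative_works by blast
  ultimately have "((\<lambda>t. \<phi> (?c t)) has_derivative (\<lambda>h. ?D (h *\<^sub>R axis a 1))) (at t)"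
    by (rule has_derivative_compose)
  moreover have "?D (h *\<^sub>R axis a 1) = h * partial_deriv (axis a 1) \<phi> (?c t)" for h
    using linear_cmul[OF has_derivative_linear[OF D]] by (simp add: partial_deriv_def)
  ultimately show ?thesis by (simp add: has_field_derivative_def mult.commute[of _ "partial_deriv _ _ _"])
qed

section \<open>Periodic wavelets\<close>

definition generator :: "(real \<Rightarrow> real) \<Rightarrow> (real \<Rightarrow> real) \<Rightarrow> wavelet_kind \<Rightarrow> real \<Rightarrow> real" where
  "generator F M k = (case k of Father \<Rightarrow> F | Mother \<Rightarrow> M)"

lemma generator_simps [simp]: "generator F M Father = F" "generator F M Mother = M"
  by (simp_all add: generator_def)

lemma UNIV_wavelet_kind: "UNIV = {Father, Mother}"
  using wavelet_kind.exhaust by auto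

instance wavelet_kind :: finite
  by standard (simp add: UNIV_wavelet_kind)

lemma sum_vec_prod:
  fixes p :: "'d::finite \<Rightarrow> int \<Rightarrow> real"
  shows "(\<Sum>m\<in>wavelet_shifts L j. \<Prod>a\<in>UNIV. p a (m $ a)) = (\<Prod>a\<in>UNIV. \<Sum>k\<in>{0..<2 ^ (j + L)}. p a k)"
proof -
  have "(\<Prod>a\<in>UNIV. \<Sum>k\<in>{0..<2 ^ (j + L)}. p a k) = (\<Sum>g\<in>PiE UNIV (\<lambda>_. {0..<2 ^ (j + L)}). \<Prod>a\<in>UNIV. p a (g a))"
    by (rule prod_sum_PiE) auto
  also have "\<dots> = (\<Sum>m\<in>wavelet_shifts L j. \<Prod>a\<in>UNIV. p a (m $ a))"
    by (rule sum.reindex_bij_witness[of _ vec_nth vec_lambda]) (auto simp: wavelet_shifts_def PiE_iff)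
  finally show ?thesis ..
qed

lemma wavelet_shifts: "finite (wavelet_shifts L j :: (int^'d) set)" "card (wavelet_shifts L j :: (int^'d) set) = 2 ^ ((j + L) * CARD('d))"
proof -
  have b: "bij_betw vec_lambda (PiE (UNIV :: 'd set) (\<lambda>_. {0..<2 ^ (j + L)})) (wavelet_shifts L j :: (int^'d) set)"
    by (rule bij_betwI[where g=vec_nth]) (auto simp: wavelet_shifts_def PiE_iff)
  have "finite (PiE (UNIV :: 'd set) (\<lambda>_. {0..<2 ^ (j + L) :: int}))" by (rule finite_PiE) auto
  then show "finite (wavelet_shifts L j :: (int^'d) set)" using b bij_betw_finite by blast
  have "card (PiE (UNIV :: 'd set) (\<lambda>_. {0..<2 ^ (j + L) :: int})) = 2 ^ ((j + L) * CARD('d))"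
    by (subst card_PiE) (auto simp: nat_power_eq power_mult)
  then show "card (wavelet_shifts L j :: (int^'d) set) = 2 ^ ((j + L) * CARD('d))"
    using bij_betw_same_card[OF b] by simp
qed

lemma infsum_vec_prod:
  fixes f :: "'d::finite \<Rightarrow> int \<Rightarrow> real"
  assumes "\<And>a. (f a) summable_on UNIV"
  shows "(\<Sum>\<^sub>\<infinity>n\<in>UNIV. \<Prod>a\<in>UNIV. f a (n $ a)) = (\<Prod>a\<in>UNIV. \<Sum>\<^sub>\<infinity>k\<in>UNIV. f a k)"
proof -
  have "(\<Sum>\<^sub>\<infinity>n\<in>UNIV. \<Prod>a\<in>UNIV. f a (n $ a)) = (\<Sum>\<^sub>\<infinity>g\<in>UNIV. \<Prod>a\<in>UNIV. f a (g a))"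
    by (rule infsum_reindex_bij_witness[of _ vec_lambda vec_nth]) auto
  also have "(UNIV :: ('d \<Rightarrow> int) set) = PiE UNIV (\<lambda>_. UNIV)" by (simp add: PiE_UNIV_domain)
  also have "(\<Sum>\<^sub>\<infinity>g\<in>PiE UNIV (\<lambda>_. UNIV). \<Prod>a\<in>UNIV. f a (g a)) = (\<Prod>a\<in>UNIV. \<Sum>\<^sub>\<infinity>k\<in>UNIV. f a k)"
    by (rule infsum_prod_PiE_abs) (simp, rule summable_on_iff_abs_summable_on_real[THEN iffD1, OF assms])
  finally show ?thesis .
qed

text \<open>The lattice sum factors because the sum in each coordinate converges absolutely, and the
  normalization splits into one factor \<open>2 powr (real (j + L) / 2)\<close> per
  coordinate.\<close>

lemma periodic_wavelet_prod:
  fixes x :: "real^'d"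
  assumes "bump B F" "bump B M"
  shows "periodic_wavelet F M L j G m x = (\<Prod>a\<in>UNIV. per (generator F M (G a)) (j + L) (m $ a) (x $ a))"
proof -
  have b: "bump B (generator F M k)" for k using assms by (cases k) auto
  have "(2::real) powr (real (j + L) * real CARD('d) / 2) = (\<Prod>a\<in>(UNIV::'d set). 2 powr (real (j + L) / 2))"
    by (simp add: powr_power mult.commute)
  then have "space_wavelet F M L j G m (x - int_vec n) = (\<Prod>a\<in>UNIV. dil (generator F M (G a)) (j + L) (m $ a) (x $ a - of_int (n $ a)))" for n
    unfolding space_wavelet_def dil_def generator_def[symmetric] prod.distrib by (simp add: int_vec_def)
  then have "periodic_wavelet F M L j G m x = (\<Sum>\<^sub>\<infinity>n\<in>UNIV. \<Prod>a\<in>UNIV. dil (generator F M (G a)) (j + L) (m $ a) (x $ a - of_int (n $ a)))"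
    unfolding periodic_wavelet_def by simp
  also have "\<dots> = (\<Prod>a\<in>UNIV. per (generator F M (G a)) (j + L) (m $ a) (x $ a))"
    unfolding per_def by (rule infsum_vec_prod) (use dil_shift_summable[OF b, where c=1] in auto)
  finally show ?thesis .
qed

context line_wavelets begin

lemma bump_generator: "bump B (generator F M k)"
  using F M by (cases k) auto

lemmas wavelet_prod = periodic_wavelet_prod[OF F M]

lemma periodic_wavelet_continuous: "continuous_on (cbox 0 1) (periodic_wavelet F M L j G m)"
  unfolding wavelet_prod[abs_def]
  by (rule continuous_on_cube_component) (rule per_continuous[OF bump_generator])

lemma periodic_wavelet_periodic: "periodic_wavelet F M L j G m (x + int_vec n) = periodic_wavelet F M L j G m x"
  unfolding wavelet_prod by (simp add: int_vec_def per_periodic)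

text \<open>One constant for both generators, taken at least 1 so that its powers increase with the
  exponent.\<close>

lemma generator_bounds:
  "\<exists>C\<ge>1. \<forall>g J k. (\<forall>t\<in>{0..1}. \<bar>per (generator F M g) J k t\<bar> \<le> C * 2 powr (real J / 2)) \<and>
     (LINT t:{0..1}|lborel. \<bar>per (generator F M g) J k t\<bar>) \<le> C * 2 powr (- real J / 2)"
proof -
  obtain C1 where C1: "C1 \<ge> 0" "\<And>J k t. t \<in> {0..1} \<Longrightarrow> \<bar>per F J k t\<bar> \<le> C1 * 2 powr (real J / 2)"
    "\<And>J k. (LINT t:{0..1}|lborel. \<bar>per F J k t\<bar>) \<le> C1 * 2 powr (- real J / 2)" using per_bounds[OF F] by blast
  obtain C2 where C2: "C2 \<ge> 0" "\<And>J k t. t \<in> {0..1} \<Longrightarrow> \<bar>per M J k t\<bar> \<le> C2 * 2 powr (real J / 2)"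
    "\<And>J k. (LINT t:{0..1}|lborel. \<bar>per M J k t\<bar>) \<le> C2 * 2 powr (- real J / 2)" using per_bounds[OF M] by blast
  have m: "C1 * (2 powr y) \<le> (C1 + C2 + 1) * (2 powr y)" "C2 * (2 powr y) \<le> (C1 + C2 + 1) * (2 powr y)" for y :: real
    using C1(1) C2(1) by (auto intro!: mult_right_mono)
  show ?thesis
  proof (intro exI[of _ "C1 + C2 + 1"] conjI allI ballI)
    show "\<bar>per (generator F M g) J k t\<bar> \<le> (C1 + C2 + 1) * 2 powr (real J / 2)" if "t \<in> {0..1}" for g J k t
      using order_trans[OF C1(2)[OF that] m(1)] order_trans[OF C2(2)[OF that] m(2)] by (cases g) simp_all
    show "(LINT t:{0..1}|lborel. \<bar>per (generator F M g) J k t\<bar>) \<le> (C1 + C2 + 1) * 2 powr (- real J / 2)" for g J k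
      using order_trans[OF C1(3) m(1)] order_trans[OF C2(3) m(2)] by (cases g) simp_all
  qed (use C1 C2 in auto)
qed

text \<open>In each coordinate the squared L2 norm is at most the supremum times the L1 norm, in
  which the powers of 2 cancel. A bound is all that the randomization argument requires of these
  norms.\<close>

lemma cube_sq_wavelet:
  "\<exists>C\<ge>0. \<forall>j G m. cube_sq (periodic_wavelet F M L j G (m::int^'d)) \<le> C"
proof -
  obtain C where C: "C \<ge> 1" "\<And>g J k t. t \<in> {0..1} \<Longrightarrow> \<bar>per (generator F M g) J k t\<bar> \<le> C * 2 powr (real J / 2)"
    "\<And>g J k. (LINT t:{0..1}|lborel. \<bar>per (generator F M g) J k t\<bar>) \<le> C * 2 powr (- real J / 2)"
    using generator_bounds by blast
  have one: "(LINT t:{0..1}|lborel. (per (generator F M g) J k t)\<^sup>2) \<le> C\<^sup>2" for g J k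
  proof -
    let ?p = "per (generator F M g) J k"
    note c = per_continuous[OF bump_generator[of g], of J k]
    have "(LINT t:{0..1}|lborel. (?p t)\<^sup>2) \<le> (LINT t:{0..1}|lborel. (C * 2 powr (real J / 2)) * \<bar>?p t\<bar>)"
    proof (rule set_integral_mono)
      show "(?p t)\<^sup>2 \<le> (C * 2 powr (real J / 2)) * \<bar>?p t\<bar>" if "t \<in> {0..1}" for t
        using mult_right_mono[OF C(2)[OF that, of g J k], of "\<bar>?p t\<bar>"] by (simp add: power2_eq_square)
    qed (intro integrable_unit continuous_intros c)+
    also have "\<dots> = (C * 2 powr (real J / 2)) * (LINT t:{0..1}|lborel. \<bar>?p t\<bar>)" by simp
    also have "\<dots> \<le> (C * 2 powr (real J / 2)) * (C * 2 powr (- real J / 2))"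
      by (rule mult_left_mono[OF C(3)]) (use C(1) in auto)
    also have "\<dots> = C\<^sup>2 * (2 powr (real J / 2) * 2 powr (- real J / 2))" by (simp add: power2_eq_square)
    also have "2 powr (real J / 2) * 2 powr (- real J / 2) = (1::real)" by (simp flip: powr_add)
    finally show ?thesis by simp
  qed
  have "cube_sq (periodic_wavelet F M L j G m) \<le> (C\<^sup>2) ^ CARD('d)" for j G and m :: "int^'d"
  proof -
    have "cube_sq (periodic_wavelet F M L j G m) = (LINT x:cbox 0 1|lborel. (\<Prod>a\<in>UNIV. (per (generator F M (G a)) (j + L) (m $ a) (x $ a))\<^sup>2))"
      unfolding cube_sq_def wavelet_prod prod_power_distrib ..
    also have "\<dots> = (\<Prod>a\<in>UNIV. LINT t:{0..1}|lborel. (per (generator F M (G a)) (j + L) (m $ a) t)\<^sup>2)"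
      by (rule cube_integral_prod) (intro continuous_intros per_continuous[OF bump_generator])
    also have "\<dots> \<le> (\<Prod>a\<in>(UNIV::'d set). C\<^sup>2)"
      by (intro prod_mono conjI one) (auto simp: set_lebesgue_integral_def intro!: integral_nonneg_AE)
    finally show ?thesis by simp
  qed
  then show ?thesis by (intro exI[of _ "(C\<^sup>2) ^ CARD('d)"]) auto
qed

definition coef :: "nat \<Rightarrow> nat \<Rightarrow> ('d::finite \<Rightarrow> wavelet_kind) \<Rightarrow> int^'d \<Rightarrow> (real^'d \<Rightarrow> real) \<Rightarrow> real" where
  "coef L j G m \<phi> = (LINT r:cbox 0 1|lborel. periodic_wavelet F M L j G m r * \<phi> r)"

text \<open>A coordinate of kind \<open>Mother\<close> supplies the moment decay with exponent u +
  1/2, each of the other d - 1 coordinates an L1 factor with exponent 1/2; the exponents add up to u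
  + d/2.\<close>

lemma coef_decay:
  assumes u: "0 < u" and mom: "\<And>v. v < u \<Longrightarrow> (LINT x|lborel. x ^ v * M x) = 0"
  shows "\<exists>C\<ge>0. \<forall>\<phi>\<in>torus_test. \<forall>K. (\<forall>x. \<bar>\<phi> x\<bar> \<le> K) \<longrightarrow>
     (\<forall>a x. \<bar>foldr partial_deriv (replicate u (axis a 1)) \<phi> x\<bar> \<le> K) \<longrightarrow>
     (\<forall>j G m. G \<in> wavelet_kinds j \<longrightarrow> \<bar>coef L j (G :: 'd::finite \<Rightarrow> wavelet_kind) m \<phi>\<bar> \<le> C * K * 2 powr (- real j * (real u + real CARD('d) / 2)))"
proof -
  obtain C where C: "C \<ge> 1" "\<And>g J k. (LINT t:{0..1}|lborel. \<bar>per (generator F M g) J k t\<bar>) \<le> C * 2 powr (- real J / 2)"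
    using generator_bounds by blast
  obtain D where D1: "D \<ge> 0" and D2: "\<forall>J k d K. (\<forall>v t. v < u \<longrightarrow> (d v has_real_derivative d (Suc v) t) (at t)) \<longrightarrow>
     (\<forall>t n. d 0 (t - of_int n) = d 0 t) \<longrightarrow> (\<forall>t. \<bar>d u t\<bar> \<le> K) \<longrightarrow>
     \<bar>LINT t:{0..1}|lborel. per M J k t * d 0 t\<bar> \<le> D * K * 2 powr (- real J * (real u + 1 / 2))"
    using per_moment_decay[OF M u mom] by blast
  note D = D1 D2[rule_format]
  define n where "n = CARD('d)"
  define E where "E = (C + D) * C ^ n"
  have E: "E \<ge> 0" unfolding E_def using C(1) D(1) by simp
  have "\<bar>coef L j G m \<phi>\<bar> \<le> E * K * 2 powr (- real j * (real u + real n / 2))"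
    if \<phi>: "\<phi> \<in> torus_test" and K: "\<And>x. \<bar>\<phi> x\<bar> \<le> K" "\<And>a x. \<bar>foldr partial_deriv (replicate u (axis a 1)) \<phi> x\<bar> \<le> K"
      and G: "G \<in> wavelet_kinds j" for \<phi> K j m and G :: "'d \<Rightarrow> wavelet_kind"
  proof -
    have K0: "0 \<le> K" using K(1)[of 0] by linarith
    let ?J = "j + L"
    let ?p = "\<lambda>a. per (generator F M (G a)) ?J (m $ a)"
    have cp: "continuous_on {0..1} (?p a)" for a by (rule per_continuous[OF bump_generator])
    have c\<phi>: "continuous_on (cbox 0 1) \<phi>" by (rule torus_test_continuous[OF \<phi>])
    have Cn: "1 \<le> C ^ k" for k using C(1) by (rule one_le_power)
    show ?thesis
    proof (cases "\<exists>a. G a = Mother")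
      case True
      then obtain a where a: "G a = Mother" by blast
      have line: "\<bar>LINT t:{0..1}|lborel. ?p a t * \<phi> (\<chi> i. if i = a then t else x i)\<bar> \<le> D * K * 2 powr (- real ?J * (real u + 1 / 2))" for x
      proof -
        let ?d = "\<lambda>v t. foldr partial_deriv (replicate v (axis a 1)) \<phi> (\<chi> i. if i = a then t else x i)"
        have "\<bar>LINT t:{0..1}|lborel. per M ?J (m $ a) t * ?d 0 t\<bar> \<le> D * K * 2 powr (- real ?J * (real u + 1 / 2))"
        proof (rule D(2))
          fix v t
          have "foldr partial_deriv (replicate v (axis a 1)) \<phi> \<in> torus_test"
            by (rule torus_test_foldr[OF \<phi>]) auto
          then show "(?d v has_real_derivative ?d (Suc v) t) (at t)"
            using partial_deriv_line[of "foldr partial_deriv (replicate v (axis a 1)) \<phi>" a x t] by simp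
        next
          fix t and k :: int
          have "(\<chi> i. if i = a then t - of_int k else x i) = (\<chi> i. if i = a then t else x i) + int_vec (\<chi> i. if i = a then - k else 0)"
            by (simp add: vec_eq_iff int_vec_def)
          then show "?d 0 (t - of_int k) = ?d 0 t" using torus_test_periodic[OF \<phi>] by simp
        qed (rule K(2))
        then show ?thesis by (simp add: a)
      qed
      have "\<bar>coef L j G m \<phi>\<bar> \<le> (D * K * 2 powr (- real ?J * (real u + 1 / 2))) * (\<Prod>i\<in>UNIV - {a}. LINT t:{0..1}|lborel. \<bar>?p i t\<bar>)"
        unfolding coef_def wavelet_prod by (rule cube_integral_coordinate_bound[where f="?p" and \<phi>=\<phi>, OF cp c\<phi> line])
      also have "\<dots> \<le> (D * K * 2 powr (- real ?J * (real u + 1 / 2))) * (\<Prod>i\<in>UNIV - {a}. C * 2 powr (- real ?J / 2))"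
      proof (intro mult_left_mono prod_mono conjI C(2))
        show "0 \<le> D * K * 2 powr (- real ?J * (real u + 1 / 2))" using D(1) K0 by simp
      qed (auto simp: set_lebesgue_integral_def intro!: integral_nonneg_AE)
      also have "(\<Prod>i\<in>UNIV - {a}. C * 2 powr (- real ?J / 2)) = C ^ (n - 1) * 2 powr (- real ?J / 2 * real (n - 1))"
        by (simp add: n_def power_mult_distrib powr_power card_Diff_singleton mult.commute)
      also have "(D * K * 2 powr (- real ?J * (real u + 1 / 2))) * (C ^ (n - 1) * 2 powr (- real ?J / 2 * real (n - 1)))
        = (D * C ^ (n - 1)) * K * (2 powr (- real ?J * (real u + 1 / 2)) * 2 powr (- real ?J / 2 * real (n - 1)))"
        by (simp add: mult_ac)
      also have "2 powr (- real ?J * (real u + 1 / 2)) * 2 powr (- real ?J / 2 * real (n - 1)) = (2::real) powr (- real ?J * (real u + real n / 2))"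
      proof -
        have "real (n - 1) = real n - 1" unfolding n_def by (simp add: of_nat_diff Suc_leI)
        then have "- real ?J * (real u + 1 / 2) + - real ?J / 2 * real (n - 1) = - real ?J * (real u + real n / 2)"
          by (simp only:) (simp add: field_simps)
        then show ?thesis unfolding powr_add[symmetric] by (simp only:)
      qed
      also have "(D * C ^ (n - 1)) * K * (2::real) powr (- real ?J * (real u + real n / 2)) \<le> E * K * 2 powr (- real j * (real u + real n / 2))"
      proof (intro mult_mono)
        have "C ^ (n - 1) \<le> C ^ n" using C(1) by (intro power_increasing) auto
        then show "D * C ^ (n - 1) \<le> E" unfolding E_def using C(1) D(1) Cn[of n] by (intro mult_mono) auto
        show "(2::real) powr (- real ?J * (real u + real n / 2)) \<le> 2 powr (- real j * (real u + real n / 2))"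
          by (intro powr_mono mult_right_mono) auto
      qed (use K0 C(1) D(1) E in auto)
      finally show ?thesis .
    next
      case False
      \<comment> \<open>A pure product of scaling functions offers no cancellation, but it occurs at
        level 0 only, where a constant bound suffices.\<close>
      then have j: "j = 0" using G by (auto simp: wavelet_kinds_def split: if_splits)
      have "\<bar>coef L j G m \<phi>\<bar> \<le> K * (\<Prod>i\<in>UNIV. LINT t:{0..1}|lborel. \<bar>?p i t\<bar>)"
        unfolding coef_def wavelet_prod by (rule cube_integral_prod_bound[where f="?p" and \<phi>=\<phi>, OF cp c\<phi> K(1)])
      also have "\<dots> \<le> K * (\<Prod>i\<in>(UNIV::'d set). C)"
      proof (intro mult_left_mono prod_mono conjI)
        fix i
        have "C * 2 powr (- real ?J / 2) \<le> C * 1" using C(1) powr_mono[of "- real ?J / 2" 0 2] by (intro mult_left_mono) auto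
        then show "(LINT t:{0..1}|lborel. \<bar>?p i t\<bar>) \<le> C" using C(2)[of "G i" ?J "m $ i"] by linarith
      qed (use K0 in \<open>auto simp: set_lebesgue_integral_def intro!: integral_nonneg_AE\<close>)
      also have "\<dots> = 1 * C ^ n * K" by (simp add: n_def)
      also have "\<dots> \<le> E * K" unfolding E_def using C(1) D(1) K0 by (intro mult_right_mono) auto
      finally show ?thesis by (simp add: j)
    qed
  qed
  then show ?thesis using E unfolding n_def by blast
qed

end

section \<open>Uniform convergence of wavelet expansions of test functions\<close>

context line_wavelets begin

definition cube_ker :: "nat \<Rightarrow> real^'d \<Rightarrow> real^'d \<Rightarrow> real" where
  "cube_ker J x y = (\<Prod>a\<in>UNIV. per_ker F J (x $ a) (y $ a))"

lemma sum_shifts_ker: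
  "(\<Sum>m\<in>wavelet_shifts L j. periodic_wavelet F M L j G m x * periodic_wavelet F M L j G m y)
     = (\<Prod>a\<in>UNIV. per_ker (generator F M (G a)) (j + L) (x $ a) (y $ a))"
  unfolding wavelet_prod prod.distrib[symmetric] per_ker_def
  by (rule sum_vec_prod[of "\<lambda>a k. per (generator F M (G a)) (j + L) k (x $ a) * per (generator F M (G a)) (j + L) k (y $ a)"])

text \<open>In each coordinate the kernel of the next scale is the sum of the \<open>Father\<close>
  and \<open>Mother\<close> kernels; expanding the product over the coordinates yields one term per
  kind.\<close>

lemma sum_kinds_ker:
  fixes x y :: "real^'d"
  shows "(\<Sum>G\<in>UNIV. \<Prod>a\<in>UNIV. per_ker (generator F M (G a)) J (x $ a) (y $ a)) = cube_ker (Suc J) x y"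
proof -
  have "cube_ker (Suc J) x y = (\<Prod>a\<in>UNIV. \<Sum>k\<in>UNIV. per_ker (generator F M k) J (x $ a) (y $ a))"
    by (simp add: cube_ker_def per_ker_step UNIV_wavelet_kind)
  also have "\<dots> = (\<Sum>G\<in>PiE UNIV (\<lambda>_. UNIV). \<Prod>a\<in>UNIV. per_ker (generator F M (G a)) J (x $ a) (y $ a))"
    by (rule prod_sum_PiE) auto
  finally show ?thesis by (simp add: PiE_UNIV_domain)
qed

text \<open>For \<open>j > 0\<close> precisely the all-\<open>Father\<close> term is missing, and
  that term is the scaling kernel of the preceding level. The levels therefore telescope.\<close>

lemma level_ker:
  fixes x y :: "real^'d"
  shows "(\<Sum>G\<in>wavelet_kinds j. \<Sum>m\<in>wavelet_shifts L j. periodic_wavelet F M L j G m x * periodic_wavelet F M L j G m y)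
    = (if j = 0 then cube_ker (Suc L) x y else cube_ker (Suc (j + L)) x y - cube_ker (j + L) x y)"
proof (cases "j = 0")
  case True
  then show ?thesis using sum_kinds_ker[of L x y] by (simp add: sum_shifts_ker wavelet_kinds_def)
next
  case False
  let ?k = "\<lambda>G :: 'd \<Rightarrow> wavelet_kind. \<Prod>a\<in>UNIV. per_ker (generator F M (G a)) (j + L) (x $ a) (y $ a)"
  have "(wavelet_kinds j :: ('d \<Rightarrow> wavelet_kind) set) = UNIV - {\<lambda>_. Father}"
    using False wavelet_kind.exhaust by (auto simp: wavelet_kinds_def fun_eq_iff) (metis wavelet_kind.exhaust)
  then have "(\<Sum>G\<in>wavelet_kinds j. ?k G) = (\<Sum>G\<in>UNIV. ?k G) - ?k (\<lambda>_. Father)"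
    by (simp add: sum_diff1)
  then show ?thesis using False by (simp add: sum_shifts_ker sum_kinds_ker) (simp add: cube_ker_def)
qed

lemma levels_ker:
  fixes x y :: "real^'d"
  shows "(\<Sum>j\<le>n. \<Sum>G\<in>wavelet_kinds j. \<Sum>m\<in>wavelet_shifts L j. periodic_wavelet F M L j G m x * periodic_wavelet F M L j G m y)
    = cube_ker (Suc (n + L)) x y"
  by (induction n) (simp_all add: level_ker)

lemma cube_ker_continuous: "continuous_on (cbox 0 1) (cube_ker J x)"
  unfolding cube_ker_def[abs_def] by (rule continuous_on_cube_component) (rule per_ker_continuous[OF F])

lemma partial_sum_ker:
  fixes x :: "real^'d"
  assumes \<phi>: "\<phi> \<in> torus_test"
  shows "(\<Sum>j\<le>n. \<Sum>G\<in>wavelet_kinds j. \<Sum>m\<in>wavelet_shifts L j. coef L j G m \<phi> * periodic_wavelet F M L j G m x)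
    = (LINT y:cbox 0 1|lborel. cube_ker (Suc (n + L)) x y * \<phi> y)"
proof -
  have "(LINT y:cbox 0 1|lborel. cube_ker (Suc (n + L)) x y * \<phi> y)
    = (LINT y:cbox 0 1|lborel. (\<Sum>j\<le>n. \<Sum>G\<in>wavelet_kinds j. \<Sum>m\<in>wavelet_shifts L j.
         periodic_wavelet F M L j G m x * (periodic_wavelet F M L j G m y * \<phi> y)))"
    unfolding levels_ker[symmetric] by (simp add: sum_distrib_right mult.assoc)
  also have "\<dots> = (\<Sum>j\<le>n. LINT y:cbox 0 1|lborel. (\<Sum>G\<in>wavelet_kinds j. \<Sum>m\<in>wavelet_shifts L j.
         periodic_wavelet F M L j G m x * (periodic_wavelet F M L j G m y * \<phi> y)))"
    by (intro set_integral_sum integrable_cube continuous_intros periodic_wavelet_continuous torus_test_continuous \<phi>)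
  also have "\<dots> = (\<Sum>j\<le>n. \<Sum>G\<in>wavelet_kinds j. LINT y:cbox 0 1|lborel. (\<Sum>m\<in>wavelet_shifts L j.
         periodic_wavelet F M L j G m x * (periodic_wavelet F M L j G m y * \<phi> y)))"
    by (intro sum.cong refl set_integral_sum integrable_cube continuous_intros periodic_wavelet_continuous torus_test_continuous \<phi>)
  also have "\<dots> = (\<Sum>j\<le>n. \<Sum>G\<in>wavelet_kinds j. \<Sum>m\<in>wavelet_shifts L j. LINT y:cbox 0 1|lborel.
         periodic_wavelet F M L j G m x * (periodic_wavelet F M L j G m y * \<phi> y))"
    by (intro sum.cong refl set_integral_sum integrable_cube continuous_intros periodic_wavelet_continuous torus_test_continuous \<phi>)
  finally show ?thesis by (simp add: coef_def mult.commute)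
qed

lemma integral_cube_ker:
  fixes x :: "real^'d"
  shows "(LINT y:cbox 0 1|lborel. cube_ker J x y) = 1"
proof -
  have "(LINT y:cbox 0 1|lborel. cube_ker J x y) = (\<Prod>a\<in>(UNIV::'d set). LINT t:{0..1}|lborel. per_ker F J (x $ a) t)"
    unfolding cube_ker_def by (rule cube_integral_prod) (rule per_ker_continuous[OF F])
  then show ?thesis by (simp add: integral_per_ker)
qed

lemma torus_test_uniformly_continuous:
  fixes \<phi> :: "real^'d \<Rightarrow> real"
  assumes \<phi>: "\<phi> \<in> torus_test" and e: "0 < e"
  shows "\<exists>d>0. \<forall>x\<in>cbox 0 1. \<forall>z. norm (z - x) < d \<longrightarrow> \<bar>\<phi> z - \<phi> x\<bar> < e"
proof -
  let ?S = "cbox (- 1) 2 :: (real^'d) set"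
  have "uniformly_continuous_on ?S \<phi>"
    by (intro compact_uniformly_continuous torus_test_continuous[OF \<phi>] compact_cbox)
  then obtain d where d: "d > 0" "\<And>x z. x \<in> ?S \<Longrightarrow> z \<in> ?S \<Longrightarrow> dist z x < d \<Longrightarrow> dist (\<phi> z) (\<phi> x) < e"
    using e unfolding uniformly_continuous_on_def by metis
  have "\<bar>\<phi> z - \<phi> x\<bar> < e" if x: "x \<in> cbox 0 1" and z: "norm (z - x) < min d 1" for x z
  proof -
    have "0 \<le> x $ i \<and> x $ i \<le> 1 \<and> \<bar>z $ i - x $ i\<bar> < 1" for i
      using x z component_le_norm_cart[of "z - x" i] by (simp add: mem_box_cart)
    then have "- 1 \<le> x $ i \<and> x $ i \<le> 2 \<and> - 1 \<le> z $ i \<and> z $ i \<le> 2" for i by (smt (verit))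
    then have "x \<in> ?S" "z \<in> ?S" by (simp_all add: mem_box_cart)
    then show ?thesis using d(2)[of x z] z by (simp add: dist_norm)
  qed
  then show ?thesis using d(1) by (intro exI[of _ "min d 1"]) auto
qed

text \<open>The kernels form an approximate identity: integral 1, support shrinking to the integer
  translates of the diagonal, and, since they need not be positive, a uniform L1 bound. The constant
  \<open>\<epsilon>\<close> divides \<open>e\<close> by that bound, increased by 1 to stay
  positive.\<close>

lemma cube_ker_approximation:
  fixes \<phi> :: "real^'d \<Rightarrow> real"
  assumes \<phi>: "\<phi> \<in> torus_test" and e: "0 < e"
  shows "\<exists>J0. \<forall>J\<ge>J0. \<forall>x\<in>cbox 0 1. \<bar>(LINT y:cbox 0 1|lborel. cube_ker J x y * \<phi> y) - \<phi> x\<bar> < e"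
proof -
  obtain C where C: "C \<ge> 0" "\<And>J s. (LINT t:{0..1}|lborel. \<bar>per_ker F J s t\<bar>) \<le> C"
    using per_ker_L1[OF F] by blast
  define n where "n = CARD('d)"
  define \<epsilon> where "\<epsilon> = e / (C ^ n + 1)"
  have Cn: "0 < C ^ n + 1" using C(1) by (simp add: add_nonneg_pos)
  have \<epsilon>: "\<epsilon> > 0" unfolding \<epsilon>_def using e Cn by simp
  obtain d where d: "d > 0" "\<And>x z. x \<in> cbox 0 1 \<Longrightarrow> norm (z - x) < d \<Longrightarrow> \<bar>\<phi> z - \<phi> x\<bar> < \<epsilon>"
    using torus_test_uniformly_continuous[OF \<phi> \<epsilon>] by blast
  have "(\<lambda>J. real n * (2 * real B) / 2 ^ J) \<longlonglongrightarrow> 0" by (rule LIMSEQ_divide_realpow_zero) simp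
  then obtain J0 where J0: "\<And>J. J \<ge> J0 \<Longrightarrow> real n * (2 * real B) / 2 ^ J < d"
    using d(1) order_tendstoD(2) eventually_sequentially by metis
  have "\<bar>(LINT y:cbox 0 1|lborel. cube_ker J x y * \<phi> y) - \<phi> x\<bar> < e" if J: "J \<ge> J0" and x: "x \<in> cbox 0 1" for J x
  proof -
    note c = continuous_on_mult[OF cube_ker_continuous[of J x]]
    have near: "\<bar>\<phi> y - \<phi> x\<bar> \<le> \<epsilon>" if nz: "cube_ker J x y \<noteq> 0" for y
    proof -
      have "\<forall>a. \<exists>k::int. \<bar>x $ a - y $ a + of_int k\<bar> \<le> 2 * real B / 2 ^ J"
        using nz per_ker_support[OF F] unfolding cube_ker_def by (simp add: prod_zero_iff)
      then obtain k where k: "\<And>a. \<bar>x $ a - y $ a + of_int (k a)\<bar> \<le> 2 * real B / 2 ^ J" by metis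
      \<comment> \<open>The representative of \<open>y\<close> modulo integer vectors that is close
        to \<open>x\<close>. It may leave the cube, hence the uniform continuity beyond the
        cube.\<close>
      define z where "z = y + int_vec (\<chi> a. - k a)"
      have "norm (z - x) \<le> (\<Sum>a\<in>UNIV. \<bar>(z - x) $ a\<bar>)" by (rule norm_le_l1_cart)
      also have "\<dots> \<le> (\<Sum>a\<in>(UNIV::'d set). 2 * real B / 2 ^ J)"
        using k by (intro sum_mono) (simp add: z_def int_vec_def abs_minus_commute algebra_simps)
      also have "\<dots> < d" using J0[OF J] by (simp add: n_def)
      finally have "\<bar>\<phi> z - \<phi> x\<bar> < \<epsilon>" by (rule d(2)[OF x])
      moreover have "\<phi> z = \<phi> y" unfolding z_def by (rule torus_test_periodic[OF \<phi>])
      ultimately show ?thesis by simp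
    qed
    have i: "set_integrable lborel (cbox 0 1) (\<lambda>y. cube_ker J x y * \<phi> y)" "set_integrable lborel (cbox 0 1) (\<lambda>y. cube_ker J x y * \<phi> x)"
      "set_integrable lborel (cbox 0 1) (\<lambda>y. cube_ker J x y * (\<phi> y - \<phi> x))" "set_integrable lborel (cbox 0 1) (\<lambda>y. \<epsilon> * \<bar>cube_ker J x y\<bar>)"
      by (intro integrable_cube continuous_intros cube_ker_continuous torus_test_continuous \<phi>)+
    have "(LINT y:cbox 0 1|lborel. cube_ker J x y * \<phi> y) - \<phi> x = (LINT y:cbox 0 1|lborel. cube_ker J x y * (\<phi> y - \<phi> x))"
      unfolding right_diff_distrib by (subst set_integral_diff(2)[OF i(1,2)]) (simp add: integral_cube_ker)
    also have "\<bar>\<dots>\<bar> \<le> (LINT y:cbox 0 1|lborel. \<epsilon> * \<bar>cube_ker J x y\<bar>)"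
      unfolding set_lebesgue_integral_def
    proof (rule norm_integral_le[where 'b=real, unfolded real_norm_def])
      fix y
      have "\<bar>cube_ker J x y * (\<phi> y - \<phi> x)\<bar> \<le> \<epsilon> * \<bar>cube_ker J x y\<bar>"
        using near[of y] by (cases "cube_ker J x y = 0") (auto simp: abs_mult mult.commute intro: mult_left_mono)
      then show "\<bar>indicator (cbox 0 1) y *\<^sub>R (cube_ker J x y * (\<phi> y - \<phi> x))\<bar> \<le> indicator (cbox 0 1) y *\<^sub>R (\<epsilon> * \<bar>cube_ker J x y\<bar>)"
        by (simp add: indicator_def)
    qed (use i in \<open>auto simp: set_integrable_def\<close>)
    also have "\<dots> = \<epsilon> * (LINT y:cbox 0 1|lborel. (\<Prod>a\<in>UNIV. \<bar>per_ker F J (x $ a) (y $ a)\<bar>))"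
      by (simp add: cube_ker_def abs_prod)
    also have "(LINT y:cbox 0 1|lborel. (\<Prod>a\<in>UNIV. \<bar>per_ker F J (x $ a) (y $ a)\<bar>)) = (\<Prod>a\<in>UNIV. LINT t:{0..1}|lborel. \<bar>per_ker F J (x $ a) t\<bar>)"
      by (rule cube_integral_prod) (intro continuous_intros per_ker_continuous[OF F])
    also have "\<epsilon> * \<dots> \<le> \<epsilon> * (\<Prod>a\<in>(UNIV::'d set). C)"
      using \<epsilon> by (intro mult_left_mono prod_mono conjI C(2)) (auto simp: set_lebesgue_integral_def intro!: integral_nonneg_AE)
    also have "\<dots> = \<epsilon> * C ^ n" by (simp add: n_def)
    also have "\<dots> < \<epsilon> * (C ^ n + 1)" using \<epsilon> by simp
    also have "\<dots> = e" unfolding \<epsilon>_def using Cn by simp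
    finally show ?thesis .
  qed
  then show ?thesis by blast
qed

lemma reconstruction:
  fixes \<phi> :: "real^'d \<Rightarrow> real"
  assumes \<phi>: "\<phi> \<in> torus_test" and e: "0 < e"
  shows "\<exists>n0. \<forall>n\<ge>n0. \<forall>x\<in>cbox 0 1.
    \<bar>(\<Sum>j\<le>n. \<Sum>G\<in>wavelet_kinds j. \<Sum>m\<in>wavelet_shifts L j. coef L j G m \<phi> * periodic_wavelet F M L j G m x) - \<phi> x\<bar> < e"
  unfolding partial_sum_ker[OF \<phi>] using cube_ker_approximation[OF \<phi> e]
  by (meson le_SucI le_add1 order_trans)

end

section \<open>The wavelet coefficients of the noise\<close>

lemma cube_sq_le:
  fixes f g :: "real^'d \<Rightarrow> real"
  assumes "continuous_on (cbox 0 1) g" "\<And>x. x \<in> cbox 0 1 \<Longrightarrow> (f x)\<^sup>2 \<le> g x"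
  shows "cube_sq f \<le> (LINT x:cbox 0 1|lborel. g x)"
proof -
  have "\<bar>cube_sq f\<bar> \<le> (LINT x:cbox 0 1|lborel. g x)"
    unfolding cube_sq_def set_lebesgue_integral_def
    by (rule norm_integral_le_nonneg[where 'b=real, unfolded real_norm_def])
      (use integrable_cube[OF assms(1)] assms(2) in \<open>auto simp: set_integrable_def indicator_def\<close>)
  then show ?thesis by simp
qed

lemma cube_integral_const: "(LINT x:cbox 0 (1::real^'d)|lborel. c) = (c::real)"
  by (simp add: set_lebesgue_integral_def measure_cube)

lemma cube_sq_le_const:
  fixes f :: "real^'d \<Rightarrow> real"
  assumes "\<And>x. x \<in> cbox 0 1 \<Longrightarrow> \<bar>f x\<bar> \<le> e"
  shows "cube_sq f \<le> e\<^sup>2"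
proof -
  have "cube_sq f \<le> (LINT x:cbox 0 (1::real^'d)|lborel. e\<^sup>2)"
  proof (rule cube_sq_le)
    show "(f x)\<^sup>2 \<le> e\<^sup>2" if "x \<in> cbox 0 1" for x
      using power_mono[OF assms[OF that], of 2] by simp
  qed (rule continuous_on_const)
  then show ?thesis by (simp only: cube_integral_const)
qed

text \<open>The weight \<open>4 ^ n\<close> bounds each increment by \<open>sqrt T / 2 ^ n\<close>,
  so the sequence converges geometrically.\<close>

lemma fast_cauchy:
  fixes y :: "nat \<Rightarrow> real"
  assumes S: "summable (\<lambda>n. 4 ^ n * (y (Suc n) - y n)\<^sup>2)" and T: "(\<Sum>n. 4 ^ n * (y (Suc n) - y n)\<^sup>2) \<le> T"
  shows "\<exists>X. \<forall>N. \<bar>X - y N\<bar> \<le> 2 * sqrt T / 2 ^ N"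
proof -
  have d: "\<bar>y (Suc n) - y n\<bar> \<le> sqrt T * (1 / 2) ^ n" for n
  proof -
    have "4 ^ n * (y (Suc n) - y n)\<^sup>2 \<le> T"
      using sum_le_suminf[OF S, of "{n}"] T by auto
    moreover have "(4::real) ^ n = (2 ^ n)\<^sup>2" by (simp add: power2_eq_square flip: power_mult_distrib)
    ultimately have "(2 ^ n * \<bar>y (Suc n) - y n\<bar>)\<^sup>2 \<le> T" by (simp add: power_mult_distrib)
    then have "2 ^ n * \<bar>y (Suc n) - y n\<bar> \<le> sqrt T" by (rule real_le_rsqrt)
    then show ?thesis by (simp add: power_divide field_simps)
  qed
  have sg: "summable (\<lambda>n. sqrt T * (1 / 2) ^ n)" by (intro summable_mult summable_geometric) simp
  have sd: "summable (\<lambda>n. y (Suc n) - y n)"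
    by (rule summable_comparison_test'[OF sg, of 0]) (use d in simp)
  then have "(\<lambda>m. \<Sum>n<m. y (Suc n) - y n) \<longlonglongrightarrow> (\<Sum>n. y (Suc n) - y n)" by (rule summable_LIMSEQ)
  then have "(\<lambda>m. (y m - y 0) + y 0) \<longlonglongrightarrow> (\<Sum>n. y (Suc n) - y n) + y 0"
    unfolding sum_lessThan_telescope by (intro tendsto_add tendsto_const)
  then obtain X where X: "y \<longlonglongrightarrow> X" by auto
  have "\<bar>X - y N\<bar> \<le> 2 * sqrt T / 2 ^ N" for N
  proof (rule LIMSEQ_le_const2)
    show "(\<lambda>m. \<bar>y m - y N\<bar>) \<longlonglongrightarrow> \<bar>X - y N\<bar>" by (intro tendsto_intros X)
    have T0: "0 \<le> sqrt T" using order_trans[OF abs_ge_zero d[of 0]] by simp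
    \<comment> \<open>The subtracted tail of the geometric series is what closes the induction; it
      is discarded afterwards.\<close>
    have "\<bar>y (N + k) - y N\<bar> \<le> 2 * sqrt T / 2 ^ N - 2 * sqrt T / 2 ^ (N + k)" for k
    proof (induction k)
      case (Suc k)
      have "\<bar>y (N + Suc k) - y N\<bar> \<le> \<bar>y (Suc (N + k)) - y (N + k)\<bar> + \<bar>y (N + k) - y N\<bar>" by simp
      also have "\<dots> \<le> sqrt T * (1 / 2) ^ (N + k) + (2 * sqrt T / 2 ^ N - 2 * sqrt T / 2 ^ (N + k))"
        by (intro add_mono d Suc)
      also have "\<dots> = 2 * sqrt T / 2 ^ N - 2 * sqrt T / 2 ^ (N + Suc k)"
        by (simp add: power_divide)
      finally show ?case .
    qed simp
    moreover have "0 \<le> 2 * sqrt T / 2 ^ (N + k)" for k using T0 by simp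
    ultimately have "\<bar>y (N + k) - y N\<bar> \<le> 2 * sqrt T / 2 ^ N" for k
      by (meson diff_le_eq le_add_same_cancel1 order_trans)
    then show "\<exists>M. \<forall>m\<ge>M. \<bar>y m - y N\<bar> \<le> 2 * sqrt T / 2 ^ N"
      by (metis le_Suc_ex)
  qed
  then show ?thesis by blast
qed

text \<open>Transport along an enumeration of \<open>A\<close>; unoccupied indices receive the zero
  function, of norm 0.\<close>

lemma (in levy_noise) AE_summable_on_squares:
  assumes A: "countable A" and \<phi>: "\<And>i. i \<in> A \<Longrightarrow> \<phi> i \<in> torus_test" and S: "(\<lambda>i. cube_sq (\<phi> i)) summable_on A"
  shows "AE \<omega> in P. (\<lambda>i. (w \<omega> (\<phi> i))\<^sup>2) summable_on A"
proof -
  let ?B = "to_nat_on A ` A"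
  define f where "f = (\<lambda>n. if n \<in> ?B then \<phi> (from_nat_into A n) else (\<lambda>x. 0))"
  have inj: "inj_on (to_nat_on A) A" using A by (rule inj_on_to_nat_on)
  have f1: "f (to_nat_on A i) = \<phi> i" if "i \<in> A" for i
    using that A unfolding f_def by simp
  have f: "f n \<in> torus_test" for n
    unfolding f_def using \<phi> A torus_test_const[of 0] by (auto simp: from_nat_into)
  have "(\<lambda>n. cube_sq (f n)) summable_on ?B"
    unfolding summable_on_reindex[OF inj] using S by (subst summable_on_cong[where g="\<lambda>i. cube_sq (\<phi> i)"]) (auto simp: f1)
  then have "(\<lambda>n. cube_sq (f n)) summable_on UNIV"
    by (subst summable_on_cong_neutral[where T="?B" and g="\<lambda>n. cube_sq (f n)"]) (auto simp: f_def cube_sq_def)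
  then have "summable (\<lambda>n. cube_sq (f n))"
    by (subst (asm) summable_on_UNIV_nonneg_real_iff) (simp_all add: cube_sq_nonneg)
  then have "AE \<omega> in P. summable (\<lambda>n. (w \<omega> (f n))\<^sup>2)" by (rule AE_summable_squares[OF f])
  then show ?thesis
  proof (rule AE_mp, intro AE_I2 impI)
    fix \<omega> assume "summable (\<lambda>n. (w \<omega> (f n))\<^sup>2)"
    then have "(\<lambda>n. (w \<omega> (f n))\<^sup>2) summable_on UNIV"
      by (subst summable_on_UNIV_nonneg_real_iff) simp_all
    then have "(\<lambda>n. (w \<omega> (f n))\<^sup>2) summable_on ?B" by (rule summable_on_subset_banach) simp
    then show "(\<lambda>i. (w \<omega> (\<phi> i))\<^sup>2) summable_on A"
      unfolding summable_on_reindex[OF inj] by (subst summable_on_cong[where g="((\<lambda>n. (w \<omega> (f n))\<^sup>2) \<circ> to_nat_on A)"]) (auto simp: f1)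
  qed
qed

type_synonym 'b index = "nat \<times> ('b \<Rightarrow> wavelet_kind) \<times> (int^'b)"

text \<open>The lower bound on \<open>s\<close> makes the weights \<open>lam\<close> summable over
  all wavelets; the upper bound makes \<open>bnd\<close>, the share of the test function in the
  series, summable.\<close>

locale noise_wavelets = levy_noise P w + line_wavelets F M B
  for P :: "'w measure" and w :: "'w \<Rightarrow> (real^'d \<Rightarrow> real) \<Rightarrow> real" and F M B +
  fixes L u :: nat and s :: real
  assumes u: "0 < u" and moments: "\<And>v. v < u \<Longrightarrow> (LINT x|lborel. x ^ v * M x) = 0"
    and s: "real CARD('d) / 2 < s" "s < real u"
begin

definition idx :: "'d index set" where
  "idx = Sigma UNIV (\<lambda>j. wavelet_kinds j \<times> wavelet_shifts L j)"

definition \<Psi> :: "'d index \<Rightarrow> real^'d \<Rightarrow> real" where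
  "\<Psi> = (\<lambda>(j, G, m). periodic_wavelet F M L j G m)"

definition cf :: "'d index \<Rightarrow> (real^'d \<Rightarrow> real) \<Rightarrow> real" where
  "cf = (\<lambda>(j, G, m). coef L j G m)"

definition idx_upto :: "nat \<Rightarrow> 'd index set" where
  "idx_upto n = Sigma {..n} (\<lambda>j. wavelet_kinds j \<times> wavelet_shifts L j)"

lemma finite_level: "finite (wavelet_kinds j \<times> wavelet_shifts L j :: (('d \<Rightarrow> wavelet_kind) \<times> (int^'d)) set)"
  by (intro finite_cartesian_product wavelet_shifts) simp

lemma countable_idx: "countable idx"
  unfolding idx_def by (rule countable_SIGMA[OF countableI_type countable_finite[OF finite_level]])

lemma finite_idx_upto: "finite (idx_upto n)" and idx_upto_subset: "idx_upto n \<subseteq> idx"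
  unfolding idx_upto_def idx_def by (intro finite_SigmaI finite_level) auto

lemma sum_idx_upto: "(\<Sum>i\<in>idx_upto n. h i) = (\<Sum>j\<le>n. \<Sum>G\<in>wavelet_kinds j. \<Sum>m\<in>wavelet_shifts L j. h (j, G, m))"
proof -
  have "(\<Sum>i\<in>idx_upto n. h i) = (\<Sum>j\<le>n. \<Sum>x\<in>wavelet_kinds j \<times> wavelet_shifts L j. h (j, x))"
    unfolding idx_upto_def by (subst sum.Sigma) (use finite_level in auto)
  then show ?thesis by (simp add: sum.cartesian_product split_def)
qed

lemma idx_upto_limit: "filterlim idx_upto (finite_subsets_at_top idx) sequentially"
  unfolding filterlim_finite_subsets_at_top
proof (intro allI impI)
  fix X :: "'d index set" assume X: "finite X \<and> X \<subseteq> idx"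
  show "\<forall>\<^sub>F n in sequentially. finite (idx_upto n) \<and> X \<subseteq> idx_upto n \<and> idx_upto n \<subseteq> idx"
    unfolding eventually_sequentially
  proof (intro exI[of _ "Max (fst ` X)"] allI impI conjI finite_idx_upto idx_upto_subset)
    fix n assume n: "Max (fst ` X) \<le> n"
    show "X \<subseteq> idx_upto n"
    proof
      fix i assume i: "i \<in> X"
      then have "fst i \<le> n" using X n by (meson Max_ge finite_imageI imageI order_trans)
      then show "i \<in> idx_upto n" using i X by (auto simp: idx_def idx_upto_def)
    qed
  qed
qed

text \<open>Level \<open>j\<close> has at most a constant times \<open>2 ^ (j * CARD('d))\<close>
  indices, which leaves a geometric series of ratio \<open>2 powr (CARD('d) - x)\<close>.\<close>

lemma summable_on_idx:
  assumes x: "real CARD('d) < x"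
  shows "(\<lambda>i. 2 powr (- x * real (fst i))) summable_on idx"
  unfolding idx_def
proof (rule summable_on_SigmaI)
  let ?K = "real CARD('d \<Rightarrow> wavelet_kind)"
  let ?c = "\<lambda>j. real (card (wavelet_kinds j \<times> wavelet_shifts L j :: (('d \<Rightarrow> wavelet_kind) \<times> (int^'d)) set)) * 2 powr (- x * real j)"
  show "((\<lambda>y. 2 powr (- x * real (fst (j, y)))) has_sum ?c j) (wavelet_kinds j \<times> wavelet_shifts L j :: (('d \<Rightarrow> wavelet_kind) \<times> (int^'d)) set)" for j
    by (rule has_sum_finiteI[OF finite_level]) simp
  have c: "?c j \<le> ?K * 2 ^ (L * CARD('d)) * (2 powr (real CARD('d) - x)) ^ j" for j
  proof -
    have "card (wavelet_kinds j :: ('d \<Rightarrow> wavelet_kind) set) \<le> CARD('d \<Rightarrow> wavelet_kind)" by (rule card_mono) auto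
    then have "?c j \<le> ?K * 2 ^ ((j + L) * CARD('d)) * 2 powr (- x * real j)"
      unfolding card_cartesian_product wavelet_shifts of_nat_mult by (intro mult_right_mono) auto
    also have "(2::real) ^ ((j + L) * CARD('d)) = 2 ^ (L * CARD('d)) * 2 powr (real CARD('d) * real j)"
      by (simp add: powr_realpow[symmetric] powr_add[symmetric] algebra_simps)
    also have "?K * (2 ^ (L * CARD('d)) * 2 powr (real CARD('d) * real j)) * 2 powr (- x * real j)
       = ?K * 2 ^ (L * CARD('d)) * (2 powr (real CARD('d) * real j) * 2 powr (- x * real j))" by simp
    also have "2 powr (real CARD('d) * real j) * 2 powr (- x * real j) = (2 powr (real CARD('d) - x)) ^ j"
      by (simp add: powr_power powr_add[symmetric] algebra_simps)
    finally show ?thesis .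
  qed
  have "2 powr (real CARD('d) - x) < 2 powr 0" using x by (intro powr_less_mono) auto
  then have "summable (\<lambda>j. ?K * 2 ^ (L * CARD('d)) * (2 powr (real CARD('d) - x)) ^ j)"
    by (intro summable_mult summable_geometric) simp
  then have "summable ?c"
    by (rule summable_comparison_test'[where N=0]) (use c in \<open>simp only: real_norm_def abs_of_nonneg abs_mult, simp\<close>)
  then show "?c summable_on UNIV" by (subst summable_on_UNIV_nonneg_real_iff) auto
qed simp

end

section \<open>Coefficients of the noise as pathwise limits\<close>

context noise_wavelets begin

definition lam :: "'d index \<Rightarrow> real" where
  "lam i = 2 powr (- (2 * s) * real (fst i))"

lemma lam_pos: "0 < lam i"
  by (simp add: lam_def)

lemma lam_nonneg [simp]: "0 \<le> lam i"
  by (simp add: lam_def)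

lemma summable_lam: "lam summable_on idx"
  unfolding lam_def[abs_def] by (rule summable_on_idx) (use s in simp)

lemma \<Psi>_continuous: "continuous_on (cbox 0 1) (\<Psi> i)"
  unfolding \<Psi>_def by (cases i) (simp add: periodic_wavelet_continuous)

lemma \<Psi>_periodic: "\<Psi> i (x + int_vec n) = \<Psi> i x"
  unfolding \<Psi>_def by (cases i) (simp add: periodic_wavelet_periodic)

lemma cf_eq: "cf i \<phi> = (LINT r:cbox 0 1|lborel. \<Psi> i r * \<phi> r)"
  unfolding cf_def \<Psi>_def coef_def by (cases i) simp

text \<open>The accuracy is chosen against the weight \<open>4 ^ n\<close> of
  \<open>fast_cauchy\<close>: squared increments are at most \<open>1 / 16 ^ n\<close>, so the
  weighted norms still decay like \<open>(1 / 4) ^ n\<close>.\<close>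

definition approx :: "'d index \<Rightarrow> nat \<Rightarrow> real^'d \<Rightarrow> real" where
  "approx i n = (SOME \<phi>. \<phi> \<in> torus_test \<and> (\<forall>x\<in>cbox 0 1. \<bar>\<Psi> i x - \<phi> x\<bar> < 1 / 4 ^ Suc n))"

lemma approx: "approx i n \<in> torus_test" "x \<in> cbox 0 1 \<Longrightarrow> \<bar>\<Psi> i x - approx i n x\<bar> < 1 / 4 ^ Suc n"
proof -
  have "\<exists>\<phi>. \<phi> \<in> torus_test \<and> (\<forall>x\<in>cbox 0 1. \<bar>\<Psi> i x - \<phi> x\<bar> < 1 / 4 ^ Suc n)"
    using torus_test_uniformly_dense[OF \<Psi>_continuous[of i] \<Psi>_periodic[of i], of "1 / 4 ^ Suc n"]
    by (simp add: Bex_def)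
  from someI_ex[OF this, folded approx_def]
  show "approx i n \<in> torus_test" "x \<in> cbox 0 1 \<Longrightarrow> \<bar>\<Psi> i x - approx i n x\<bar> < 1 / 4 ^ Suc n" by blast+
qed

lemma w_diff: "\<omega> \<in> space P \<Longrightarrow> \<phi> \<in> torus_test \<Longrightarrow> \<psi> \<in> torus_test \<Longrightarrow> w \<omega> (\<lambda>x. \<phi> x - \<psi> x) = w \<omega> \<phi> - w \<omega> \<psi>"
  using torus_test_lin(1)[OF w_dual, of \<omega> \<phi> "\<lambda>x. -1 * \<psi> x"] torus_test_lin(2)[OF w_dual, of \<omega> \<psi> "-1"]
    torus_test_scale[of \<psi> "-1"] by simp

lemma w_sum:
  assumes "\<omega> \<in> space P" "finite I" "\<And>i. i \<in> I \<Longrightarrow> \<phi> i \<in> torus_test"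
  shows "w \<omega> (\<lambda>x. \<Sum>i\<in>I. c i * \<phi> i x) = (\<Sum>i\<in>I. c i * w \<omega> (\<phi> i))"
  using assms(2,3)
proof (induction I rule: finite_induct)
  case empty
  show ?case using torus_test_lin(2)[OF w_dual[OF assms(1)] torus_test_const[of 0], of 0] by simp
next
  case (insert i I)
  have "(\<lambda>x. c i * \<phi> i x) \<in> torus_test" "(\<lambda>x. \<Sum>i\<in>I. c i * \<phi> i x) \<in> torus_test"
    using insert by (auto intro!: torus_test_sum torus_test_scale)
  then show ?case
    using insert torus_test_lin(1)[OF w_dual[OF assms(1)], of "\<lambda>x. c i * \<phi> i x" "\<lambda>x. \<Sum>i\<in>I. c i * \<phi> i x"]
      torus_test_lin(2)[OF w_dual[OF assms(1)], of "\<phi> i" "c i"] by simp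
qed

definition incr :: "'w \<Rightarrow> 'd index \<Rightarrow> nat \<Rightarrow> real" where
  "incr \<omega> i n = w \<omega> (approx i (Suc n)) - w \<omega> (approx i n)"

text \<open>On this event the limits \<open>X \<omega> i\<close> exist and their weighted squares
  are summable, by arguments that are deterministic in \<open>\<omega>\<close>.\<close>

definition good :: "'w \<Rightarrow> bool" where
  "good \<omega> \<longleftrightarrow> \<omega> \<in> space P \<and> (\<lambda>i. lam i * (w \<omega> (approx i 0))\<^sup>2) summable_on idx \<and>
     (\<lambda>(i, n). lam i * (4 ^ n * (incr \<omega> i n)\<^sup>2)) summable_on idx \<times> UNIV"

lemma cube_sq_approx_0: "\<exists>C. \<forall>i. cube_sq (approx i 0) \<le> C"
proof -
  obtain C where C: "\<And>j G m. cube_sq (periodic_wavelet F M L j G (m :: int^'d)) \<le> C"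
    using cube_sq_wavelet by blast
  have "cube_sq (approx i 0) \<le> 2 * C + 2" for i
  proof -
    have c: "continuous_on (cbox 0 1) (\<lambda>x. 2 * (\<Psi> i x)\<^sup>2 + 2)"
      by (intro continuous_intros \<Psi>_continuous)
    have i1: "set_integrable lborel (cbox 0 1) (\<lambda>x. 2 * (\<Psi> i x)\<^sup>2)"
      by (intro integrable_cube continuous_intros \<Psi>_continuous)
    have i2: "set_integrable lborel (cbox 0 1) (\<lambda>x::real^'d. 2 :: real)"
      by (intro integrable_cube continuous_intros)
    have "cube_sq (approx i 0) \<le> (LINT x:cbox 0 1|lborel. 2 * (\<Psi> i x)\<^sup>2 + 2)"
    proof (rule cube_sq_le[OF c])
      fix x :: "real^'d" assume x: "x \<in> cbox 0 1"
      have "\<bar>\<Psi> i x - approx i 0 x\<bar> \<le> 1" using approx(2)[OF x, of i 0] by simp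
      then have d: "(\<Psi> i x - approx i 0 x)\<^sup>2 \<le> 1" by (simp add: abs_square_le_1)
      have "(approx i 0 x)\<^sup>2 + (2 * \<Psi> i x - approx i 0 x)\<^sup>2 = 2 * (\<Psi> i x)\<^sup>2 + 2 * (\<Psi> i x - approx i 0 x)\<^sup>2"
        by (simp add: power2_eq_square algebra_simps)
      then show "(approx i 0 x)\<^sup>2 \<le> 2 * (\<Psi> i x)\<^sup>2 + 2"
        using d zero_le_power2[of "2 * \<Psi> i x - approx i 0 x"] by linarith
    qed
    also have "\<dots> = 2 * cube_sq (\<Psi> i) + 2"
      unfolding set_integral_add(2)[OF i1 i2] cube_sq_def by (simp add: cube_integral_const)
    also have "\<dots> \<le> 2 * C + 2"
      using C unfolding \<Psi>_def by (cases i) simp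
    finally show ?thesis .
  qed
  then show ?thesis by blast
qed

text \<open>Square summability is applied to two families: the initial approximations scaled by
  \<open>sqrt (lam i)\<close>, and the increments scaled by \<open>sqrt (lam i) * 2 ^ n\<close>,
  indexed by pairs. Their squared norms are of order \<open>lam i\<close> and
  \<open>lam i * (1 / 4) ^ n\<close>.\<close>

lemma AE_good: "AE \<omega> in P. good \<omega>"
proof -
  obtain C where C: "\<And>i. cube_sq (approx i 0) \<le> C" using cube_sq_approx_0 by blast
  have 1: "AE \<omega> in P. (\<lambda>i. (w \<omega> (\<lambda>x. sqrt (lam i) * approx i 0 x))\<^sup>2) summable_on idx"
  proof (rule AE_summable_on_squares[OF countable_idx])
    show "(\<lambda>i. cube_sq (\<lambda>x. sqrt (lam i) * approx i 0 x)) summable_on idx"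
    proof (rule summable_on_comparison_test)
      show "(\<lambda>i. C * lam i) summable_on idx" by (rule summable_on_cmult_right[OF summable_lam])
      show "cube_sq (\<lambda>x. sqrt (lam i) * approx i 0 x) \<le> C * lam i" for i
        using mult_right_mono[OF C[of i], of "lam i"] lam_pos[of i] by (simp add: cube_sq_scale mult.commute)
    qed (rule cube_sq_nonneg)
  qed (intro torus_test_scale approx)
  let ?\<theta> = "\<lambda>(i, n) x. (sqrt (lam i) * 2 ^ n) * (approx i (Suc n) x - approx i n x)"
  have 2: "AE \<omega> in P. (\<lambda>z. (w \<omega> (?\<theta> z))\<^sup>2) summable_on idx \<times> UNIV"
  proof (rule AE_summable_on_squares)
    show "countable (idx \<times> (UNIV :: nat set))" using countable_idx by simp
    show "?\<theta> z \<in> torus_test" for z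
      by (cases z) (auto intro!: torus_test_scale torus_test_diff approx)
    have g: "(\<lambda>n::nat. (1 / 4 :: real) ^ n) summable_on UNIV"
      by (subst summable_on_UNIV_nonneg_real_iff) (auto intro: summable_geometric)
    have "(\<lambda>(i, n::nat). lam i * (1 / 4) ^ n) summable_on idx \<times> UNIV"
    proof (rule summable_on_SigmaI)
      show "((\<lambda>n::nat. case (i, n) of (i, n) \<Rightarrow> lam i * (1 / 4) ^ n) has_sum lam i * infsum (\<lambda>n::nat. (1 / 4) ^ n) UNIV) UNIV" for i
        unfolding prod.case by (rule has_sum_cmult_right[OF has_sum_infsum[OF g]])
      show "(\<lambda>i. lam i * infsum (\<lambda>n::nat. (1 / 4 :: real) ^ n) UNIV) summable_on idx"
        by (rule summable_on_cmult_left[OF summable_lam])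
    qed auto
    then show "(\<lambda>z. cube_sq (?\<theta> z)) summable_on idx \<times> UNIV"
    proof (rule summable_on_comparison_test)
      fix z :: "'d index \<times> nat"
      obtain i n where z: "z = (i, n)" by (cases z)
      have "cube_sq (\<lambda>x. approx i (Suc n) x - approx i n x) \<le> (1 / 4 ^ n)\<^sup>2"
      proof (rule cube_sq_le_const)
        fix x :: "real^'d" assume x: "x \<in> cbox 0 1"
        show "\<bar>approx i (Suc n) x - approx i n x\<bar> \<le> 1 / 4 ^ n"
        proof -
          define c where "c = (1::real) / 4 ^ n"
          have "0 \<le> c" "\<bar>\<Psi> i x - approx i n x\<bar> < c / 4" "\<bar>\<Psi> i x - approx i (Suc n) x\<bar> < c / 16"
            using approx(2)[OF x, of i n] approx(2)[OF x, of i "Suc n"] by (simp_all add: c_def)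
          then show ?thesis unfolding c_def[symmetric] by linarith
        qed
      qed
      then have "(sqrt (lam i) * 2 ^ n)\<^sup>2 * cube_sq (\<lambda>x. approx i (Suc n) x - approx i n x) \<le> (sqrt (lam i) * 2 ^ n)\<^sup>2 * (1 / 4 ^ n)\<^sup>2"
        by (rule mult_left_mono) simp
      also have "\<dots> = lam i * ((2 ^ n)\<^sup>2 * (1 / 4 ^ n)\<^sup>2)"
        using lam_pos[of i] by (simp add: power_mult_distrib)
      also have "(2 ^ n)\<^sup>2 * (1 / 4 ^ n)\<^sup>2 = (1 / 4 :: real) ^ n"
      proof -
        have "(2 ^ n)\<^sup>2 = (4::real) ^ n" by (simp add: power2_eq_square flip: power_mult_distrib)
        then have "(2 ^ n)\<^sup>2 * (1 / 4 ^ n)\<^sup>2 = (4::real) ^ n * (1 / 4 ^ n)\<^sup>2" by (simp only:)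
        also have "\<dots> = (1 / 4) ^ n" by (simp add: power2_eq_square power_one_over)
        finally show ?thesis .
      qed
      finally show "cube_sq (?\<theta> z) \<le> (case z of (i, n) \<Rightarrow> lam i * (1 / 4) ^ n)"
        unfolding z by (simp only: prod.case cube_sq_scale)
    qed (rule cube_sq_nonneg)
  qed
  from 1 2 show ?thesis
  proof (rule AE_mp[OF AE_conjI], intro AE_I2 impI)
    fix \<omega> assume \<omega>: "\<omega> \<in> space P" and
      sm: "(\<lambda>i. (w \<omega> (\<lambda>x. sqrt (lam i) * approx i 0 x))\<^sup>2) summable_on idx \<and> (\<lambda>z. (w \<omega> (?\<theta> z))\<^sup>2) summable_on idx \<times> UNIV"
    have "(w \<omega> (\<lambda>x. sqrt (lam i) * approx i 0 x))\<^sup>2 = lam i * (w \<omega> (approx i 0))\<^sup>2" for i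
      using torus_test_lin(2)[OF w_dual[OF \<omega>] approx(1), of "sqrt (lam i)" i 0] lam_pos[of i] by (simp add: power_mult_distrib)
    moreover have "(\<lambda>z. (w \<omega> (?\<theta> z))\<^sup>2) = (\<lambda>(i, n). lam i * (4 ^ n * (incr \<omega> i n)\<^sup>2))"
    proof (intro ext, clarify)
      fix j G m n
      let ?i = "(j, G, m) :: 'd index"
      have 4: "(2 ^ n)\<^sup>2 = (4::real) ^ n" by (simp add: power2_eq_square flip: power_mult_distrib)
      have "w \<omega> (\<lambda>x. (sqrt (lam ?i) * 2 ^ n) * (approx ?i (Suc n) x - approx ?i n x)) = (sqrt (lam ?i) * 2 ^ n) * incr \<omega> ?i n"
        unfolding incr_def w_diff[OF \<omega> approx(1) approx(1), symmetric]
        by (rule torus_test_lin(2)[OF w_dual[OF \<omega>]]) (intro torus_test_diff approx)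
      then show "(w \<omega> (\<lambda>x. (sqrt (lam ?i) * 2 ^ n) * (approx ?i (Suc n) x - approx ?i n x)))\<^sup>2 = lam ?i * (4 ^ n * (incr \<omega> ?i n)\<^sup>2)"
        using lam_pos[of ?i] by (simp add: power_mult_distrib 4)
    qed
    ultimately show "good \<omega>" unfolding good_def using \<omega> sm by simp
  qed
qed

text \<open>The share of index \<open>i\<close> in the double series of \<open>good\<close>. Divided
  by \<open>lam i\<close> it controls all approximation errors of \<open>X \<omega> i\<close>, and
  it is summable over \<open>i\<close>.\<close>

definition rem :: "'w \<Rightarrow> 'd index \<Rightarrow> real" where
  "rem \<omega> i = infsum (\<lambda>n. lam i * (4 ^ n * (incr \<omega> i n)\<^sup>2)) UNIV"

text \<open>The choice is meaningful for \<open>good \<omega>\<close> only.\<close>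

definition X :: "'w \<Rightarrow> 'd index \<Rightarrow> real" where
  "X \<omega> i = (SOME x. \<forall>N. \<bar>x - w \<omega> (approx i N)\<bar> \<le> 2 * sqrt (rem \<omega> i / lam i) / 2 ^ N)"

lemma good_inner: "good \<omega> \<Longrightarrow> i \<in> idx \<Longrightarrow> (\<lambda>n. lam i * (4 ^ n * (incr \<omega> i n)\<^sup>2)) summable_on UNIV"
  unfolding good_def using summable_on_SigmaD1[of "\<lambda>i n. lam i * (4 ^ n * (incr \<omega> i n)\<^sup>2)" idx "\<lambda>_. UNIV" i] by simp

lemma good_rem: assumes "good \<omega>" shows "rem \<omega> summable_on idx"
  unfolding rem_def[abs_def]
  using summable_on_SigmaD[of "\<lambda>(i, n). lam i * (4 ^ n * (incr \<omega> i n)\<^sup>2)" idx "\<lambda>_. UNIV"] good_inner[OF assms] assms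
  by (simp add: good_def)

lemma rem_nonneg: "0 \<le> rem \<omega> i"
  unfolding rem_def by (rule infsum_nonneg) simp

lemma X:
  assumes "good \<omega>" "i \<in> idx"
  shows "\<bar>X \<omega> i - w \<omega> (approx i N)\<bar> \<le> 2 * sqrt (rem \<omega> i / lam i) / 2 ^ N"
proof -
  let ?f = "\<lambda>n. 4 ^ n * (incr \<omega> i n)\<^sup>2"
  have f: "?f summable_on UNIV"
    using good_inner[OF assms] lam_pos[of i] by (subst (asm) summable_on_cmult_right') auto
  have "(\<Sum>n. ?f n) = infsum ?f UNIV"
    by (rule sums_unique[symmetric, OF has_sum_imp_sums[OF has_sum_infsum[OF f]]])
  also have "\<dots> = rem \<omega> i / lam i"
    unfolding rem_def using lam_pos[of i] by (simp add: infsum_cmult_right')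
  finally have "(\<Sum>n. ?f n) = rem \<omega> i / lam i" .
  moreover have "summable ?f" using f by (subst (asm) summable_on_UNIV_nonneg_real_iff) auto
  ultimately have "\<exists>x. \<forall>N. \<bar>x - w \<omega> (approx i N)\<bar> \<le> 2 * sqrt (rem \<omega> i / lam i) / 2 ^ N"
    using fast_cauchy[of "\<lambda>n. w \<omega> (approx i n)" "rem \<omega> i / lam i"] by (simp add: incr_def)
  from someI_ex[OF this, folded X_def] show ?thesis by blast
qed

text \<open>The squared error of the initial approximation is at most
  \<open>4 * rem \<omega> i / lam i\<close>; the weight cancels the denominator and leaves the
  summable \<open>rem \<omega>\<close>.\<close>

lemma summable_lam_X:
  assumes "good \<omega>"
  shows "(\<lambda>i. lam i * (X \<omega> i)\<^sup>2) summable_on idx"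
proof (rule summable_on_comparison_test)
  show "(\<lambda>i. 2 * (lam i * (w \<omega> (approx i 0))\<^sup>2) + 8 * rem \<omega> i) summable_on idx"
    using assms good_rem[OF assms] unfolding good_def by (intro summable_on_add summable_on_cmult_right) auto
  fix i assume i: "i \<in> idx"
  let ?y = "w \<omega> (approx i 0)"
  have "\<bar>X \<omega> i - ?y\<bar>\<^sup>2 \<le> (2 * sqrt (rem \<omega> i / lam i))\<^sup>2"
    using X[OF assms i, of 0] by (intro power_mono) auto
  then have "(X \<omega> i - ?y)\<^sup>2 \<le> 4 * (rem \<omega> i / lam i)"
    using rem_nonneg[of \<omega> i] lam_pos[of i] by (simp add: power_mult_distrib)
  moreover have "(X \<omega> i)\<^sup>2 + (X \<omega> i - 2 * ?y)\<^sup>2 = 2 * ?y\<^sup>2 + 2 * (X \<omega> i - ?y)\<^sup>2"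
    by (simp add: power2_eq_square algebra_simps)
  ultimately have "(X \<omega> i)\<^sup>2 \<le> 2 * ?y\<^sup>2 + 8 * (rem \<omega> i / lam i)"
    using zero_le_power2[of "X \<omega> i - 2 * ?y"] by linarith
  then have "lam i * (X \<omega> i)\<^sup>2 \<le> lam i * (2 * ?y\<^sup>2 + 8 * (rem \<omega> i / lam i))"
    using lam_pos[of i] by (intro mult_left_mono) auto
  also have "\<dots> = 2 * (lam i * ?y\<^sup>2) + 8 * rem \<omega> i" using lam_pos[of i] by (simp add: distrib_left)
  finally show "lam i * (X \<omega> i)\<^sup>2 \<le> 2 * (lam i * ?y\<^sup>2) + 8 * rem \<omega> i" .
qed auto

text \<open>The squared decay rate of the wavelet coefficients of a test function,
  \<open>2 powr (- 2 * j * (u + d / 2))\<close>, divided by \<open>lam i\<close>. It is summable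
  because \<open>s < real u\<close>.\<close>

definition bnd :: "'d index \<Rightarrow> real" where
  "bnd i = 2 powr (- (2 * real u + real CARD('d) - 2 * s) * real (fst i))"

lemma summable_bnd: "bnd summable_on idx"
  unfolding bnd_def[abs_def] by (rule summable_on_idx) (use s in simp)

text \<open>Pure derivatives along the axes suffice, since \<open>coef_decay\<close> uses the
  moments in one coordinate at a time.\<close>

definition test_bound :: "(real^'d \<Rightarrow> real) \<Rightarrow> real \<Rightarrow> bool" where
  "test_bound \<phi> K \<longleftrightarrow> (\<forall>x. \<bar>\<phi> x\<bar> \<le> K) \<and> (\<forall>a x. \<bar>foldr partial_deriv (replicate u (axis a 1)) \<phi> x\<bar> \<le> K)"

text \<open>The coefficient decay equals \<open>sqrt (lam i) * sqrt (bnd i)\<close>, so a product of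
  two square roots is split into a random part, summable on \<open>good\<close>, and a deterministic
  one. The constant is uniform in \<open>\<omega>\<close> and linear in \<open>K\<close>, from which
  continuity in the test function follows.\<close>

lemma X_cf_bound:
  "\<exists>C\<ge>0. \<forall>\<omega> \<phi> K. \<forall>i\<in>idx. \<phi> \<in> torus_test \<longrightarrow> test_bound \<phi> K \<longrightarrow>
     \<bar>X \<omega> i * cf i \<phi>\<bar> \<le> C * K * (lam i * (X \<omega> i)\<^sup>2 + bnd i)"
proof -
  obtain C where C: "C \<ge> 0" and dec: "\<forall>\<phi>\<in>torus_test. \<forall>K. (\<forall>x. \<bar>\<phi> x\<bar> \<le> K) \<longrightarrow>
     (\<forall>a x. \<bar>foldr partial_deriv (replicate u (axis a 1)) \<phi> x\<bar> \<le> K) \<longrightarrow>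
     (\<forall>j G m. G \<in> wavelet_kinds j \<longrightarrow> \<bar>coef L j (G :: 'd \<Rightarrow> wavelet_kind) m \<phi>\<bar> \<le> C * K * 2 powr (- real j * (real u + real CARD('d) / 2)))"
    using coef_decay[OF u moments, where 'd='d and L=L] by blast
  have "\<bar>X \<omega> i * cf i \<phi>\<bar> \<le> C * K * (lam i * (X \<omega> i)\<^sup>2 + bnd i)"
    if \<phi>: "\<phi> \<in> torus_test" "test_bound \<phi> K" and i: "i \<in> idx" for \<omega> \<phi> K i
  proof -
    have K: "0 \<le> K" using \<phi>(2) abs_ge_zero order_trans unfolding test_bound_def by blast
    obtain j G m where ie: "i = (j, G, m)" by (cases i)
    have "G \<in> wavelet_kinds j" using i by (simp add: idx_def ie)
    then have b: "\<bar>cf i \<phi>\<bar> \<le> C * K * 2 powr (- real j * (real u + real CARD('d) / 2))"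
      using dec \<phi> unfolding test_bound_def cf_def ie by simp
    have eq: "sqrt (lam i) * sqrt (bnd i) = 2 powr (- real j * (real u + real CARD('d) / 2))"
    proof -
      have "lam i * bnd i = (2 powr (- real j * (real u + real CARD('d) / 2)))\<^sup>2"
        by (simp add: lam_def bnd_def ie power2_eq_square powr_add[symmetric]) (simp add: algebra_simps)
      then show ?thesis by (simp add: real_sqrt_mult[symmetric])
    qed
    let ?p = "sqrt (lam i) * \<bar>X \<omega> i\<bar>" and ?q = "sqrt (bnd i)"
    have "\<bar>X \<omega> i * cf i \<phi>\<bar> \<le> \<bar>X \<omega> i\<bar> * (C * K * (sqrt (lam i) * sqrt (bnd i)))"
      unfolding abs_mult eq by (rule mult_left_mono[OF b]) simp
    also have "\<dots> = C * K * (?p * ?q)" by simp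
    also have "\<dots> \<le> C * K * (?p\<^sup>2 + ?q\<^sup>2)"
    proof (rule mult_left_mono)
      have "0 \<le> (?p - ?q)\<^sup>2" "0 \<le> ?p\<^sup>2" "0 \<le> ?q\<^sup>2" by simp_all
      then show "?p * ?q \<le> ?p\<^sup>2 + ?q\<^sup>2" unfolding power2_diff by linarith
    qed (use C K in simp)
    also have "?p\<^sup>2 + ?q\<^sup>2 = lam i * (X \<omega> i)\<^sup>2 + bnd i"
      using lam_pos[of i] by (simp add: power_mult_distrib bnd_def)
    finally show ?thesis .
  qed
  then show ?thesis using C by blast
qed

end

section \<open>The almost sure expansion of the noise\<close>

context noise_wavelets begin

lemma good_has_sum:
  assumes g: "good \<omega>" and \<phi>: "\<phi> \<in> torus_test"
  shows "((\<lambda>i. X \<omega> i * cf i \<phi>) has_sum (\<Sum>\<^sub>\<infinity>i\<in>idx. X \<omega> i * cf i \<phi>)) idx"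
proof -
  obtain C where C: "C \<ge> 0" "\<And>\<omega> \<phi> K i. i \<in> idx \<Longrightarrow> \<phi> \<in> torus_test \<Longrightarrow> test_bound \<phi> K \<Longrightarrow>
     \<bar>X \<omega> i * cf i \<phi>\<bar> \<le> C * K * (lam i * (X \<omega> i)\<^sup>2 + bnd i)" using X_cf_bound by blast
  have "\<exists>K. test_bound \<phi> K"
  proof -
    have "\<exists>K. \<forall>x. \<bar>foldr partial_deriv (replicate u (axis a 1)) \<phi> x\<bar> \<le> K" for a
      by (intro torus_test_bounded torus_test_foldr[OF \<phi>]) auto
    then obtain K where K: "\<And>a x. \<bar>foldr partial_deriv (replicate u (axis a 1)) \<phi> x\<bar> \<le> K a" by metis
    obtain K0 where K0: "\<And>x. \<bar>\<phi> x\<bar> \<le> K0" using torus_test_bounded[OF \<phi>] by blast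
    have "\<bar>foldr partial_deriv (replicate u (axis a 1)) \<phi> x\<bar> \<le> Max (range K)" for a x
      by (rule order_trans[OF K Max_ge]) auto
    then show ?thesis unfolding test_bound_def using K0
      by (intro exI[of _ "max K0 (Max (range K))"]) (simp add: le_max_iff_disj)
  qed
  then obtain K where "test_bound \<phi> K" by blast
  have "(\<lambda>i. norm (X \<omega> i * cf i \<phi>)) summable_on idx"
  proof (rule summable_on_comparison_test)
    show "(\<lambda>i. C * K * (lam i * (X \<omega> i)\<^sup>2 + bnd i)) summable_on idx"
      by (intro summable_on_cmult_right summable_on_add summable_lam_X[OF g] summable_bnd)
  qed (use C(2)[OF _ \<phi> \<open>test_bound \<phi> K\<close>] in auto)
  then show ?thesis
    by (rule has_sum_infsum[OF summable_on_iff_abs_summable_on_real[THEN iffD2]])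
qed

lemma reconstruction_idx:
  assumes \<phi>: "\<phi> \<in> torus_test"
  shows "\<exists>N\<ge>k. \<forall>x\<in>cbox 0 1. \<bar>(\<Sum>i\<in>idx_upto N. cf i \<phi> * \<Psi> i x) - \<phi> x\<bar> < 1 / 2 ^ k"
proof -
  obtain n0 where "\<And>n x. n \<ge> n0 \<Longrightarrow> x \<in> cbox 0 1 \<Longrightarrow>
    \<bar>(\<Sum>j\<le>n. \<Sum>G\<in>wavelet_kinds j. \<Sum>m\<in>wavelet_shifts L j. coef L j G m \<phi> * periodic_wavelet F M L j G m x) - \<phi> x\<bar> < 1 / 2 ^ k"
    using reconstruction[OF \<phi>, of "1 / 2 ^ k" L] by auto
  then show ?thesis
    by (intro exI[of _ "max k n0"]) (simp add: sum_idx_upto cf_def \<Psi>_def)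
qed

text \<open>First \<open>N k\<close> makes a partial sum uniformly close to \<open>\<phi>\<close>,
  then \<open>n k\<close> makes the smooth replacements of its wavelets accurate. The remainders
  \<open>\<rho> k\<close> are test functions of size at most \<open>2 / 2 ^ k\<close> on the cube;
  their squared norms are summable, which forces \<open>w \<omega> (\<rho> k)\<close> to 0 almost
  surely.\<close>

lemma AE_reconstruction:
  assumes \<phi>: "\<phi> \<in> torus_test"
  shows "AE \<omega> in P. good \<omega> \<longrightarrow> (\<Sum>\<^sub>\<infinity>i\<in>idx. X \<omega> i * cf i \<phi>) = w \<omega> \<phi>"
proof -
  have "\<exists>N. \<forall>k. k \<le> N k \<and> (\<forall>x\<in>cbox 0 1. \<bar>(\<Sum>i\<in>idx_upto (N k). cf i \<phi> * \<Psi> i x) - \<phi> x\<bar> < 1 / 2 ^ k)"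
    by (intro choice allI) (use reconstruction_idx[OF \<phi>] in blast)
  then obtain N where N: "\<And>k. N k \<ge> k" "\<And>k x. x \<in> cbox 0 1 \<Longrightarrow> \<bar>(\<Sum>i\<in>idx_upto (N k). cf i \<phi> * \<Psi> i x) - \<phi> x\<bar> < 1 / 2 ^ k"
    by blast
  \<comment> \<open>One factor for two errors: the 1 covers the replacement of
    \<open>\<Psi> i\<close> by \<open>approx\<close>, and \<open>1 / sqrt (lam i)\<close> covers the
    distance of \<open>X \<omega> i\<close> from the noise at \<open>approx\<close>.\<close>
  define S where "S = (\<lambda>k. \<Sum>i\<in>idx_upto (N k). \<bar>cf i \<phi>\<bar> * (1 + 1 / sqrt (lam i)))"
  have S0: "0 \<le> S k" for k unfolding S_def by (intro sum_nonneg) simp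
  have "\<exists>n. S k / 2 ^ n < 1 / 2 ^ k" for k
  proof -
    have "(\<lambda>n. S k / 2 ^ n) \<longlonglongrightarrow> 0" by (rule LIMSEQ_divide_realpow_zero) simp
    then have "\<forall>\<^sub>F n in sequentially. S k / 2 ^ n < 1 / 2 ^ k" by (rule order_tendstoD) simp
    then show ?thesis using eventually_happens by force
  qed
  then obtain n where n: "\<And>k. S k / 2 ^ n k < 1 / 2 ^ k" by metis
  define \<rho> where "\<rho> = (\<lambda>k x. \<phi> x - (\<Sum>i\<in>idx_upto (N k). cf i \<phi> * approx i (n k) x))"
  have sum_test: "(\<lambda>x. \<Sum>i\<in>idx_upto (N k). cf i \<phi> * approx i (n k) x) \<in> torus_test" for k
    by (intro torus_test_sum torus_test_scale approx finite_idx_upto)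
  have \<rho>_test: "\<rho> k \<in> torus_test" for k
    unfolding \<rho>_def by (intro torus_test_diff \<phi> sum_test)
  have \<rho>_small: "\<bar>\<rho> k x\<bar> \<le> 2 / 2 ^ k" if x: "x \<in> cbox 0 1" for k x
  proof -
    have "\<bar>\<Sum>i\<in>idx_upto (N k). cf i \<phi> * (\<Psi> i x - approx i (n k) x)\<bar> \<le> (\<Sum>i\<in>idx_upto (N k). \<bar>cf i \<phi>\<bar> * (1 + 1 / sqrt (lam i)) * (1 / 2 ^ n k))"
    proof (rule order_trans[OF sum_abs sum_mono])
      fix i
      have "\<bar>\<Psi> i x - approx i (n k) x\<bar> \<le> 1 / 4 ^ Suc (n k)" using approx(2)[OF x, of i "n k"] by simp
      also have "\<dots> \<le> 1 / 2 ^ n k"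
      proof (rule divide_left_mono)
        have "(2::real) ^ n k \<le> 4 ^ n k" by (rule power_mono) auto
        moreover have "(0::real) \<le> 4 ^ n k" by simp
        ultimately show "(2::real) ^ n k \<le> 4 ^ Suc (n k)" unfolding power_Suc by linarith
      qed auto
      also have "\<dots> \<le> (1 + 1 / sqrt (lam i)) * (1 / 2 ^ n k)" by (intro mult_le_cancel_right1[THEN iffD2]) simp
      finally show "\<bar>cf i \<phi> * (\<Psi> i x - approx i (n k) x)\<bar> \<le> \<bar>cf i \<phi>\<bar> * (1 + 1 / sqrt (lam i)) * (1 / 2 ^ n k)"
        unfolding abs_mult mult.assoc by (rule mult_left_mono) simp
    qed
    also have "\<dots> = S k / 2 ^ n k" by (simp add: S_def sum_divide_distrib)
    also have "\<dots> < 1 / 2 ^ k" by (rule n)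
    finally have "\<bar>(\<Sum>i\<in>idx_upto (N k). cf i \<phi> * \<Psi> i x) - (\<Sum>i\<in>idx_upto (N k). cf i \<phi> * approx i (n k) x)\<bar> < 1 / 2 ^ k"
      by (simp add: right_diff_distrib sum_subtractf)
    then show ?thesis using N(2)[OF x, of k] unfolding \<rho>_def by linarith
  qed
  have "summable (\<lambda>k. cube_sq (\<rho> k))"
  proof (rule summable_comparison_test'[where N=0])
    show "summable (\<lambda>k. 4 * (1 / 4 :: real) ^ k)" by (intro summable_mult summable_geometric) simp
    fix k
    have "cube_sq (\<rho> k) \<le> (2 / 2 ^ k)\<^sup>2" by (rule cube_sq_le_const[OF \<rho>_small])
    also have "\<dots> = 4 * (1 / 4) ^ k"
    proof -
      have "(2 ^ k)\<^sup>2 = (4::real) ^ k" by (simp add: power2_eq_square flip: power_mult_distrib)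
      then show ?thesis by (simp add: power_divide)
    qed
    finally show "norm (cube_sq (\<rho> k)) \<le> 4 * (1 / 4) ^ k" using cube_sq_nonneg[of "\<rho> k"] by simp
  qed
  then have "AE \<omega> in P. summable (\<lambda>k. (w \<omega> (\<rho> k))\<^sup>2)" by (rule AE_summable_squares[OF \<rho>_test])
  then show ?thesis
  proof (rule AE_mp, intro AE_I2 impI)
    fix \<omega> assume \<omega>: "\<omega> \<in> space P" and sm: "summable (\<lambda>k. (w \<omega> (\<rho> k))\<^sup>2)" and g: "good \<omega>"
    define R where "R = infsum (rem \<omega>) idx"
    have remR: "rem \<omega> i \<le> R" if "i \<in> idx" for i
      using finite_sum_le_infsum[OF good_rem[OF g], of "{i}"] that rem_nonneg unfolding R_def by auto
    have "(\<lambda>k. sqrt ((w \<omega> (\<rho> k))\<^sup>2)) \<longlonglongrightarrow> sqrt 0"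
      by (intro tendsto_real_sqrt summable_LIMSEQ_zero sm)
    then have l1: "(\<lambda>k. w \<omega> (\<rho> k)) \<longlonglongrightarrow> 0" by (simp add: tendsto_rabs_zero_iff)
    have w\<rho>: "w \<omega> (\<rho> k) = w \<omega> \<phi> - (\<Sum>i\<in>idx_upto (N k). cf i \<phi> * w \<omega> (approx i (n k)))" for k
      unfolding \<rho>_def by (subst w_diff[OF \<omega> \<phi> sum_test], subst w_sum[OF \<omega> finite_idx_upto approx(1)]) simp
    have d: "\<bar>(\<Sum>i\<in>idx_upto (N k). X \<omega> i * cf i \<phi>) - (\<Sum>i\<in>idx_upto (N k). cf i \<phi> * w \<omega> (approx i (n k)))\<bar> \<le> 2 * sqrt R * (1 / 2 ^ k)" for k
    proof -
      have "\<bar>\<Sum>i\<in>idx_upto (N k). cf i \<phi> * (X \<omega> i - w \<omega> (approx i (n k)))\<bar>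
         \<le> (\<Sum>i\<in>idx_upto (N k). 2 * sqrt R * (\<bar>cf i \<phi>\<bar> * (1 + 1 / sqrt (lam i)) * (1 / 2 ^ n k)))"
      proof (rule order_trans[OF sum_abs sum_mono])
        fix i assume "i \<in> idx_upto (N k)"
        then have i: "i \<in> idx" using idx_upto_subset by blast
        have R0: "0 \<le> R" using remR[OF i] rem_nonneg[of \<omega> i] by linarith
        have "\<bar>X \<omega> i - w \<omega> (approx i (n k))\<bar> \<le> 2 * sqrt (rem \<omega> i / lam i) / 2 ^ n k" by (rule X[OF g i])
        also have "\<dots> = 2 * sqrt (rem \<omega> i) * (1 / sqrt (lam i)) * (1 / 2 ^ n k)" by (simp add: real_sqrt_divide)
        also have "\<dots> \<le> 2 * sqrt R * (1 + 1 / sqrt (lam i)) * (1 / 2 ^ n k)"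
          using remR[OF i] R0 rem_nonneg[of \<omega> i] by (intro mult_right_mono mult_mono) auto
        finally have "\<bar>cf i \<phi>\<bar> * \<bar>X \<omega> i - w \<omega> (approx i (n k))\<bar> \<le> \<bar>cf i \<phi>\<bar> * (2 * sqrt R * (1 + 1 / sqrt (lam i)) * (1 / 2 ^ n k))"
          by (rule mult_left_mono) simp
        then show "\<bar>cf i \<phi> * (X \<omega> i - w \<omega> (approx i (n k)))\<bar> \<le> 2 * sqrt R * (\<bar>cf i \<phi>\<bar> * (1 + 1 / sqrt (lam i)) * (1 / 2 ^ n k))"
          by (simp only: abs_mult mult_ac)
      qed
      also have "\<dots> = 2 * sqrt R * (S k / 2 ^ n k)" by (simp add: S_def sum_divide_distrib sum_distrib_left)
      also have "\<dots> \<le> 2 * sqrt R * (1 / 2 ^ k)"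
      proof (rule mult_left_mono[OF less_imp_le[OF n]])
        have "0 \<le> R" unfolding R_def by (rule infsum_nonneg) (rule rem_nonneg)
        then show "0 \<le> 2 * sqrt R" by simp
      qed
      finally show ?thesis by (simp add: right_diff_distrib sum_subtractf mult.commute)
    qed
    have "(\<lambda>k. 2 * sqrt R * (1 / 2 ^ k)) \<longlonglongrightarrow> 0"
      using LIMSEQ_divide_realpow_zero[of 2 "2 * sqrt R"] by simp
    then have l2: "(\<lambda>k. (\<Sum>i\<in>idx_upto (N k). X \<omega> i * cf i \<phi>) - (\<Sum>i\<in>idx_upto (N k). cf i \<phi> * w \<omega> (approx i (n k)))) \<longlonglongrightarrow> 0"
      by (rule Lim_null_comparison[rotated]) (use d in auto)
    have "(\<lambda>k. ((\<Sum>i\<in>idx_upto (N k). X \<omega> i * cf i \<phi>) - (\<Sum>i\<in>idx_upto (N k). cf i \<phi> * w \<omega> (approx i (n k)))) + (w \<omega> \<phi> - w \<omega> (\<rho> k))) \<longlonglongrightarrow> 0 + (w \<omega> \<phi> - 0)"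
      by (intro tendsto_add tendsto_diff l1 l2 tendsto_const)
    then have lim: "(\<lambda>k. \<Sum>i\<in>idx_upto (N k). X \<omega> i * cf i \<phi>) \<longlonglongrightarrow> w \<omega> \<phi>" by (simp add: w\<rho>)
    \<comment> \<open>Only a subsequence of partial sums is under control, but the series is known
      to converge, so this identifies its sum.\<close>
    have "filterlim N sequentially sequentially"
      using N(1) by (intro filterlim_at_top_mono[OF filterlim_ident]) auto
    then have "filterlim (\<lambda>k. idx_upto (N k)) (finite_subsets_at_top idx) sequentially"
      by (rule filterlim_compose[OF idx_upto_limit])
    then have "(\<lambda>k. \<Sum>i\<in>idx_upto (N k). X \<omega> i * cf i \<phi>) \<longlonglongrightarrow> (\<Sum>\<^sub>\<infinity>i\<in>idx. X \<omega> i * cf i \<phi>)"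
      by (rule filterlim_compose[OF good_has_sum[OF g \<phi>, unfolded has_sum_def]])
    then show "(\<Sum>\<^sub>\<infinity>i\<in>idx. X \<omega> i * cf i \<phi>) = w \<omega> \<phi>" using lim by (rule LIMSEQ_unique)
  qed
qed

text \<open>The difference of two series is the series of the difference, bounded by a multiple of
  any \<open>K\<close> that dominates finitely many derivatives of it.\<close>

lemma series_tendsto:
  assumes g: "good \<omega>" and \<phi>: "\<phi> \<in> torus_test" and \<psi>: "\<And>n. \<psi> n \<in> torus_test" and lim: "smooth_limit \<psi> \<phi>"
  shows "(\<lambda>n. \<Sum>\<^sub>\<infinity>i\<in>idx. X \<omega> i * cf i (\<psi> n)) \<longlonglongrightarrow> (\<Sum>\<^sub>\<infinity>i\<in>idx. X \<omega> i * cf i \<phi>)"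
proof -
  let ?T = "\<lambda>\<phi>. \<Sum>\<^sub>\<infinity>i\<in>idx. X \<omega> i * cf i \<phi>"
  obtain C where C: "C \<ge> 0" "\<And>\<omega> \<phi> K i. i \<in> idx \<Longrightarrow> \<phi> \<in> torus_test \<Longrightarrow> test_bound \<phi> K \<Longrightarrow>
     \<bar>X \<omega> i * cf i \<phi>\<bar> \<le> C * K * (lam i * (X \<omega> i)\<^sup>2 + bnd i)" using X_cf_bound by blast
  define Z where "Z = infsum (\<lambda>i. lam i * (X \<omega> i)\<^sup>2 + bnd i) idx"
  have sZ: "(\<lambda>i. lam i * (X \<omega> i)\<^sup>2 + bnd i) summable_on idx"
    by (intro summable_on_add summable_lam_X[OF g] summable_bnd)
  have Z: "0 \<le> Z" unfolding Z_def by (rule infsum_nonneg) (auto simp: bnd_def)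
  have bound: "\<bar>?T (\<psi> n) - ?T \<phi>\<bar> \<le> C * K * Z" if K: "test_bound (\<lambda>x. \<psi> n x - \<phi> x) K" for n K
  proof -
    have t: "(\<lambda>x. \<psi> n x - \<phi> x) \<in> torus_test" by (intro torus_test_diff \<psi> \<phi>)
    have "cf i (\<lambda>x. \<psi> n x - \<phi> x) = cf i (\<psi> n) - cf i \<phi>" for i
      unfolding cf_eq right_diff_distrib
      by (intro set_integral_diff integrable_cube continuous_intros \<Psi>_continuous torus_test_continuous \<psi> \<phi>)
    then have "((\<lambda>i. X \<omega> i * cf i (\<lambda>x. \<psi> n x - \<phi> x)) has_sum (?T (\<psi> n) - ?T \<phi>)) idx"
      using has_sum_add[OF good_has_sum[OF g \<psi>, of n] has_sum_cmult_right[OF good_has_sum[OF g \<phi>], of "-1"]]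
      by (simp add: right_diff_distrib)
    moreover have "((\<lambda>i. C * K * (lam i * (X \<omega> i)\<^sup>2 + bnd i)) has_sum C * K * Z) idx"
      unfolding Z_def by (rule has_sum_cmult_right[OF has_sum_infsum[OF sZ]])
    ultimately have "norm (?T (\<psi> n) - ?T \<phi>) \<le> C * K * Z"
      by (rule norm_infsum_le) (use C(2)[OF _ t K] in auto)
    then show ?thesis by simp
  qed
  show ?thesis
  proof (rule LIMSEQ_I)
    fix e :: real assume e: "0 < e"
    define K where "K = e / (C * Z + 1)"
    have CZ: "0 < C * Z + 1" using C(1) Z by (simp add: add_nonneg_pos)
    have K: "0 < K" unfolding K_def using e CZ by simp
    have ev: "\<forall>\<^sub>F n in sequentially. \<forall>x. \<bar>foldr partial_deriv bs (\<psi> n) x - foldr partial_deriv bs \<phi> x\<bar> < K"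
      if "set bs \<subseteq> Basis" for bs
      using lim that K unfolding smooth_limit_def uniform_limit_iff dist_real_def by auto
    have e2: "\<forall>\<^sub>F n in sequentially. \<forall>a\<in>(UNIV::'d set). \<forall>x. \<bar>foldr partial_deriv (replicate u (axis a 1)) (\<psi> n) x - foldr partial_deriv (replicate u (axis a 1)) \<phi> x\<bar> < K"
      by (intro eventually_ball_finite ballI ev) auto
    have e1: "\<forall>\<^sub>F n in sequentially. \<forall>x. \<bar>\<psi> n x - \<phi> x\<bar> < K" using ev[of "[]"] by simp
    from e1 e2 have "\<forall>\<^sub>F n in sequentially. test_bound (\<lambda>x. \<psi> n x - \<phi> x) K"
    proof eventually_elim
      case (elim n)
      have eq: "foldr partial_deriv (replicate u (axis a 1)) (\<lambda>x. \<psi> n x - \<phi> x)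
        = (\<lambda>x. foldr partial_deriv (replicate u (axis a 1)) (\<psi> n) x - foldr partial_deriv (replicate u (axis a 1)) \<phi> x)" for a :: 'd
        by (rule foldr_partial_deriv_diff[OF \<psi> \<phi>]) auto
      show "test_bound (\<lambda>x. \<psi> n x - \<phi> x) K"
        unfolding test_bound_def eq using elim by (intro conjI allI less_imp_le) blast+
    qed
    then obtain n0 where n0: "\<And>n. n \<ge> n0 \<Longrightarrow> test_bound (\<lambda>x. \<psi> n x - \<phi> x) K"
      unfolding eventually_sequentially by blast
    have "C * K * Z < e"
    proof -
      have "C * K * Z = K * (C * Z)" by simp
      also have "\<dots> < K * (C * Z + 1)" using K by simp
      also have "\<dots> = e" unfolding K_def using CZ by simp
      finally show ?thesis .
    qed
    then show "\<exists>n0. \<forall>n\<ge>n0. norm (?T (\<psi> n) - ?T \<phi>) < e"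
      using bound[OF n0] by (intro exI[of _ n0]) (auto intro: order_le_less_trans)
  qed
qed

lemma AE_expansion:
  "AE \<omega> in P. good \<omega> \<and> (\<forall>\<phi>\<in>torus_test. ((\<lambda>i. X \<omega> i * cf i \<phi>) has_sum w \<omega> \<phi>) idx)"
proof -
  obtain D :: "(real^'d \<Rightarrow> real) set" where D: "countable D" "D \<subseteq> torus_test"
    and dense: "\<And>\<phi>. \<phi> \<in> torus_test \<Longrightarrow> \<exists>\<psi>. range \<psi> \<subseteq> D \<and> smooth_limit \<psi> \<phi>"
    using torus_test_separable by blast
  have "AE \<omega> in P. \<forall>\<phi>\<in>D. good \<omega> \<longrightarrow> (\<Sum>\<^sub>\<infinity>i\<in>idx. X \<omega> i * cf i \<phi>) = w \<omega> \<phi>"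
    unfolding AE_ball_countable[OF D(1)] using AE_reconstruction D(2) by blast
  with AE_good show ?thesis
  proof (rule AE_mp[OF AE_conjI], intro AE_I2 impI conjI ballI)
    fix \<omega> and \<phi> :: "real^'d \<Rightarrow> real" assume \<omega>: "\<omega> \<in> space P" and h: "good \<omega> \<and> (\<forall>\<phi>\<in>D. good \<omega> \<longrightarrow> (\<Sum>\<^sub>\<infinity>i\<in>idx. X \<omega> i * cf i \<phi>) = w \<omega> \<phi>)"
      and \<phi>: "\<phi> \<in> torus_test"
    obtain \<psi> where \<psi>: "range \<psi> \<subseteq> D" "smooth_limit \<psi> \<phi>" using dense[OF \<phi>] by blast
    have t: "\<psi> n \<in> torus_test" for n using \<psi>(1) D(2) by blast
    have "(\<lambda>n. \<Sum>\<^sub>\<infinity>i\<in>idx. X \<omega> i * cf i (\<psi> n)) \<longlonglongrightarrow> (\<Sum>\<^sub>\<infinity>i\<in>idx. X \<omega> i * cf i \<phi>)"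
      by (rule series_tendsto[OF _ \<phi> t \<psi>(2)]) (use h in simp)
    moreover have "(\<Sum>\<^sub>\<infinity>i\<in>idx. X \<omega> i * cf i (\<psi> n)) = w \<omega> (\<psi> n)" for n using h \<psi>(1) by blast
    moreover have "(\<lambda>n. w \<omega> (\<psi> n)) \<longlonglongrightarrow> w \<omega> \<phi>" by (rule torus_dual_tendsto[OF w_dual[OF \<omega>] \<phi> t \<psi>(2)])
    ultimately have "(\<Sum>\<^sub>\<infinity>i\<in>idx. X \<omega> i * cf i \<phi>) = w \<omega> \<phi>" using LIMSEQ_unique by simp
    then show "((\<lambda>i. X \<omega> i * cf i \<phi>) has_sum w \<omega> \<phi>) idx" using good_has_sum[of \<omega> \<phi>] h \<phi> by simp
  qed simp
qed

end

section \<open>Besov norms\<close>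

lemma recip_finite: assumes "0 < p" "p \<noteq> \<infinity>" shows "0 < enn2real p" "recip p = 1 / enn2real p"
proof -
  show r: "0 < enn2real p" using assms by (simp add: enn2real_positive_iff top.not_eq_extremum)
  have "p = ennreal (enn2real p)" using assms by (simp add: ennreal_enn2real_if)
  then have "inverse p = ennreal (inverse (enn2real p))" using inverse_ennreal[OF r] by metis
  then show "recip p = 1 / enn2real p" unfolding recip_def using r by (simp add: divide_inverse)
qed

lemma recip_top: "recip \<top> = 0"
  by (simp add: recip_def)

lemma recip_max_2:
  assumes "0 < p"
  shows "recip (max p 2) = min (recip p) (1 / 2)"
proof (cases "p = \<infinity>")
  case True
  then have "max p 2 = \<top>" by (simp add: max_absorb1)
  then show ?thesis using True by (simp add: recip_top)
next
  case False
  have two: "recip 2 = 1 / 2" using recip_finite(2)[of 2] by simp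
  have p: "p = ennreal (enn2real p)" using False by (simp add: ennreal_enn2real_if)
  note r = recip_finite[OF assms False]
  have le: "p \<le> 2 \<longleftrightarrow> enn2real p \<le> 2"
    by (subst p) (metis ennreal_le_iff ennreal_numeral zero_le_numeral)
  show ?thesis
  proof (cases "p \<le> 2")
    case True
    then have "1 / 2 \<le> 1 / enn2real p" using r le by (intro divide_left_mono) auto
    then show ?thesis using True r(2) by (simp add: two max_absorb2)
  next
    case False
    then have "max p 2 = p" by (simp add: max_def)
    moreover have "1 / enn2real p \<le> 1 / 2" using False le r by (intro divide_left_mono) auto
    ultimately show ?thesis using r(2) by simp
  qed
qed

text \<open>Every entry is at most \<open>T\<close>, so an r-th power with r >= 2 is at most
  \<open>T powr (r - 2)\<close> times the square.\<close>

lemma lp_norm_le_l2: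
  assumes A: "finite A" "A \<noteq> {}" and p: "2 \<le> p" and S: "(\<Sum>i\<in>A. (cmod (x i))\<^sup>2) \<le> T\<^sup>2" and T: "0 < T"
  shows "lp_norm p A x \<le> T"
proof -
  have le: "cmod (x i) \<le> T" if "i \<in> A" for i
  proof -
    have "(cmod (x i))\<^sup>2 \<le> T\<^sup>2" using member_le_sum[of i A "\<lambda>i. (cmod (x i))\<^sup>2"] A that S by auto
    then show ?thesis using T by (simp add: abs_le_square_iff[symmetric])
  qed
  show ?thesis
  proof (cases "p = \<infinity>")
    case True
    then show ?thesis unfolding lp_norm_def using A le by simp
  next
    case False
    define r where "r = enn2real p"
    have p0: "0 < p" using p by (simp add: order_less_le_trans[of 0 2])
    have r: "0 < r" "recip p = 1 / r" using recip_finite[OF p0 False] by (simp_all add: r_def)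
    have r2: "2 \<le> r"
      using p False unfolding r_def by (metis ennreal_enn2real_if ennreal_le_iff ennreal_numeral enn2real_nonneg infinity_ennreal_def)
    have pw: "cmod (x i) powr r \<le> T powr (r - 2) * (cmod (x i))\<^sup>2" if "i \<in> A" for i
    proof (cases "x i = 0")
      case False
      have "cmod (x i) powr r = cmod (x i) powr ((r - 2) + 2)" by simp
      also have "\<dots> = cmod (x i) powr (r - 2) * cmod (x i) powr 2" by (rule powr_add)
      also have "\<dots> \<le> T powr (r - 2) * cmod (x i) powr 2"
        using le[OF that] r2 by (intro mult_right_mono powr_mono2) auto
      finally show ?thesis using False by simp
    qed (use r in simp)
    have "(\<Sum>i\<in>A. cmod (x i) powr r) \<le> (\<Sum>i\<in>A. T powr (r - 2) * (cmod (x i))\<^sup>2)" by (rule sum_mono[OF pw])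
    also have "\<dots> = T powr (r - 2) * (\<Sum>i\<in>A. (cmod (x i))\<^sup>2)" by (simp add: sum_distrib_left)
    also have "\<dots> \<le> T powr (r - 2) * T\<^sup>2" by (rule mult_left_mono[OF S]) simp
    also have "\<dots> = T powr r" using T by (simp add: powr_diff)
    finally have "(\<Sum>i\<in>A. cmod (x i) powr r) powr (1 / r) \<le> (T powr r) powr (1 / r)"
      using r by (intro powr_mono2) (auto intro: sum_nonneg)
    then show ?thesis using False r T by (simp add: lp_norm_def r_def[symmetric] powr_powr)
  qed
qed

text \<open>With \<open>l\<close> of the size of the root mean square of \<open>x\<close>, this is Hoelder's inequality up to
  a constant; it follows from \<open>t powr r \<le> l powr r + l powr (r - 2) * t\<^sup>2\<close>.\<close>

lemma lp_norm_le_below_2: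
  assumes A: "finite A" and p: "0 < p" "p < 2" and l: "0 < l"
    and S: "(\<Sum>i\<in>A. (cmod (x i))\<^sup>2) \<le> K * N * l\<^sup>2" and N: "real (card A) \<le> K * N" and K: "0 \<le> K" "0 < N"
  shows "lp_norm p A x \<le> (2 * K) powr recip p * N powr recip p * l"
proof -
  have fin: "p \<noteq> \<infinity>" using p by auto
  define r where "r = enn2real p"
  have r: "0 < r" "recip p = 1 / r" using recip_finite[OF p(1) fin] by (simp_all add: r_def)
  have r2: "r < 2"
    using p fin unfolding r_def by (metis ennreal_enn2real_if ennreal_less_iff ennreal_numeral enn2real_nonneg infinity_ennreal_def)
  have pw: "t powr r \<le> l powr r + l powr (r - 2) * t\<^sup>2" if "0 \<le> t" for t
  proof (cases "t \<le> l")
    case True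
    then have "t powr r \<le> l powr r" using that r by (intro powr_mono2) auto
    moreover have "0 \<le> l powr (r - 2) * t\<^sup>2" by simp
    ultimately show ?thesis by linarith
  next
    case False
    have "t powr r = t powr (r - 2) * t powr 2" by (simp flip: powr_add)
    also have "\<dots> \<le> l powr (r - 2) * t powr 2"
      using False l r2 by (intro mult_right_mono powr_mono2') auto
    also have "t powr 2 = t\<^sup>2" using False l by simp
    finally show ?thesis by (simp add: add_increasing)
  qed
  have "(\<Sum>i\<in>A. cmod (x i) powr r) \<le> (\<Sum>i\<in>A. l powr r + l powr (r - 2) * (cmod (x i))\<^sup>2)"
    by (rule sum_mono) (rule pw, simp)
  also have "\<dots> = real (card A) * l powr r + l powr (r - 2) * (\<Sum>i\<in>A. (cmod (x i))\<^sup>2)"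
    by (simp add: sum.distrib sum_distrib_left)
  also have "\<dots> \<le> K * N * l powr r + l powr (r - 2) * (K * N * l\<^sup>2)"
    by (intro add_mono mult_right_mono mult_left_mono N S) auto
  also have "\<dots> = 2 * K * N * l powr r" using l by (simp add: powr_diff)
  finally have "(\<Sum>i\<in>A. cmod (x i) powr r) powr (1 / r) \<le> (2 * K * N * l powr r) powr (1 / r)"
    using r by (intro powr_mono2) (auto intro: sum_nonneg)
  also have "\<dots> = (2 * K) powr (1 / r) * N powr (1 / r) * l"
    using l K r by (simp add: powr_mult powr_powr)
  finally show ?thesis using fin r by (simp add: lp_norm_def r_def[symmetric])
qed

text \<open>Strictness of the bound on \<open>\<tau>\<close> supplies \<open>\<kappa> > 0\<close>;
  geometric decay over the levels is then summable for every outer exponent, and the kinds cost only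
  their number.\<close>

lemma besov_seq_norm_finite:
  fixes c :: "nat \<Rightarrow> ('d::finite \<Rightarrow> wavelet_kind) \<Rightarrow> int^'d \<Rightarrow> complex"
  assumes q: "0 < q" and C: "0 \<le> C" and \<kappa>: "0 < \<kappa>"
    and b: "\<And>j G. G \<in> wavelet_kinds j \<Longrightarrow> 2 powr (real j * (\<tau> - real CARD('d) * recip p)) * lp_norm p (wavelet_shifts L j) (c j G) \<le> C * 2 powr (- \<kappa> * real j)"
  shows "besov_seq_norm L \<tau> p q c < \<infinity>"
proof -
  define a where "a = \<tau> - real CARD('d) * recip p"
  have lp0: "0 \<le> lp_norm p (wavelet_shifts L j) (c j G)" for j G
  proof (cases "p = \<infinity>")
    case True
    have "(0 :: int^'d) \<in> wavelet_shifts L j" by (simp add: wavelet_shifts_def)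
    then have "cmod (c j G 0) \<le> Max ((\<lambda>i. cmod (c j G i)) ` wavelet_shifts L j)"
      by (intro Max_ge) (auto simp: wavelet_shifts)
    from order_trans[OF norm_ge_zero this] show ?thesis using True by (simp add: lp_norm_def)
  qed (simp add: lp_norm_def)
  show ?thesis
  proof (cases "q = \<infinity>")
    case True
    have "2 powr (real j * a) * lp_norm p (wavelet_shifts L j) (c j G) \<le> C" if "G \<in> wavelet_kinds j" for j G
    proof -
      have "2 powr (- \<kappa> * real j) \<le> 2 powr 0" using \<kappa> by (intro powr_mono) auto
      then have "C * 2 powr (- \<kappa> * real j) \<le> C * 1" using C by (intro mult_left_mono) auto
      then show ?thesis using b[OF that] by (simp add: a_def)
    qed
    then have "(SUP j. SUP G\<in>wavelet_kinds j. ennreal (2 powr (real j * a) * lp_norm p (wavelet_shifts L j) (c j G))) \<le> ennreal C"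
      by (intro SUP_least ennreal_leI)
    then have "besov_seq_norm L \<tau> p q c \<le> ennreal C"
      using True by (simp only: besov_seq_norm_def Let_def a_def refl if_True)
    also have "\<dots> < \<infinity>" by simp
    finally show ?thesis .
  next
    case False
    define r where "r = enn2real q"
    have r: "0 < r" using recip_finite[OF q False] by (simp add: r_def)
    let ?s = "\<lambda>j. 2 powr (real j * a * r) * (\<Sum>G\<in>wavelet_kinds j. lp_norm p (wavelet_shifts L j) (c j G) powr r)"
    let ?K = "real CARD('d \<Rightarrow> wavelet_kind)"
    have le: "?s j \<le> ?K * C powr r * (2 powr (- \<kappa> * r)) ^ j" for j
    proof -
      have "?s j = (\<Sum>G\<in>wavelet_kinds j. (2 powr (real j * a) * lp_norm p (wavelet_shifts L j) (c j G)) powr r)"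
        using lp0 by (simp add: sum_distrib_left powr_mult powr_powr)
      also have "\<dots> \<le> (\<Sum>G\<in>(wavelet_kinds j :: ('d \<Rightarrow> wavelet_kind) set). (C * 2 powr (- \<kappa> * real j)) powr r)"
        using b lp0 r unfolding a_def by (intro sum_mono powr_mono2) auto
      also have "\<dots> = real (card (wavelet_kinds j :: ('d \<Rightarrow> wavelet_kind) set)) * (C * 2 powr (- \<kappa> * real j)) powr r" by simp
      also have "\<dots> \<le> ?K * (C * 2 powr (- \<kappa> * real j)) powr r"
        by (intro mult_right_mono of_nat_mono card_mono) auto
      also have "(C * 2 powr (- \<kappa> * real j)) powr r = C powr r * (2 powr (- \<kappa> * r)) ^ j"
        using C by (simp add: powr_mult powr_powr powr_power mult_ac)
      finally show ?thesis by (simp add: mult.assoc)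
    qed
    have sm: "summable (\<lambda>j. ?K * C powr r * (2 powr (- \<kappa> * r)) ^ j)"
    proof (intro summable_mult summable_geometric)
      have "2 powr (- \<kappa> * r) < 2 powr 0" using \<kappa> r by (intro powr_less_mono) auto
      then show "norm (2 powr (- \<kappa> * r)) < 1" by simp
    qed
    have s0: "0 \<le> ?s j" for j by (intro mult_nonneg_nonneg sum_nonneg) auto
    have "summable ?s"
      by (rule summable_comparison_test'[OF sm, of 0]) (simp only: real_norm_def abs_of_nonneg[OF s0] le)
    then have "(\<Sum>j. ennreal (?s j)) \<noteq> \<infinity>"
      using suminf_ennreal2[OF s0] by simp
    then show ?thesis
      unfolding besov_seq_norm_def Let_def a_def[symmetric] r_def[symmetric] using False by simp
  qed
qed

context noise_wavelets begin

text \<open>The factor in front of \<open>X\<close> undoes the normalization in the Besov expansion.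
  At level \<open>j\<close> there are about \<open>2 powr (d * j)\<close> coefficients of root mean
  square about \<open>2 powr (s * j)\<close>: for \<open>p \<ge> 2\<close> their l_2 norm dominates
  the l_p norm, for \<open>p < 2\<close> Hoelder's inequality is used.\<close>

lemma good_imp_besov:
  assumes g: "good \<omega>" and p: "0 < p" and q: "0 < q"
    and \<tau>: "\<tau> + s < real CARD('d) * (min (recip p) (1 / 2) - 1 / 2)"
  shows "besov_seq_norm L \<tau> p q (\<lambda>j G m. of_real (2 powr (real (j + L) * real CARD('d) / 2) * X \<omega> (j, G, m))) < \<infinity>"
proof -
  define d where "d = real CARD('d)"
  define c where "c = (\<lambda>j G m. complex_of_real (2 powr (real (j + L) * d / 2) * X \<omega> (j, G, m)))"
  \<comment> \<open>Adding 1 gives \<open>T \<ge> 1\<close>, so that the same constant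
    \<open>K\<close> also bounds the number of shifts.\<close>
  define T where "T = infsum (\<lambda>i. lam i * (X \<omega> i)\<^sup>2) idx + 1"
  have T: "T \<ge> 1" unfolding T_def by (simp add: infsum_nonneg)
  have sum: "(\<Sum>m\<in>wavelet_shifts L j. (cmod (c j G m))\<^sup>2) \<le> T * 2 powr (real L * d) * 2 powr (d * real j) * (2 powr (s * real j))\<^sup>2"
    if G: "G \<in> wavelet_kinds j" for j G
  proof -
    have "(\<Sum>m\<in>wavelet_shifts L j. lam (j, G, m) * (X \<omega> (j, G, m))\<^sup>2) = (\<Sum>i\<in>(\<lambda>m. (j, G, m)) ` wavelet_shifts L j. lam i * (X \<omega> i)\<^sup>2)"
      by (subst sum.reindex) (auto simp: inj_on_def)
    also have "\<dots> \<le> infsum (\<lambda>i. lam i * (X \<omega> i)\<^sup>2) idx"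
      by (rule finite_sum_le_infsum[OF summable_lam_X[OF g]]) (use G in \<open>auto simp: wavelet_shifts idx_def\<close>)
    also have "\<dots> \<le> T" by (simp add: T_def)
    finally have "2 powr (- (2 * s) * real j) * (\<Sum>m\<in>wavelet_shifts L j. (X \<omega> (j, G, m))\<^sup>2) \<le> T"
      by (simp add: lam_def sum_distrib_left)
    then have "2 powr (2 * s * real j) * (2 powr (- (2 * s) * real j) * (\<Sum>m\<in>wavelet_shifts L j. (X \<omega> (j, G, m))\<^sup>2)) \<le> 2 powr (2 * s * real j) * T"
      by (rule mult_left_mono) simp
    moreover have "2 powr (2 * s * real j) * (2 powr (- (2 * s) * real j) * y) = y" for y :: real
      unfolding mult.assoc[symmetric] powr_add[symmetric] by simp
    ultimately have le: "(\<Sum>m\<in>wavelet_shifts L j. (X \<omega> (j, G, m))\<^sup>2) \<le> 2 powr (2 * s * real j) * T" by (simp only:)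
    have sq: "(2 powr (real (j + L) * d / 2))\<^sup>2 = 2 powr (real L * d) * 2 powr (d * real j)"
      by (simp add: power2_eq_square powr_add[symmetric]) (simp add: algebra_simps)
    have "(\<Sum>m\<in>wavelet_shifts L j. (cmod (c j G m))\<^sup>2) = (2 powr (real (j + L) * d / 2))\<^sup>2 * (\<Sum>m\<in>wavelet_shifts L j. (X \<omega> (j, G, m))\<^sup>2)"
      unfolding c_def norm_of_real power2_abs power_mult_distrib sum_distrib_left ..
    also have "\<dots> \<le> (2 powr (real (j + L) * d / 2))\<^sup>2 * (2 powr (2 * s * real j) * T)"
      by (rule mult_left_mono[OF le]) simp
    also have "2 powr (2 * s * real j) = (2 powr (s * real j))\<^sup>2"
      by (simp add: power2_eq_square powr_add[symmetric] mult.assoc)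
    finally show ?thesis unfolding sq by (simp add: mult_ac)
  qed
  define K where "K = T * 2 powr (real L * d)"
  have K: "0 < K" using T by (simp add: K_def)
  have ne: "finite (wavelet_shifts L j :: (int^'d) set)" "(wavelet_shifts L j :: (int^'d) set) \<noteq> {}" for j
  proof -
    have "(0 :: int^'d) \<in> wavelet_shifts L j" by (simp add: wavelet_shifts_def)
    then show "(wavelet_shifts L j :: (int^'d) set) \<noteq> {}" by blast
  qed (rule wavelet_shifts)
  have "\<exists>C \<kappa>. 0 \<le> C \<and> 0 < \<kappa> \<and> (\<forall>j. \<forall>G\<in>wavelet_kinds j. 2 powr (real j * (\<tau> - d * recip p)) * lp_norm p (wavelet_shifts L j) (c j G) \<le> C * 2 powr (- \<kappa> * real j))"
  proof (cases "2 \<le> p")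
    case True
    then have "recip p \<le> 1 / 2" using recip_max_2[OF p] by (simp add: max_def min_def split: if_splits)
    then have \<kappa>: "0 < - (\<tau> - d * recip p + d / 2 + s)" using \<tau> by (simp add: d_def algebra_simps)
    show ?thesis
    \<comment> \<open>The decay rate is the Besov weight \<open>d * recip p - \<tau>\<close> minus
      the growth \<open>d / 2 + s\<close> of the l_2 norm.\<close>
    proof (rule exI[of _ "sqrt K"], rule exI[of _ "- (\<tau> - d * recip p + d / 2 + s)"], intro conjI allI ballI \<kappa>)
      fix j G assume G: "G \<in> (wavelet_kinds j :: ('d \<Rightarrow> wavelet_kind) set)"
      have "lp_norm p (wavelet_shifts L j) (c j G) \<le> sqrt K * 2 powr ((d / 2 + s) * real j)"
      proof (rule lp_norm_le_l2[OF ne True])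
        have "(2 powr ((d / 2 + s) * real j))\<^sup>2 = 2 powr (d * real j) * (2 powr (s * real j))\<^sup>2"
          by (simp add: power2_eq_square powr_add[symmetric]) (simp add: algebra_simps)
        then show "(\<Sum>i\<in>wavelet_shifts L j. (cmod (c j G i))\<^sup>2) \<le> (sqrt K * 2 powr ((d / 2 + s) * real j))\<^sup>2"
          using sum[OF G] K unfolding power_mult_distrib by (simp add: K_def mult.assoc)
      qed (use K in simp)
      then have "2 powr (real j * (\<tau> - d * recip p)) * lp_norm p (wavelet_shifts L j) (c j G) \<le> 2 powr (real j * (\<tau> - d * recip p)) * (sqrt K * 2 powr ((d / 2 + s) * real j))"
        by (rule mult_left_mono) simp
      also have "\<dots> = sqrt K * (2 powr (real j * (\<tau> - d * recip p)) * 2 powr ((d / 2 + s) * real j))" by simp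
      also have "2 powr (real j * (\<tau> - d * recip p)) * 2 powr ((d / 2 + s) * real j) = 2 powr (- (- (\<tau> - d * recip p + d / 2 + s)) * real j)"
        unfolding powr_add[symmetric] by (rule arg_cong[where f="\<lambda>x. 2 powr x"]) (simp add: algebra_simps)
      finally show "2 powr (real j * (\<tau> - d * recip p)) * lp_norm p (wavelet_shifts L j) (c j G) \<le> sqrt K * 2 powr (- (- (\<tau> - d * recip p + d / 2 + s)) * real j)" .
    qed (use K in simp)
  next
    case False
    then have p2: "p < 2" by simp
    have "recip p \<ge> 1 / 2" using recip_max_2[OF p] p2 recip_finite(2)[of 2] by (simp add: max_def min_def split: if_splits)
    then have "min (recip p) (1 / 2) = 1 / 2" by simp
    then have \<kappa>: "0 < - (\<tau> + s)" using \<tau> by simp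
    show ?thesis
    \<comment> \<open>The cardinality factor \<open>2 powr (d * j * recip p)\<close> from Hoelder's
      inequality cancels the term with \<open>recip p\<close> in the Besov weight, leaving
      \<open>\<tau> + s\<close>.\<close>
    proof (rule exI[of _ "(2 * K) powr recip p"], rule exI[of _ "- (\<tau> + s)"], intro conjI allI ballI \<kappa>)
      fix j G assume G: "G \<in> (wavelet_kinds j :: ('d \<Rightarrow> wavelet_kind) set)"
      have "lp_norm p (wavelet_shifts L j) (c j G) \<le> (2 * K) powr recip p * (2 powr (d * real j)) powr recip p * 2 powr (s * real j)"
      proof (rule lp_norm_le_below_2[OF ne(1) p p2])
        show "(\<Sum>i\<in>wavelet_shifts L j. (cmod (c j G i))\<^sup>2) \<le> K * 2 powr (d * real j) * (2 powr (s * real j))\<^sup>2"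
          using sum[OF G] by (simp add: K_def)
        have "real (card (wavelet_shifts L j :: (int^'d) set)) = 2 powr (real L * d) * 2 powr (d * real j)"
          unfolding wavelet_shifts by (simp add: d_def powr_realpow[symmetric] powr_add[symmetric] algebra_simps)
        also have "\<dots> \<le> T * (2 powr (real L * d) * 2 powr (d * real j))" using mult_right_mono[OF T, of "2 powr (real L * d) * 2 powr (d * real j)"] by simp
        finally show "real (card (wavelet_shifts L j :: (int^'d) set)) \<le> K * 2 powr (d * real j)" by (simp add: K_def mult.assoc)
      qed (use K in auto)
      then have "2 powr (real j * (\<tau> - d * recip p)) * lp_norm p (wavelet_shifts L j) (c j G) \<le> 2 powr (real j * (\<tau> - d * recip p)) * ((2 * K) powr recip p * (2 powr (d * real j)) powr recip p * 2 powr (s * real j))"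
        by (rule mult_left_mono) simp
      also have "\<dots> = (2 * K) powr recip p * (2 powr (real j * (\<tau> - d * recip p)) * 2 powr (d * real j * recip p) * 2 powr (s * real j))"
        by (simp add: powr_powr)
      also have "2 powr (real j * (\<tau> - d * recip p)) * 2 powr (d * real j * recip p) * 2 powr (s * real j) = 2 powr (- (- (\<tau> + s)) * real j)"
        unfolding powr_add[symmetric] by (rule arg_cong[where f="\<lambda>x. 2 powr x"]) (simp add: algebra_simps)
      finally show "2 powr (real j * (\<tau> - d * recip p)) * lp_norm p (wavelet_shifts L j) (c j G) \<le> (2 * K) powr recip p * 2 powr (- (- (\<tau> + s)) * real j)" .
    qed simp
  qed
  then obtain C \<kappa> where "C \<ge> 0" "\<kappa> > 0" "\<And>j G. G \<in> wavelet_kinds j \<Longrightarrow> 2 powr (real j * (\<tau> - d * recip p)) * lp_norm p (wavelet_shifts L j) (c j G) \<le> C * 2 powr (- \<kappa> * real j)"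
    by blast
  then have "besov_seq_norm L \<tau> p q c < \<infinity>" unfolding d_def by (intro besov_seq_norm_finite[OF q])
  then show ?thesis unfolding c_def d_def .
qed

lemma AE_in_besov_space:
  assumes p: "0 < p" and q: "0 < q"
    and \<tau>: "\<tau> + s < real CARD('d) * (min (recip p) (1 / 2) - 1 / 2)"
  shows "AE \<omega> in P. w \<omega> \<in> besov_space F M L \<tau> p q"
  using AE_expansion
proof (rule AE_mp, intro AE_I2 impI)
  fix \<omega> assume \<omega>: "\<omega> \<in> space P" and h: "good \<omega> \<and> (\<forall>\<phi>\<in>torus_test. ((\<lambda>i. X \<omega> i * cf i \<phi>) has_sum w \<omega> \<phi>) idx)"
  let ?c = "\<lambda>j G m. complex_of_real (2 powr (real (j + L) * real CARD('d) / 2) * X \<omega> (j, G, m))"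
  have idx: "{(j, G, m). G \<in> wavelet_kinds j \<and> m \<in> wavelet_shifts L j} = idx" by (auto simp: idx_def)
  have "((\<lambda>(j, G, m). ?c j G m * of_real (2 powr (- real (j + L) * real CARD('d) / 2) *
               (LINT r:cbox 0 1|lborel. periodic_wavelet F M L j G m r * \<phi> r)))
           has_sum of_real (w \<omega> \<phi>)) idx" if \<phi>: "\<phi> \<in> torus_test" for \<phi>
  proof -
    have "((\<lambda>i. complex_of_real (X \<omega> i * cf i \<phi>)) has_sum of_real (w \<omega> \<phi>)) idx"
      using h \<phi> by (intro has_sum_of_real) blast
    moreover have eq: "?c j G m * of_real (2 powr (- real (j + L) * real CARD('d) / 2) *
               (LINT r:cbox 0 1|lborel. periodic_wavelet F M L j G m r * \<phi> r)) = complex_of_real (X \<omega> (j, G, m) * cf (j, G, m) \<phi>)" for j G m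
    proof -
      have "2 powr (real (j + L) * real CARD('d) / 2) * 2 powr (- real (j + L) * real CARD('d) / 2) = (1::real)"
        unfolding powr_add[symmetric]
        by (simp only: mult_minus_left minus_divide_left[symmetric] add.right_inverse) simp
      then have eq: "2 powr (real (j + L) * real CARD('d) / 2) * y * (2 powr (- real (j + L) * real CARD('d) / 2) * z) = y * z" for y z :: real
        by (metis mult.assoc mult.commute mult_1)
      then show ?thesis unfolding of_real_mult[symmetric] cf_eq \<Psi>_def by (simp only: prod.case eq)
    qed
    have "(\<lambda>(j, G, m). ?c j G m * of_real (2 powr (- real (j + L) * real CARD('d) / 2) *
               (LINT r:cbox 0 1|lborel. periodic_wavelet F M L j G m r * \<phi> r))) = (\<lambda>i. complex_of_real (X \<omega> i * cf i \<phi>))"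
    proof
      fix i :: "'d index"
      obtain j G m where i: "i = (j, G, m)" by (cases i)
      show "(case i of (j, G, m) \<Rightarrow> ?c j G m * of_real (2 powr (- real (j + L) * real CARD('d) / 2) *
               (LINT r:cbox 0 1|lborel. periodic_wavelet F M L j G m r * \<phi> r))) = complex_of_real (X \<omega> i * cf i \<phi>)"
        unfolding i prod.case by (rule eq)
    qed
    ultimately show ?thesis by (simp only:)
  qed
  then show "w \<omega> \<in> besov_space F M L \<tau> p q"
    unfolding besov_space_def idx using w_dual[OF \<omega>] good_imp_besov[OF _ p q \<tau>] h by blast
qed

end

section \<open>Choice of the weight exponent and conclusion\<close>

lemma cont_diff_imp_continuous: "cont_diff k f \<Longrightarrow> continuous_on UNIV f"
proof (induction k)
  case (Suc k)
  from Suc.IH[OF cont_diff_Suc_D[OF Suc.prems]] show ?case .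
qed simp

lemma bump_exists:
  assumes "continuous_on UNIV \<psi>" "compact (closure {x. \<psi> x \<noteq> 0})"
  shows "\<exists>B0. \<forall>B\<ge>B0. bump B \<psi>"
proof -
  obtain r where r: "\<And>x. x \<in> closure {x. \<psi> x \<noteq> 0} \<Longrightarrow> \<bar>x\<bar> \<le> r"
    using compact_imp_bounded[OF assms(2)] unfolding bounded_iff by auto
  obtain B0 :: nat where B0: "r \<le> real B0" using real_arch_simple by blast
  have "bump B \<psi>" if "B \<ge> B0" for B
    unfolding bump_def
  proof (intro conjI allI impI assms(1))
    fix x assume x: "real B < \<bar>x\<bar>"
    show "\<psi> x = 0"
    proof (rule ccontr)
      assume "\<psi> x \<noteq> 0"
      then have "\<bar>x\<bar> \<le> r" by (intro r subsetD[OF closure_subset]) simp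
      then show False using x B0 that by linarith
    qed
  qed
  then show ?thesis by blast
qed

theorem corollary3:
  fixes P :: "'w measure" and w :: "'w \<Rightarrow> (real^'d \<Rightarrow> real) \<Rightarrow> real"
    and p q :: ennreal and \<tau> :: real
    and u L :: nat and \<psi>F \<psi>M :: "real \<Rightarrow> real"
  assumes noise: "periodic_levy_noise P w"
    and pos: "0 < p" "0 < q"
    and tau: "\<tau> < real CARD('d) * (recip (max p 2) - 1)"
    and wavelets: "wavelet_system u \<psi>F \<psi>M" "torus_scale \<psi>F \<psi>M L"
    and regularity: "real u > max \<tau> (real CARD('d) * max (recip p - 1) 0 - \<tau>)"
  shows "AE \<omega> in P. w \<omega> \<in> besov_space \<psi>F \<psi>M L \<tau> p q"
proof -
  define d where "d = real CARD('d)"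
  have d: "d > 0" by (simp add: d_def)
  have t: "\<tau> < d * (min (recip p) (1 / 2) - 1)"
    using tau recip_max_2[OF pos(1)] by (simp add: d_def)
  have "d * (min (recip p) (1 / 2) - 1) \<le> d * (- 1 / 2)" using d by (intro mult_left_mono) auto
  then have "\<tau> < - d / 2" using t by simp
  have "0 \<le> d * max (recip p - 1) 0" using d by simp
  moreover have "d * max (recip p - 1) 0 - \<tau> < real u" using regularity by (simp add: d_def)
  ultimately have "- \<tau> < real u" by linarith
  \<comment> \<open>The regularity requirement exceeds \<open>- \<tau>\<close>, and
    \<open>\<tau>\<close> lies below \<open>- d / 2\<close> for every \<open>p\<close>.\<close>
  then have u: "d / 2 < real u" using \<open>\<tau> < - d / 2\<close> by linarith
  have "d / 2 < d * (min (recip p) (1 / 2) - 1 / 2) - \<tau>" using t by (simp add: algebra_simps)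
  \<comment> \<open>The third bound is what the Besov norm demands; its compatibility with
    \<open>d / 2 < s\<close> is exactly the hypothesis on \<open>\<tau>\<close>.\<close>
  then obtain s where s_bounds: "d / 2 < s" "s < real u" "s < d * (min (recip p) (1 / 2) - 1 / 2) - \<tau>"
    using u dense[of "d / 2" "min (real u) (d * (min (recip p) (1 / 2) - 1 / 2) - \<tau>)"] by auto
  obtain B1 B2 where B1: "\<And>B. B \<ge> B1 \<Longrightarrow> bump B \<psi>F" and B2: "\<And>B. B \<ge> B2 \<Longrightarrow> bump B \<psi>M"
    using bump_exists[OF cont_diff_imp_continuous, of u \<psi>F] bump_exists[OF cont_diff_imp_continuous, of u \<psi>M] wavelets(1)
    unfolding wavelet_system_def by blast
  interpret noise_wavelets P w \<psi>F \<psi>M "max B1 B2" L u s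
  proof
    show "periodic_levy_noise P w" by (rule noise)
    show "bump (max B1 B2) \<psi>F" "bump (max B1 B2) \<psi>M" using B1 B2 by simp_all
    show "0 < u" using u d by (cases u) auto
    show "real CARD('d) / 2 < s" "s < real u" using s_bounds by (simp_all add: d_def)
    show "\<exists>h :: int \<Rightarrow> real. finite {k. h k \<noteq> 0} \<and>
        (\<forall>x. \<psi>F x = (\<Sum>k | h k \<noteq> 0. h k * sqrt 2 * \<psi>F (2 * x - of_int k)))"
      "\<exists>g :: int \<Rightarrow> real. finite {k. g k \<noteq> 0} \<and>
        (\<forall>x. \<psi>M x = (\<Sum>k | g k \<noteq> 0. g k * sqrt 2 * \<psi>F (2 * x - of_int k)))"
      "orthonormal_basis_L2 (line_wavelet \<psi>F \<psi>M)"
      "\<And>v. v < u \<Longrightarrow> (LINT x|lborel. x ^ v * \<psi>M x) = 0"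
      using wavelets(1) unfolding wavelet_system_def by blast+
  qed
  show ?thesis
    by (rule AE_in_besov_space[OF pos]) (use s_bounds(3) in \<open>simp add: d_def\<close>)
qed

end
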